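(* Let $n\ge1$. Assume that $\Omega\subset\mathbb{R}^{n+1}$ is a bounded domain with $C^1$ boundary and that $\beta$ satisfies $0\le\beta\le\frac{2(n+1)}{n-1}$ if $n\ge2$, or $\beta\ge0$ if $n=1$. If $\mu_{n+1,\beta}(\Omega)<\mu^*_{n+1,\beta}$, then $\mu_{n+1,\beta}(\Omega)$ is achieved in $W^{1,2}_0(\Omega)$.
   Context: For a domain $\Omega\subset\mathbb{R}^{n+1}$ let $\delta_\Omega(x)=\operatorname{dist}(x,\partial\Omega)$, and define $$J_{n+1,\beta,\Omega}[u]=\frac{\int_\Omega|\nabla u|^2\,dx}{\Big(\int_\Omega\delta_\Omega^{-2+\frac{n-1}{n+1}\beta}|u|^{2+\frac{2\beta}{n+1}}\,dx\Big)^{\frac{n+1}{n+\beta+1}}},\qquad \mu_{n+1,\beta}(\Omega)=\inf_{u\in C_0^\infty(\Omega)\setminus\{0\}}J_{n+1,\beta,\Omega}[u].$$ $\mu^*_{n+1,\beta}=\mu_{n+1,\beta}(\mathbb{R}^{n+1}_+)$, where $\mathbb{R}^{n+1}_+=\{(y,t):y\in\mathbb{R}^n,\ t>0\}$. "$\mu_{n+1,\beta}(\Omega)$ is achieved in $W^{1,2}_0(\Omega)$" means that there is a nonzero $u\in W^{1,2}_0(\Omega)$ with $J_{n+1,\beta,\Omega}[u]=\mu_{n+1,\beta}(\Omega)$. *)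

theory Defs
  imports "HOL-Analysis.Analysis"
begin

text \<open>
  The space \<open>(real^'n) \<times> real\<close>, whose norm and Lebesgue measure are the Euclidean ones, plays the
  role of \<open>R^(n+1)\<close> with \<open>n = CARD('n) \<ge> 1\<close>; its points are the pairs \<open>(y, t)\<close>.
\<close>

definition half_space :: "((real^'n) \<times> real) set" where
  "half_space = {(y, t). t > 0}"

definition gradient :: "('a::euclidean_space \<Rightarrow> real) \<Rightarrow> 'a \<Rightarrow> 'a" where
  "gradient f x = (\<Sum>i\<in>Basis. frechet_derivative f (at x) i *\<^sub>R i)"

primrec Ck :: "nat \<Rightarrow> ('a::euclidean_space \<Rightarrow> real) \<Rightarrow> bool" where
  "Ck 0 f \<longleftrightarrow> continuous_on UNIV f"
| "Ck (Suc k) f \<longleftrightarrow>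
     (\<forall>x. f differentiable (at x)) \<and> (\<forall>i\<in>Basis. Ck k (\<lambda>x. frechet_derivative f (at x) i))"

text \<open>Elements of \<open>C_0^\<infinity>(\<Omega>)\<close> are represented by their extension by zero to the whole space.\<close>

definition test_functions :: "'a::euclidean_space set \<Rightarrow> ('a \<Rightarrow> real) set" where
  "test_functions \<Omega> =
     {\<phi>. (\<forall>k. Ck k \<phi>) \<and> compact (closure {x. \<phi> x \<noteq> 0}) \<and> closure {x. \<phi> x \<noteq> 0} \<subseteq> \<Omega>}"

text \<open>
  Near each boundary point, after an orthogonal change of coordinates, the set is the part of a
  ball above the graph of a \<open>C^1\<close> function.
\<close>

definition C1_boundary :: "((real^'n) \<times> real) set \<Rightarrow> bool" where
  "C1_boundary \<Omega> \<longleftrightarrow>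
     (\<forall>x0\<in>frontier \<Omega>. \<exists>r>0. \<exists>T (\<gamma> :: real^'n \<Rightarrow> real). orthogonal_transformation T \<and> Ck 1 \<gamma> \<and>
        \<Omega> \<inter> ball x0 r = {x \<in> ball x0 r. snd (T x) > \<gamma> (fst (T x))})"

definition L2_on :: "'a::euclidean_space set \<Rightarrow> ('a \<Rightarrow> 'b::euclidean_space) \<Rightarrow> bool" where
  "L2_on \<Omega> f \<longleftrightarrow>
     f \<in> borel_measurable (lebesgue_on \<Omega>) \<and> integrable (lebesgue_on \<Omega>) (\<lambda>x. (norm (f x))\<^sup>2)"

definition locally_integrable_on ::
    "('a::euclidean_space \<Rightarrow> 'b::euclidean_space) \<Rightarrow> 'a set \<Rightarrow> bool" where
  "locally_integrable_on f \<Omega> \<longleftrightarrow> (\<forall>K. compact K \<and> K \<subseteq> \<Omega> \<longrightarrow> integrable (lebesgue_on K) f)"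

definition has_weak_gradient ::
    "'a::euclidean_space set \<Rightarrow> ('a \<Rightarrow> real) \<Rightarrow> ('a \<Rightarrow> 'a) \<Rightarrow> bool" where
  "has_weak_gradient \<Omega> u g \<longleftrightarrow>
     locally_integrable_on u \<Omega> \<and> locally_integrable_on g \<Omega> \<and>
     (\<forall>\<phi>\<in>test_functions \<Omega>. \<forall>i\<in>Basis.
        (LINT x|lebesgue_on \<Omega>. u x * (gradient \<phi> x \<bullet> i)) =
        - (LINT x|lebesgue_on \<Omega>. (g x \<bullet> i) * \<phi> x))"

definition W12 :: "'a::euclidean_space set \<Rightarrow> ('a \<Rightarrow> real) set" where
  "W12 \<Omega> = {u. L2_on \<Omega> u \<and> (\<exists>g. has_weak_gradient \<Omega> u g \<and> L2_on \<Omega> g)}"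

text \<open>The closure of \<open>C_0^\<infinity>(\<Omega>)\<close> in \<open>W^(1,2)(\<Omega>)\<close>.\<close>

definition W12_0 :: "'a::euclidean_space set \<Rightarrow> ('a \<Rightarrow> real) set" where
  "W12_0 \<Omega> =
     {u \<in> W12 \<Omega>. \<exists>g \<phi>. has_weak_gradient \<Omega> u g \<and> L2_on \<Omega> g \<and>
        (\<forall>k::nat. \<phi> k \<in> test_functions \<Omega>) \<and>
        (\<lambda>k. LINT x|lebesgue_on \<Omega>. (\<phi> k x - u x)\<^sup>2) \<longlonglongrightarrow> 0 \<and>
        (\<lambda>k. LINT x|lebesgue_on \<Omega>. (norm (gradient (\<phi> k) x - g x))\<^sup>2) \<longlonglongrightarrow> 0}"

definition weighted_density ::
    "real \<Rightarrow> ((real^'n) \<times> real) set \<Rightarrow> ((real^'n) \<times> real \<Rightarrow> real) \<Rightarrow> (real^'n) \<times> real \<Rightarrow> real" where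
  "weighted_density \<beta> \<Omega> u x =
     (let n = real CARD('n) in
      infdist x (frontier \<Omega>) powr (- 2 + (n - 1) / (n + 1) * \<beta>) *
      \<bar>u x\<bar> powr (2 + 2 * \<beta> / (n + 1)))"

text \<open>
  The quotient \<open>J[u]\<close>; the argument \<open>g\<close> stands for \<open>\<nabla>u\<close>, which is the classical gradient for
  test functions and a weak gradient (determined only almost everywhere) for Sobolev functions.
\<close>

definition J ::
    "real \<Rightarrow> ((real^'n) \<times> real) set \<Rightarrow> ((real^'n) \<times> real \<Rightarrow> real) \<Rightarrow>
     ((real^'n) \<times> real \<Rightarrow> (real^'n) \<times> real) \<Rightarrow> real" where
  "J \<beta> \<Omega> u g =
     (let n = real CARD('n) in
      (LINT x|lebesgue_on \<Omega>. (norm (g x))\<^sup>2) /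
      (LINT x|lebesgue_on \<Omega>. weighted_density \<beta> \<Omega> u x) powr ((n + 1) / (n + \<beta> + 1)))"

definition \<mu> :: "real \<Rightarrow> ((real^'n) \<times> real) set \<Rightarrow> real" where
  "\<mu> \<beta> \<Omega> = (INF u\<in>test_functions \<Omega> - {\<lambda>x. 0}. J \<beta> \<Omega> u (gradient u))"

text \<open>
  The denominator of \<open>J[u]\<close> is required to be finite because the library integral of a
  non-integrable function is \<open>0\<close>; the numerator is finite for every \<open>u\<close> in \<open>W_0^(1,2)\<close>.
  Nonzero means nonzero as an element of \<open>W_0^(1,2)\<close>, that is, not almost everywhere zero.
\<close>

definition \<mu>_achieved :: "real \<Rightarrow> ((real^'n) \<times> real) set \<Rightarrow> bool" where
  "\<mu>_achieved \<beta> \<Omega> \<longleftrightarrow>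
     (\<exists>u\<in>W12_0 \<Omega>. \<exists>g.
        \<not> (AE x in lebesgue_on \<Omega>. u x = 0) \<and>
        has_weak_gradient \<Omega> u g \<and>
        integrable (lebesgue_on \<Omega>) (weighted_density \<beta> \<Omega> u) \<and>
        J \<beta> \<Omega> u g = \<mu> \<beta> \<Omega>)"

end

theory Submission
  imports Defs "HOL-Complex_Analysis.Great_Picard"
begin

text \<open>
  Write \<open>\<Phi>(u)\<close> for the weighted integral in the denominator of \<open>J\<close>, \<open>E(u)\<close> for the Dirichlet integral,
  \<open>s \<le> 1\<close> for the exponent of \<open>\<Phi>\<close> and \<open>\<mu>\<close>, \<open>\<mu>*\<close> for the two infima. Near every point of the closure,
  a volume-preserving and almost isometric chart into the half-space gives \<open>\<mu>* \<Phi>(u)^s \<le> (1 + e)^4 E(u)\<close>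
  for functions supported there. A partition of unity and Minkowski's inequality turn this into
  \<open>\<kappa> \<Phi>(u)^s \<le> E(u) + C \<parallel>u\<parallel>^2\<close>, with the \<open>L^2\<close> norm, for some \<open>\<kappa>\<close> with \<open>\<mu> < \<kappa> < \<mu>*\<close>.

  Let \<open>v\<close> be a minimizing sequence with \<open>\<Phi> = 1\<close> which converges to \<open>u\<close> in \<open>L^2\<close> and almost everywhere.
  Almost-minimizers \<open>x l\<close> of \<open>E\<close> over the convex hulls of its tails converge strongly to \<open>u\<close>, and
  \<open>E(v m - x l)\<close> is asymptotically at most \<open>\<mu> - E(u)\<close>. Fatou's lemma shows that \<open>\<Phi>(v m - x l)\<close> is
  asymptotically at least \<open>1 - \<Phi>(u)\<close>. Hence \<open>\<kappa> (1 - \<Phi>(u))^s \<le> \<mu> - E(u) \<le> \<mu> - \<mu> \<Phi>(u)^s\<close>, and since \<open>\<mu> < \<kappa>\<close>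
  and \<open>s \<le> 1\<close> this forces \<open>\<Phi>(u) = 1\<close> and \<open>E(u) = \<mu>\<close>.
\<close>

section \<open>Gradients and functions of class \<open>C^k\<close>\<close>

text \<open>The quotient on the half-space is invariant under dilations, so a minimizing sequence
  may concentrate at a point, and neither \<open>L^2\<close> nor pointwise convergence keeps \<Phi>
  from dropping in the limit. The strict gap decides this: lost mass costs at least \<kappa>, kept
  mass only \<mu>. For \<beta> = 0 one has s = 1, subadditivity of \<open>t^s\<close> degenerates to
  an equality, and the gap alone forbids the loss. The \<open>L^2\<close> remainder is harmless,
  since it vanishes along the sequence by Rellich compactness. The compared pieces are
  \<open>v m - x l\<close> and not \<open>v m - u\<close>, because the inequalities are stated for
  test functions. Strong convergence of \<open>x l\<close> gives membership in
  \<open>W_0^(1,2)\<close> directly, and near-minimality along a segment gives the energy splitting;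
  the splitting of \<Phi> is a one-sided Brezis-Lieb lemma resting on convexity of
  \<open>t^p\<close>. The range of \<beta> makes the weight a nonpositive power of the distance, so
  a chart only has to keep the new height below (1 + e) times the distance.\<close>

lemma has_derivative_gradient:
  assumes "f differentiable (at x)"
  shows "(f has_derivative (\<lambda>h. gradient f x \<bullet> h)) (at x)"
proof -
  have d: "(f has_derivative frechet_derivative f (at x)) (at x)"
    using assms frechet_derivative_works by blast
  then interpret bounded_linear "frechet_derivative f (at x)"
    by (rule has_derivative_bounded_linear)
  have "frechet_derivative f (at x) = (\<lambda>h. gradient f x \<bullet> h)"
  proof
    fix h
    have "frechet_derivative f (at x) h = frechet_derivative f (at x) (\<Sum>i\<in>Basis. (h \<bullet> i) *\<^sub>R i)"
      by (simp add: euclidean_representation)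
    also have "\<dots> = gradient f x \<bullet> h"
      by (simp add: gradient_def sum scaleR inner_sum_left inner_commute[of h] mult.commute)
    finally show "frechet_derivative f (at x) h = gradient f x \<bullet> h" .
  qed
  then show ?thesis using d by simp
qed

lemma gradient_eqI:
  assumes "(f has_derivative (\<lambda>h. v \<bullet> h)) (at x)"
  shows "gradient f x = v"
proof -
  have "frechet_derivative f (at x) = (\<lambda>h. v \<bullet> h)"
    using assms frechet_derivative_at by metis
  then show ?thesis
    by (simp add: gradient_def euclidean_representation)
qed

lemma gradient_inner_Basis:
  "i \<in> Basis \<Longrightarrow> gradient f x \<bullet> i = frechet_derivative f (at x) i"
  by (simp add: gradient_def)

lemma Ck_1_iff:
  "Ck 1 f \<longleftrightarrow> (\<forall>x. f differentiable (at x)) \<and> continuous_on UNIV (gradient f)"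
proof -
  have "(\<forall>i\<in>Basis. continuous_on UNIV (\<lambda>x. frechet_derivative f (at x) i)) \<longleftrightarrow> continuous_on UNIV (gradient f)"
  proof
    assume "\<forall>i\<in>Basis. continuous_on UNIV (\<lambda>x. frechet_derivative f (at x) i)"
    then show "continuous_on UNIV (gradient f)"
      unfolding gradient_def by (intro continuous_intros) auto
  next
    assume c: "continuous_on UNIV (gradient f)"
    show "\<forall>i\<in>Basis. continuous_on UNIV (\<lambda>x. frechet_derivative f (at x) i)"
    proof
      fix i :: 'a assume "i \<in> Basis"
      then have "(\<lambda>x. frechet_derivative f (at x) i) = (\<lambda>x. gradient f x \<bullet> i)"
        by (simp add: gradient_inner_Basis)
      then show "continuous_on UNIV (\<lambda>x. frechet_derivative f (at x) i)"
        using continuous_on_inner[OF c continuous_on_const[of _ i]] by (simp only:)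
    qed
  qed
  then show ?thesis by (simp add: One_nat_def)
qed

lemma Ck_1I:
  assumes "\<And>x. (f has_derivative (\<lambda>h. G x \<bullet> h)) (at x)" and "continuous_on UNIV G"
  shows "Ck 1 f" and "gradient f = G"
proof -
  show g: "gradient f = G"
    using gradient_eqI[OF assms(1)] by auto
  show "Ck 1 f"
    unfolding Ck_1_iff g using assms(1,2) differentiableI by blast
qed

lemma Ck_1_differentiable: "Ck 1 f \<Longrightarrow> f differentiable (at x)"
  using Ck_1_iff by blast

lemma Ck_1_has_derivative: "Ck 1 f \<Longrightarrow> (f has_derivative (\<lambda>h. gradient f x \<bullet> h)) (at x)"
  by (simp add: Ck_1_differentiable has_derivative_gradient)

lemma Ck_1_continuous_gradient: "Ck 1 f \<Longrightarrow> continuous_on UNIV (gradient f)"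
  using Ck_1_iff by blast

lemma Ck_1_continuous: "Ck 1 f \<Longrightarrow> continuous_on UNIV f"
  by (metis Ck_1_differentiable differentiable_imp_continuous_within continuous_at_imp_continuous_on)

lemma Ck_Suc_imp: "Ck (Suc k) f \<Longrightarrow> Ck k f"
proof (induction k arbitrary: f)
  case 0
  then have "\<forall>x. f differentiable (at x)" by simp
  then show ?case
    by (simp add: continuous_at_imp_continuous_on differentiable_imp_continuous_within)
next
  case (Suc k)
  then show ?case by (metis Ck.simps(2))
qed

lemma Ck_add: "Ck k f \<Longrightarrow> Ck k g \<Longrightarrow> Ck k (\<lambda>x. f x + g x)"
proof (induction k arbitrary: f g)
  case 0 then show ?case by (auto intro: continuous_intros)
next
  case (Suc k)
  then have d: "f differentiable at x" "g differentiable at x" for x by auto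
  have "frechet_derivative (\<lambda>x. f x + g x) (at x) =
     (\<lambda>i. frechet_derivative f (at x) i + frechet_derivative g (at x) i)" for x
    by (rule frechet_derivative_at[symmetric], rule has_derivative_add)
       (use d frechet_derivative_works in blast)+
  then show ?case using Suc d by auto
qed

lemma Ck_const: "Ck k (\<lambda>x. c)"
proof (induction k arbitrary: c)
  case (Suc k)
  have "frechet_derivative (\<lambda>x. c) (at x) = (\<lambda>i. 0)" for x :: 'a
    by simp
  then show ?case using Suc[of 0] by simp
qed simp

lemma Ck_mult: "Ck k f \<Longrightarrow> Ck k g \<Longrightarrow> Ck k (\<lambda>x. f x * g x)"
proof (induction k arbitrary: f g)
  case 0 then show ?case by (auto intro: continuous_intros)
next
  case (Suc k)
  then have d: "f differentiable at x" "g differentiable at x" for x by auto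
  have "((\<lambda>x. f x * g x) has_derivative
     (\<lambda>i. f x * frechet_derivative g (at x) i + frechet_derivative f (at x) i * g x)) (at x)" for x
    using d by (intro has_derivative_mult) (auto simp: frechet_derivative_works)
  then have *: "frechet_derivative (\<lambda>x. f x * g x) (at x) =
     (\<lambda>i. f x * frechet_derivative g (at x) i + frechet_derivative f (at x) i * g x)" for x
    by (rule frechet_derivative_at[symmetric])
  have f: "Ck k f" and g: "Ck k g" using Suc.prems Ck_Suc_imp by blast+
  have "Ck k (\<lambda>x. f x * frechet_derivative g (at x) i + frechet_derivative f (at x) i * g x)" if "i \<in> Basis" for i
  proof (rule Ck_add)
    show "Ck k (\<lambda>x. f x * frechet_derivative g (at x) i)"
      by (rule Suc.IH[OF f]) (use Suc.prems that in simp)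
    show "Ck k (\<lambda>x. frechet_derivative f (at x) i * g x)"
      by (rule Suc.IH[OF _ g]) (use Suc.prems that in simp)
  qed
  moreover have "(\<lambda>x. f x * g x) differentiable at x" for x
    using d by (rule differentiable_mult)
  ultimately show ?case unfolding Ck.simps * by blast
qed

lemma Ck_cmult: "Ck k f \<Longrightarrow> Ck k (\<lambda>x. c * f x)"
  by (rule Ck_mult[OF Ck_const])

lemma Ck_inner_Basis: "Ck k (\<lambda>x::'a::euclidean_space. x \<bullet> b)"
proof (cases k)
  case (Suc m)
  have D: "((\<lambda>x::'a. x \<bullet> b) has_derivative (\<lambda>h. h \<bullet> b)) (at x)" for x
    by (auto intro!: derivative_eq_intros)
  have "frechet_derivative (\<lambda>x::'a. x \<bullet> b) (at x) = (\<lambda>h. h \<bullet> b)" for x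
    by (rule frechet_derivative_at[symmetric, OF D])
  moreover have "(\<lambda>x::'a. x \<bullet> b) differentiable (at x)" for x
    using D differentiableI by blast
  ultimately show ?thesis using Suc by (simp add: Ck_const)
qed (auto intro: continuous_intros)

subsection \<open>A smooth bump function\<close>

text \<open>The parameter \<open>m\<close> closes the family under differentiation: the derivative
  of \<open>exp_bump m\<close> combines \<open>exp_bump (m + 1)\<close> and
  \<open>exp_bump (m + 2)\<close>, so smoothness can be proved by induction for all \<open>m\<close>
  at once. The bump itself is the case \<open>m = 0\<close>.\<close>

definition exp_bump :: "nat \<Rightarrow> real \<Rightarrow> real" where
  "exp_bump m t = (if t > 0 then (1 / t) ^ m * exp (- (1 / t)) else 0)"

text \<open>A single term of the exponential series at \<open>1 / t\<close> beats
  \<open>(1 / t) ^ (m + k)\<close>. The surplus factor \<open>\<bar>t\<bar> ^ k\<close> measures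
  flatness at 0; \<open>k = 2\<close> is enough for the derivative there.\<close>

lemma exp_bump_le: "0 \<le> exp_bump m t" "exp_bump m t \<le> fact (m + k) * \<bar>t\<bar> ^ k"
proof -
  show "0 \<le> exp_bump m t" by (simp add: exp_bump_def)
  show "exp_bump m t \<le> fact (m + k) * \<bar>t\<bar> ^ k"
  proof (cases "t > 0")
    case True
    define s where "s = 1 / t"
    have s: "s > 0" using True by (simp add: s_def)
    have "s ^ (m + k) / fact (m + k) \<le> exp s"
    proof -
      have "(\<Sum>n<Suc (m+k). s ^ n / fact n) \<le> exp s"
        using s summable_exp[of s] unfolding exp_def
        by (intro order_trans[OF sum_le_suminf[of _ "{..<Suc (m+k)}"]]) (auto simp: divide_inverse mult.commute)
      moreover have "s ^ (m + k) / fact (m + k) \<le> (\<Sum>n<Suc (m+k). s ^ n / fact n)"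
        using s by (intro member_le_sum) auto
      ultimately show ?thesis by simp
    qed
    then have "s ^ (m+k) * exp (-s) \<le> fact (m+k)"
      by (simp add: exp_minus field_simps)
    moreover have "s ^ m * exp (-s) = (s ^ (m+k) * exp (-s)) * t ^ k"
    proof -
      have "s ^ k * t ^ k = 1" using True by (simp add: s_def flip: power_mult_distrib)
      then show ?thesis by (simp add: power_add mult.assoc mult.left_commute[of _ "exp (-s)"])
    qed
    ultimately show ?thesis
      using True by (simp add: exp_bump_def s_def mult_right_mono)
  qed (simp add: exp_bump_def)
qed

lemma exp_bump_has_derivative:
  "(exp_bump m has_field_derivative exp_bump (m + 2) t - m * exp_bump (m + 1) t) (at t)"
proof -
  consider "t > 0" | "t < 0" | "t = 0" by linarith
  then show ?thesis
  proof cases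
    case 1
    have "((\<lambda>t. (1 / t) ^ m * exp (- (1 / t))) has_field_derivative
        exp_bump (m + 2) t - m * exp_bump (m + 1) t) (at t)"
    proof -
      define u where "u = 1 / t"
      have D: "((\<lambda>t. 1 / t) has_field_derivative - (u^2)) (at t)"
        using 1 by (auto intro!: derivative_eq_intros simp: u_def power2_eq_square)
      have "((\<lambda>t. (1 / t) ^ m * exp (- (1 / t))) has_field_derivative
          u ^ m * (exp (- u) * u^2) + (real m * (- (u^2) * u ^ (m - Suc 0))) * exp (- u)) (at t)"
        using DERIV_mult[OF DERIV_power[OF D, of m] DERIV_fun_exp[OF DERIV_minus[OF D]]]
        by (simp add: u_def mult_ac)
      moreover have "u ^ m * (exp (- u) * u^2) + (real m * (- (u^2) * u ^ (m - Suc 0))) * exp (- u)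
          = exp_bump (m + 2) t - m * exp_bump (m + 1) t"
      proof -
        have A: "real m * (- (u^2) * u ^ (m - Suc 0)) = - (real m * u ^ (m + 1))"
          by (cases m) (simp_all add: power2_eq_square)
        have B: "exp_bump j t = u ^ j * exp (- u)" for j
          using 1 by (simp add: exp_bump_def u_def)
        show ?thesis unfolding A B power_add by simp
      qed
      ultimately show ?thesis by simp
    qed
    then show ?thesis
      by (rule has_field_derivative_transform_within_open[where S="{0<..}"])
         (use 1 in \<open>auto simp: exp_bump_def\<close>)
  next
    case 2
    have "((\<lambda>t. 0) has_field_derivative exp_bump (m + 2) t - m * exp_bump (m + 1) t) (at t)"
      using 2 by (simp add: exp_bump_def)
    then show ?thesis
      by (rule has_field_derivative_transform_within_open[where S="{..<0}"])
         (use 2 in \<open>auto simp: exp_bump_def\<close>)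
  next
    case 3
    \<comment> \<open>At the junction the quadratic bound makes the difference quotient at most
      linear in \<open>h\<close>, which settles both one-sided limits together.\<close>
    have "((\<lambda>h. exp_bump m h / h) \<longlongrightarrow> 0) (at 0)"
    proof (rule Lim_null_comparison)
      show "\<forall>\<^sub>F h in at 0. norm (exp_bump m h / h) \<le> fact (m + 2) * \<bar>h\<bar>"
      proof (rule eventuallyI)
        fix h :: real
        have "\<bar>exp_bump m h\<bar> \<le> fact (m+2) * \<bar>h\<bar> ^ 2"
          using exp_bump_le(1)[of m h] exp_bump_le(2)[of m h 2] by simp
        then show "norm (exp_bump m h / h) \<le> fact (m + 2) * \<bar>h\<bar>"
          by (cases "h = 0") (simp_all add: pos_divide_le_eq power2_eq_square mult.assoc)
      qed
      have "((\<lambda>h::real. fact (m + 2) * \<bar>h\<bar>) \<longlongrightarrow> fact (m+2) * \<bar>0\<bar>) (at 0)"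
        by (intro tendsto_intros)
      then show "((\<lambda>h::real. fact (m + 2) * \<bar>h\<bar>) \<longlongrightarrow> 0) (at 0)" by simp
    qed
    moreover have "exp_bump j 0 = 0" for j by (simp add: exp_bump_def)
    ultimately show ?thesis using 3 by (simp add: DERIV_def)
  qed
qed

text \<open>\<open>x \<bullet> x\<close> is a polynomial, so each partial derivative is a
  combination of functions of the same kind times a linear one. The induction has to be general in
  \<open>m\<close>, which grows with every derivative.\<close>

lemma Ck_exp_bump: "Ck k (\<lambda>x::'a::euclidean_space. exp_bump m (1 - x \<bullet> x))"
proof (induction k arbitrary: m)
  case 0
  have "continuous_on UNIV (exp_bump m)"
    using DERIV_isCont[OF exp_bump_has_derivative] by (simp add: continuous_at_imp_continuous_on)
  then have "continuous_on UNIV (\<lambda>x::'a. exp_bump m (1 - x \<bullet> x))"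
    by (rule continuous_on_compose2) (auto intro!: continuous_intros)
  then show ?case by simp
next
  case (Suc k)
  have D: "((\<lambda>x::'a. exp_bump m (1 - x \<bullet> x)) has_derivative
     (\<lambda>h. (exp_bump (m + 2) (1 - x \<bullet> x) + (- real m) * exp_bump (m + 1) (1 - x \<bullet> x)) * ((-2) * (x \<bullet> h)))) (at x)" for x
  proof -
    have 1: "((\<lambda>x::'a. 1 - x \<bullet> x) has_derivative (\<lambda>h. (-2) * (x \<bullet> h))) (at x)"
      by (auto intro!: derivative_eq_intros simp: inner_commute)
    have "((\<lambda>x::'a. exp_bump m (1 - x \<bullet> x)) has_derivative
       (\<lambda>h. (exp_bump (m + 2) (1 - x \<bullet> x) - m * exp_bump (m + 1) (1 - x \<bullet> x)) * ((-2) * (x \<bullet> h)))) (at x)"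
      by (rule has_derivative_compose[OF 1 exp_bump_has_derivative[unfolded has_field_derivative_def]])
    then show ?thesis by simp
  qed
  show ?case
    unfolding Ck.simps
  proof (intro conjI allI ballI)
    fix x :: 'a show "(\<lambda>x::'a. exp_bump m (1 - x \<bullet> x)) differentiable (at x)"
      using D differentiableI by blast
  next
    fix i :: 'a assume "i \<in> Basis"
    have "frechet_derivative (\<lambda>x::'a. exp_bump m (1 - x \<bullet> x)) (at x) =
      (\<lambda>h. (exp_bump (m + 2) (1 - x \<bullet> x) + (- real m) * exp_bump (m + 1) (1 - x \<bullet> x)) * ((-2) * (x \<bullet> h)))" for x
      using D by (rule frechet_derivative_at[symmetric])
    then show "Ck k (\<lambda>x. frechet_derivative (\<lambda>x::'a. exp_bump m (1 - x \<bullet> x)) (at x) i)"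
      by (simp only:) (rule Ck_mult[OF Ck_add[OF Suc Ck_cmult[OF Suc]] Ck_cmult[OF Ck_inner_Basis]])
  qed
qed

section \<open>Gradient rules and C^1 functions with compact support\<close>

lemma gradient_add:
  assumes "f differentiable at x" and "g differentiable at x"
  shows "gradient (\<lambda>x. f x + g x) x = gradient f x + gradient g x"
  using has_derivative_add[OF assms[THEN has_derivative_gradient]]
  by (rule_tac gradient_eqI) (simp add: inner_add_left)

lemma gradient_cmult:
  assumes "f differentiable at x"
  shows "gradient (\<lambda>x. c * f x) x = c *\<^sub>R gradient f x"
  using has_derivative_mult_right[OF assms[THEN has_derivative_gradient], of c]
  by (intro gradient_eqI) simp

lemma gradient_mult:
  assumes "f differentiable at x" and "g differentiable at x"
  shows "gradient (\<lambda>x. f x * g x) x = f x *\<^sub>R gradient g x + g x *\<^sub>R gradient f x"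
  using has_derivative_mult[OF assms[THEN has_derivative_gradient]]
  by (rule_tac gradient_eqI) (simp only: inner_add_left inner_scaleR_left mult.commute)

text \<open>Most estimates use one continuous derivative only. This class survives multiplication by
  the C^1 cutoffs and transport by the C^1 charts below, where smoothness is lost. Naming a compact
  \<open>K\<close> instead of the closed support makes sums and products immediate.\<close>

definition C1c :: "'a::euclidean_space set \<Rightarrow> ('a \<Rightarrow> real) set" where
  "C1c U = {f. Ck 1 f \<and> (\<exists>K. compact K \<and> K \<subseteq> U \<and> (\<forall>x. x \<notin> K \<longrightarrow> f x = 0))}"

lemma closure_support_subset:
  fixes f :: "'a::euclidean_space \<Rightarrow> real"
  assumes "closed K" "\<forall>x. x \<notin> K \<longrightarrow> f x = 0"
  shows "closure {x. f x \<noteq> 0} \<subseteq> K"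
  by (rule closure_minimal) (use assms in blast)+

lemma test_functions_iff:
  "f \<in> test_functions U \<longleftrightarrow> (\<forall>k. Ck k f) \<and> (\<exists>K. compact K \<and> K \<subseteq> U \<and> (\<forall>x. x \<notin> K \<longrightarrow> f x = 0))"
proof
  assume "f \<in> test_functions U"
  then have "compact (closure {x. f x \<noteq> 0})" "closure {x. f x \<noteq> 0} \<subseteq> U" "\<forall>k. Ck k f"
    unfolding test_functions_def by blast+
  moreover have "\<forall>x. x \<notin> closure {x. f x \<noteq> 0} \<longrightarrow> f x = 0"
    using closure_subset[of "{x. f x \<noteq> 0}"] by blast
  ultimately show "(\<forall>k. Ck k f) \<and> (\<exists>K. compact K \<and> K \<subseteq> U \<and> (\<forall>x. x \<notin> K \<longrightarrow> f x = 0))"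
    by blast
next
  assume "(\<forall>k. Ck k f) \<and> (\<exists>K. compact K \<and> K \<subseteq> U \<and> (\<forall>x. x \<notin> K \<longrightarrow> f x = 0))"
  then obtain K where K: "\<forall>k. Ck k f" "compact K" "K \<subseteq> U" "\<forall>x. x \<notin> K \<longrightarrow> f x = 0" by blast
  have s: "closure {x. f x \<noteq> 0} \<subseteq> K"
    using K by (intro closure_support_subset compact_imp_closed)
  then have "compact (closure {x. f x \<noteq> 0})"
    using K(2) by (metis closed_closure compact_Int_closed inf.absorb2)
  then show "f \<in> test_functions U" using s K unfolding test_functions_def by blast
qed

lemma test_functions_C1c: "f \<in> test_functions U \<Longrightarrow> f \<in> C1c U"
  unfolding test_functions_iff C1c_def by blast

lemma test_functions_add:
  assumes "f \<in> test_functions U" "g \<in> test_functions U"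
  shows "(\<lambda>x. f x + g x) \<in> test_functions U"
proof -
  obtain K L where "compact K" "K \<subseteq> U" "\<forall>x. x \<notin> K \<longrightarrow> f x = 0" "compact L" "L \<subseteq> U" "\<forall>x. x \<notin> L \<longrightarrow> g x = 0"
    using assms unfolding test_functions_iff by blast
  then show ?thesis
    using assms unfolding test_functions_iff
    by (intro conjI allI Ck_add exI[of _ "K \<union> L"]) auto
qed

lemma test_functions_cmult:
  assumes "f \<in> test_functions U"
  shows "(\<lambda>x. c * f x) \<in> test_functions U"
proof -
  obtain K where "compact K" "K \<subseteq> U" "\<forall>x. x \<notin> K \<longrightarrow> f x = 0"
    using assms unfolding test_functions_iff by blast
  then show ?thesis
    using assms unfolding test_functions_iff
    by (intro conjI allI Ck_cmult exI[of _ K]) auto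
qed

lemma test_functions_diff:
  assumes "f \<in> test_functions U" "g \<in> test_functions U"
  shows "(\<lambda>x. f x - g x) \<in> test_functions U"
  using test_functions_add[OF assms(1) test_functions_cmult[OF assms(2), of "-1"]] by simp

lemma C1c_mono: "f \<in> C1c U \<Longrightarrow> U \<subseteq> V \<Longrightarrow> f \<in> C1c V"
  unfolding C1c_def by blast

lemma C1c_gradient_zero:
  assumes "closed K" "\<forall>x. x \<notin> K \<longrightarrow> f x = 0" "x \<notin> K"
  shows "gradient f x = 0"
proof (rule gradient_eqI)
  have "((\<lambda>x. 0) has_derivative (\<lambda>h. 0)) (at x)" by simp
  then have "(f has_derivative (\<lambda>h. 0)) (at x)"
    by (rule has_derivative_transform_within_open[where s="- K"]) (use assms in \<open>simp_all add: open_Compl\<close>)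
  then show "(f has_derivative (\<lambda>h. 0 \<bullet> h)) (at x)" by simp
qed

section \<open>Integrals of compactly supported functions\<close>

lemma integrable_compact_support:
  fixes f :: "'a::euclidean_space \<Rightarrow> 'b::{banach, second_countable_topology}"
  assumes "continuous_on UNIV f" "compact K" "\<forall>x. x \<notin> K \<longrightarrow> f x = 0"
  shows "integrable lborel f"
proof -
  have "integrable lborel (\<lambda>x. indicator K x *\<^sub>R f x)"
    using assms by (intro borel_integrable_compact) (auto intro: continuous_on_subset)
  also have "(\<lambda>x. indicator K x *\<^sub>R f x) = f"
    using assms(3) by (auto simp: indicator_def)
  finally show ?thesis .
qed

lemma lborel_distr_translate:
  fixes z :: "'a::euclidean_space" shows "distr lborel borel (\<lambda>x. x + z) = lborel"
  using lborel_distr_plus[of z] by (metis (no_types, lifting) add.commute ext)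

lemma nn_integral_translate:
  fixes z :: "'a::euclidean_space"
  assumes [measurable]: "f \<in> borel_measurable borel"
  shows "(\<integral>\<^sup>+x. f (x + z) \<partial>lborel) = (\<integral>\<^sup>+x. f x \<partial>lborel)"
proof -
  have "(\<integral>\<^sup>+x. f x \<partial>lborel) = (\<integral>\<^sup>+x. f x \<partial>(distr lborel borel (\<lambda>x. x + z)))"
    by (simp add: lborel_distr_translate)
  also have "\<dots> = (\<integral>\<^sup>+x. f (x + z) \<partial>lborel)"
    by (subst nn_integral_distr) auto
  finally show ?thesis by simp
qed

lemma integral_translate:
  fixes z :: "'a::euclidean_space" and f :: "'a \<Rightarrow> 'b::{banach, second_countable_topology}"
  assumes [measurable]: "f \<in> borel_measurable borel"
  shows "(LINT x|lborel. f (x + z)) = (LINT x|lborel. f x)"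
proof -
  have "(LINT x|lborel. f x) = (LINT x|distr lborel borel (\<lambda>x. x + z). f x)"
    by (simp add: lborel_distr_translate)
  also have "\<dots> = (LINT x|lborel. f (x + z))"
    by (subst integral_distr) auto
  finally show ?thesis by simp
qed

lemma C1cE:
  assumes "f \<in> C1c U"
  obtains K where "compact K" "K \<subseteq> U" "\<forall>x. x \<notin> K \<longrightarrow> f x = 0" "\<forall>x. x \<notin> K \<longrightarrow> gradient f x = 0"
    "Ck 1 f" "continuous_on UNIV f" "continuous_on UNIV (gradient f)"
proof -
  obtain K where K: "compact K" "K \<subseteq> U" "\<forall>x. x \<notin> K \<longrightarrow> f x = 0" and c: "Ck 1 f"
    using assms unfolding C1c_def by blast
  have "\<forall>x. x \<notin> K \<longrightarrow> gradient f x = 0"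
    using C1c_gradient_zero[OF compact_imp_closed[OF K(1)] K(3)] by blast
  then show ?thesis using K c Ck_1_continuous Ck_1_continuous_gradient that by blast
qed

section \<open>Dirichlet energy, \<open>L^2\<close> norm and the translation estimate\<close>

definition energy :: "('a::euclidean_space \<Rightarrow> real) \<Rightarrow> real" where
  "energy f = (LINT x|lborel. (norm (gradient f x))\<^sup>2)"

definition sqnorm :: "('a::euclidean_space \<Rightarrow> real) \<Rightarrow> real" where
  "sqnorm f = (LINT x|lborel. (f x)\<^sup>2)"

lemma energy_nonneg: "0 \<le> energy f" and sqnorm_nonneg: "0 \<le> sqnorm f"
  by (simp_all add: energy_def sqnorm_def)

lemma C1c_integrable:
  assumes "f \<in> C1c U"
  shows "integrable lborel f" "integrable lborel (gradient f)"
    "integrable lborel (\<lambda>x. (f x)\<^sup>2)" "integrable lborel (\<lambda>x. (norm (gradient f x))\<^sup>2)"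
    "integrable lborel (\<lambda>x. \<bar>f x\<bar>)"
proof -
  obtain K where K: "compact K" "\<forall>x. x \<notin> K \<longrightarrow> f x = 0" "\<forall>x. x \<notin> K \<longrightarrow> gradient f x = 0"
      "continuous_on UNIV f" "continuous_on UNIV (gradient f)"
    using assms by (rule C1cE)
  have "continuous_on UNIV (\<lambda>x. (f x)\<^sup>2)" "continuous_on UNIV (\<lambda>x. (norm (gradient f x))\<^sup>2)" "continuous_on UNIV (\<lambda>x. \<bar>f x\<bar>)"
    by (intro continuous_intros K)+
  then show "integrable lborel f" "integrable lborel (gradient f)"
    "integrable lborel (\<lambda>x. (f x)\<^sup>2)" "integrable lborel (\<lambda>x. (norm (gradient f x))\<^sup>2)"
    "integrable lborel (\<lambda>x. \<bar>f x\<bar>)"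
    using K by (auto intro!: integrable_compact_support[OF _ K(1)])
qed

lemma C1c_Lipschitz:
  assumes "f \<in> C1c U"
  obtains M where "0 \<le> M" "\<And>x. \<bar>f x\<bar> \<le> M" "\<And>x. norm (gradient f x) \<le> M" "\<And>x y. \<bar>f x - f y\<bar> \<le> M * norm (x - y)"
proof -
  obtain K where K: "compact K" "\<forall>x. x \<notin> K \<longrightarrow> f x = 0" "\<forall>x. x \<notin> K \<longrightarrow> gradient f x = 0" "Ck 1 f"
      "continuous_on UNIV f" "continuous_on UNIV (gradient f)"
    using assms by (rule C1cE)
  have "bounded (gradient f ` K)" "bounded (f ` K)"
    using K by (auto intro!: compact_imp_bounded compact_continuous_image intro: continuous_on_subset)
  then obtain M1 M2 where M1: "\<forall>x\<in>K. norm (gradient f x) \<le> M1" and M2: "\<forall>x\<in>K. norm (f x) \<le> M2"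
    unfolding bounded_iff by blast
  define M where "M = max 0 (max M1 M2)"
  have g: "norm (gradient f x) \<le> M" and f: "\<bar>f x\<bar> \<le> M" for x
  proof -
    have "M1 \<le> M" "M2 \<le> M" "0 \<le> M" by (auto simp: M_def)
    moreover have "gradient f x = 0" "f x = 0" if "x \<notin> K" using that K(2,3) by blast+
    ultimately show "norm (gradient f x) \<le> M" "\<bar>f x\<bar> \<le> M"
      using bspec[OF M1, of x] bspec[OF M2, of x] by (cases "x \<in> K"; simp)+
  qed
  have "\<bar>f x - f y\<bar> \<le> M * norm (x - y)" for x y
  proof -
    have "norm (f x - f y) \<le> M * norm (x - y)"
    proof (rule differentiable_bound[where S=UNIV])
      show "(f has_derivative (\<lambda>h. gradient f x \<bullet> h)) (at x within UNIV)" for x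
        using Ck_1_has_derivative[OF K(4)] by simp
      show "onorm (\<lambda>h. gradient f x \<bullet> h) \<le> M" for x
      proof (rule onorm_bound)
        show "norm (gradient f x \<bullet> h) \<le> M * norm h" for h
          using Cauchy_Schwarz_ineq2[of "gradient f x" h] mult_right_mono[OF g[of x], of "norm h"] by simp
      qed (simp add: M_def)
    qed auto
    then show ?thesis by simp
  qed
  moreover have "0 \<le> M" by (simp add: M_def)
  ultimately show ?thesis using that f g by blast
qed

text \<open>This is Cauchy-Schwarz along the segment from \<open>x\<close> to \<open>x + z\<close>.
  The bound is written as a nonnegative integral with an indicator, ready for exchanging the
  integrations in \<open>x\<close> and \<open>t\<close>.\<close>

lemma square_increment_le:
  assumes "Ck 1 f"
  shows "ennreal ((f (x + z) - f x)\<^sup>2)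
    \<le> (\<integral>\<^sup>+t. ennreal (indicator {0..1::real} t * (norm z ^ 2 * (norm (gradient f (x + t *\<^sub>R z)))\<^sup>2)) \<partial>lborel)"
proof -
  define g where "g t = gradient f (x + t *\<^sub>R z) \<bullet> z" for t :: real
  define m where "m = f (x + z) - f x"
  have cg': "continuous_on UNIV (\<lambda>t::real. gradient f (x + t *\<^sub>R z))"
    by (rule continuous_on_compose2[OF Ck_1_continuous_gradient[OF assms]]) (auto intro!: continuous_intros)
  have cg: "continuous_on S g" for S
    unfolding g_def using cg' by (intro continuous_on_inner continuous_on_const) (blast intro: continuous_on_subset)
  have D: "((\<lambda>t. f (x + t *\<^sub>R z)) has_vector_derivative g t) (at t within S)" for t S
  proof -
    have 1: "((\<lambda>t. x + t *\<^sub>R z) has_derivative (\<lambda>h. h *\<^sub>R z)) (at t within S)"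
      by (auto intro!: derivative_eq_intros)
    show ?thesis
      using has_derivative_compose[OF 1 Ck_1_has_derivative[OF assms]]
      by (simp add: has_vector_derivative_def g_def)
  qed
  have "(g has_integral (f (x + 1 *\<^sub>R z) - f (x + 0 *\<^sub>R z))) {0..1}"
    by (rule fundamental_theorem_of_calculus) (auto intro: D)
  then have I1: "(g has_integral m) {0..1}" by (simp add: m_def)
  have "(\<lambda>t. (g t)\<^sup>2) integrable_on {0..1}"
    using cg by (intro integrable_continuous_real continuous_intros)
  then obtain I where I2: "((\<lambda>t. (g t)\<^sup>2) has_integral I) {0..1}" by blast
  \<comment> \<open>Since \<open>m\<close> is the mean of \<open>g\<close> over the unit interval,
    integrating \<open>(g t - m)^2 \<ge> 0\<close> yields \<open>m^2 \<le> I\<close>.\<close>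
  have "((\<lambda>t. (g t)\<^sup>2 - 2 * m * g t + m\<^sup>2) has_integral (I - 2 * m * m + m\<^sup>2)) {0..1}"
    using has_integral_add[OF has_integral_diff[OF I2 has_integral_mult_right[OF I1, of "2 * m"]]
       has_integral_const_real[of "m\<^sup>2" 0 1]] by simp
  moreover have "0 \<le> (g t)\<^sup>2 - 2 * m * g t + m\<^sup>2" for t
    using zero_le_power2[of "g t - m"] by (simp add: power2_diff algebra_simps)
  ultimately have "0 \<le> I - 2 * m * m + m\<^sup>2"
    by (rule has_integral_nonneg)
  then have mI: "m\<^sup>2 \<le> I" by (simp add: power2_eq_square)
  have "((\<lambda>t. indicator {0..1} t * (g t)\<^sup>2) has_integral I) UNIV"
  proof -
    have "(\<lambda>t. indicator {0..1} t * (g t)\<^sup>2) = (\<lambda>t. if t \<in> {0..1} then (g t)\<^sup>2 else 0)"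
      by (auto simp: indicator_def)
    then show ?thesis using I2 has_integral_restrict_UNIV[of "{0..1}" "\<lambda>t. (g t)\<^sup>2" I] by metis
  qed
  moreover have "(\<lambda>t. indicator {0..1} t * (g t)\<^sup>2) \<in> borel_measurable borel"
    using borel_measurable_continuous_onI[OF cg] by measurable
  ultimately have "(\<integral>\<^sup>+t. ennreal (indicator {0..1} t * (g t)\<^sup>2) \<partial>lborel) = I"
    by (intro nn_integral_has_integral_lborel) auto
  then have "ennreal (m\<^sup>2) \<le> (\<integral>\<^sup>+t. ennreal (indicator {0..1} t * (g t)\<^sup>2) \<partial>lborel)"
    using mI by (simp add: ennreal_leI)
  also have "\<dots> \<le> (\<integral>\<^sup>+t. ennreal (indicator {0..1::real} t * (norm z ^ 2 * (norm (gradient f (x + t *\<^sub>R z)))\<^sup>2)) \<partial>lborel)"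
  proof (intro nn_integral_mono ennreal_leI mult_left_mono)
    fix t
    have "\<bar>g t\<bar> \<le> norm (gradient f (x + t *\<^sub>R z)) * norm z"
      unfolding g_def by (rule Cauchy_Schwarz_ineq2)
    then have "\<bar>g t\<bar>\<^sup>2 \<le> (norm (gradient f (x + t *\<^sub>R z)) * norm z)\<^sup>2"
      by (intro power_mono) auto
    then show "(g t)\<^sup>2 \<le> norm z ^ 2 * (norm (gradient f (x + t *\<^sub>R z)))\<^sup>2"
      by (simp add: power_mult_distrib mult.commute)
  qed simp
  finally show ?thesis by (simp add: m_def)
qed

text \<open>Once the integrals are exchanged, translation invariance in \<open>x\<close> makes the
  inner one independent of \<open>t\<close>. Both the Poincare inequality and the \<open>L^2\<close>
  error of mollification come from this estimate.\<close>

lemma translation_estimate_nn: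
  assumes "f \<in> C1c U"
  shows "(\<integral>\<^sup>+x. ennreal ((f (x + z) - f x)\<^sup>2) \<partial>lborel) \<le> ennreal (norm z ^ 2 * energy f)"
proof -
  obtain K where K: "Ck 1 f" "continuous_on UNIV f" "continuous_on UNIV (gradient f)"
    using assms by (rule C1cE)
  have [measurable]: "(\<lambda>p. norm (gradient f (fst p + snd p *\<^sub>R z))) \<in> borel_measurable (borel \<Otimes>\<^sub>M borel)"
    unfolding borel_prod
    by (intro borel_measurable_continuous_onI continuous_on_norm continuous_on_compose2[OF K(3)])
       (auto intro!: continuous_intros)
  have [measurable]: "gradient f \<in> borel_measurable borel"
    using K borel_measurable_continuous_onI by blast
  have "(\<integral>\<^sup>+x. ennreal ((f (x + z) - f x)\<^sup>2) \<partial>lborel) \<le>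
     (\<integral>\<^sup>+x. (\<integral>\<^sup>+t. ennreal (indicator {0..1::real} t * (norm z ^ 2 * (norm (gradient f (x + t *\<^sub>R z)))\<^sup>2)) \<partial>lborel) \<partial>lborel)"
    by (intro nn_integral_mono square_increment_le K)
  also have "\<dots> = (\<integral>\<^sup>+t. (\<integral>\<^sup>+x. ennreal (indicator {0..1::real} t * (norm z ^ 2 * (norm (gradient f (x + t *\<^sub>R z)))\<^sup>2)) \<partial>lborel) \<partial>lborel)"
  proof (rule lborel_pair.Fubini'[symmetric])
    have "(\<lambda>p. ennreal (indicator {0..1::real} (snd p) * (norm z ^ 2 * (norm (gradient f (fst p + snd p *\<^sub>R z)))\<^sup>2)))
      \<in> borel_measurable (lborel \<Otimes>\<^sub>M lborel)"
      by measurable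
    then show "(\<lambda>(x, t). ennreal (indicator {0..1::real} t * (norm z ^ 2 * (norm (gradient f (x + t *\<^sub>R z)))\<^sup>2)))
      \<in> borel_measurable (lborel \<Otimes>\<^sub>M lborel)"
      by (simp add: case_prod_beta')
  qed
  also have "\<dots> = (\<integral>\<^sup>+t. ennreal (norm z ^ 2 * energy f) * indicator {0..1::real} t \<partial>lborel)"
  proof (rule nn_integral_cong)
    fix t :: real
    have "(\<integral>\<^sup>+x. ennreal (norm z ^ 2 * (norm (gradient f (x + t *\<^sub>R z)))\<^sup>2) \<partial>lborel)
        = (\<integral>\<^sup>+x. ennreal (norm z ^ 2 * (norm (gradient f x))\<^sup>2) \<partial>lborel)"
      by (rule nn_integral_translate[of "\<lambda>x. ennreal (norm z ^ 2 * (norm (gradient f x))\<^sup>2)"]) measurable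
    also have "\<dots> = ennreal (LINT x|lborel. norm z ^ 2 * (norm (gradient f x))\<^sup>2)"
      using C1c_integrable(4)[OF assms] by (intro nn_integral_eq_integral) auto
    also have "\<dots> = ennreal (norm z ^ 2 * energy f)"
      by (simp add: energy_def)
    finally show "(\<integral>\<^sup>+x. ennreal (indicator {0..1::real} t * (norm z ^ 2 * (norm (gradient f (x + t *\<^sub>R z)))\<^sup>2)) \<partial>lborel)
       = ennreal (norm z ^ 2 * energy f) * indicator {0..1::real} t"
      by (auto simp: indicator_def)
  qed
  also have "\<dots> = ennreal (norm z ^ 2 * energy f)"
    by (simp add: nn_integral_cmult_indicator)
  finally show ?thesis .
qed

text \<open>A translation by the diameter \<open>2 * R\<close> of a ball around \<open>U\<close>
  makes the supports of \<open>f\<close> and of its translate disjoint, so the squared increment has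
  integral exactly \<open>2 * sqnorm f\<close>. The translation estimate bounds it by
  \<open>(2 * R)^2 * energy f\<close>, hence the constant \<open>2 * R^2\<close>.\<close>

lemma poincare:
  fixes U :: "'a::euclidean_space set"
  assumes "bounded U"
  obtains C where "C \<ge> 0" "\<And>f. f \<in> C1c U \<Longrightarrow> sqnorm f \<le> C * energy f"
proof -
  obtain R where R: "R > 0" "U \<subseteq> ball 0 R"
    using bounded_subset_ballD[OF assms, of 0] by blast
  obtain b :: 'a where b: "b \<in> Basis" using nonempty_Basis by blast
  define z where "z = (2 * R) *\<^sub>R b"
  have nz: "norm z = 2 * R" using b R by (simp add: z_def)
  show ?thesis
  proof (rule that[of "2 * R^2"])
    fix f :: "'a \<Rightarrow> real" assume f: "f \<in> C1c U"
    obtain K where K: "K \<subseteq> U" "\<forall>x. x \<notin> K \<longrightarrow> f x = 0" "continuous_on UNIV f"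
      using f by (rule C1cE)
    have [measurable]: "f \<in> borel_measurable borel"
      using K borel_measurable_continuous_onI by blast
    have dis: "f (x + z) * f x = 0" for x
    proof (rule ccontr)
      assume "f (x + z) * f x \<noteq> 0"
      then have "x + z \<in> K" "x \<in> K" using K(2) by auto
      then have "x + z \<in> ball 0 R" "x \<in> ball 0 R" using K R by blast+
      then have "norm (x + z) < R" "norm x < R" by auto
      then have "norm z < 2 * R" using norm_triangle_ineq4[of "x + z" x] by simp
      then show False using nz by simp
    qed
    have sq: "(f (x + z) - f x)\<^sup>2 = (f (x + z))\<^sup>2 + (f x)\<^sup>2" for x
      using dis[of x] by (simp add: power2_diff)
    have i: "integrable lborel (\<lambda>x. (f x)\<^sup>2)" using C1c_integrable(3)[OF f] .
    have e: "(\<integral>\<^sup>+x. ennreal ((f x)\<^sup>2) \<partial>lborel) = ennreal (sqnorm f)"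
      unfolding sqnorm_def using i by (intro nn_integral_eq_integral) auto
    have "ennreal (2 * sqnorm f) = (\<integral>\<^sup>+x. ennreal ((f x)\<^sup>2) \<partial>lborel) + (\<integral>\<^sup>+x. ennreal ((f x)\<^sup>2) \<partial>lborel)"
      unfolding e using sqnorm_nonneg[of f] by (simp flip: ennreal_plus)
    also have "\<dots> = (\<integral>\<^sup>+x. ennreal ((f (x + z))\<^sup>2) \<partial>lborel) + (\<integral>\<^sup>+x. ennreal ((f x)\<^sup>2) \<partial>lborel)"
      using nn_integral_translate[of "\<lambda>x. ennreal ((f x)\<^sup>2)" z] by simp
    also have "\<dots> = (\<integral>\<^sup>+x. ennreal ((f (x + z) - f x)\<^sup>2) \<partial>lborel)"
      unfolding sq by (simp add: nn_integral_add)
    also have "\<dots> \<le> ennreal (norm z ^ 2 * energy f)"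
      by (rule translation_estimate_nn[OF f])
    finally have "2 * sqnorm f \<le> norm z ^ 2 * energy f"
      using energy_nonneg[of f] by (simp add: ennreal_le_iff)
    then show "sqnorm f \<le> 2 * R^2 * energy f"
      using nz by (simp add: power2_eq_square)
  qed simp
qed

text \<open>Translation invariance gives every difference quotient integral zero, and dominated
  convergence carries this over to the directional derivative.\<close>

lemma integral_gradient_zero:
  fixes f :: "'a::euclidean_space \<Rightarrow> real"
  assumes "f \<in> C1c U"
  shows "(LINT x|lborel. gradient f x \<bullet> z) = 0"
proof -
  obtain K where K: "compact K" "\<forall>x. x \<notin> K \<longrightarrow> f x = 0" "continuous_on UNIV f" "Ck 1 f" "\<forall>x. x \<notin> K \<longrightarrow> gradient f x = 0"
      "continuous_on UNIV (gradient f)"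
    using assms by (rule C1cE)
  obtain M where M: "0 \<le> M" "\<And>x y. \<bar>f x - f y\<bar> \<le> M * norm (x - y)"
    using C1c_Lipschitz[OF assms] by metis
  obtain R where R: "R > 0" "K \<subseteq> ball 0 R"
    using bounded_subset_ballD[OF compact_imp_bounded[OF K(1)], of 0] by blast
  have fm[measurable]: "f \<in> borel_measurable borel" "gradient f \<in> borel_measurable borel"
    using K borel_measurable_continuous_onI by blast+
  define s where "s n x = real (Suc n) * (f (x + (1 / real (Suc n)) *\<^sub>R z) - f x)" for n x
  \<comment> \<open>All increments have length at most \<open>norm z\<close>, so every quotient
    vanishes outside this ball; its indicator times the Lipschitz bound is the dominating
    function.\<close>
  define C :: "'a set" where "C = cball 0 (R + norm z)"
  have "(\<lambda>n. LINT x|lborel. s n x) \<longlonglongrightarrow> (LINT x|lborel. gradient f x \<bullet> z)"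
  proof (rule integral_dominated_convergence[where w="\<lambda>x. indicator C x *\<^sub>R (M * norm z)"])
    show "(\<lambda>x. gradient f x \<bullet> z) \<in> borel_measurable lborel" by measurable
    show "s n \<in> borel_measurable lborel" for n unfolding s_def by measurable
    show "integrable lborel (\<lambda>x. indicator C x *\<^sub>R (M * norm z))"
      unfolding C_def by (intro borel_integrable_compact) auto
    show "AE x in lborel. (\<lambda>n. s n x) \<longlonglongrightarrow> gradient f x \<bullet> z"
    proof (rule AE_I2)
      fix x
      have 1: "((\<lambda>t. x + t *\<^sub>R z) has_derivative (\<lambda>h. h *\<^sub>R z)) (at 0)"
        by (auto intro!: derivative_eq_intros)
      have "(f has_derivative (\<lambda>h. gradient f (x + 0 *\<^sub>R z) \<bullet> h)) (at (x + 0 *\<^sub>R z))"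
        by (rule Ck_1_has_derivative[OF K(4)])
      from has_derivative_compose[OF 1 this]
      have "((\<lambda>t. f (x + t *\<^sub>R z)) has_field_derivative gradient f x \<bullet> z) (at 0)"
        by (simp add: has_field_derivative_def mult.commute[of _ "gradient f x \<bullet> z"] fun_eq_iff)
      then have L: "((\<lambda>h. (f (x + h *\<^sub>R z) - f x) / h) \<longlongrightarrow> gradient f x \<bullet> z) (at 0)"
        by (simp add: DERIV_def)
      have "filterlim (\<lambda>n. 1 / real (Suc n)) (at 0) sequentially"
        by (simp add: filterlim_at LIMSEQ_Suc[OF lim_1_over_n] del: of_nat_Suc)
      from filterlim_compose[OF L this]
      show "(\<lambda>n. s n x) \<longlonglongrightarrow> gradient f x \<bullet> z"
        unfolding s_def by (simp add: mult.commute)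
    qed
    show "AE x in lborel. norm (s n x) \<le> indicator C x *\<^sub>R (M * norm z)" for n
    proof (rule AE_I2)
      fix x
      show "norm (s n x) \<le> indicator C x *\<^sub>R (M * norm z)"
      proof (cases "x \<in> C")
        case True
        have "\<bar>s n x\<bar> \<le> real (Suc n) * (M * norm ((1 / real (Suc n)) *\<^sub>R z))"
          unfolding s_def abs_mult using M(2)[of "x + (1 / real (Suc n)) *\<^sub>R z" x]
          by (intro mult_mono) auto
        then show ?thesis using True by simp
      next
        case False
        then have n: "norm x > R + norm z" by (simp add: C_def)
        have "norm ((1 / real (Suc n)) *\<^sub>R z) \<le> norm z"
          by (simp add: divide_le_eq mult_le_cancel_left1 mult.commute)
        then have "norm (x + (1 / real (Suc n)) *\<^sub>R z) > R"
          using n norm_triangle_ineq2[of x "- ((1 / real (Suc n)) *\<^sub>R z)"] by simp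
        moreover have "norm x > R" using n by (smt (verit) norm_ge_zero)
        ultimately have "x \<notin> K" "x + (1 / real (Suc n)) *\<^sub>R z \<notin> K"
          using R by auto
        then have "s n x = 0" using K(2) by (simp add: s_def)
        then show ?thesis using False by simp
      qed
    qed
  qed
  moreover have "(LINT x|lborel. s n x) = 0" for n
  proof -
    have i: "integrable lborel f" using C1c_integrable(1)[OF assms] .
    have i2: "integrable lborel (\<lambda>x. f (x + (1 / real (Suc n)) *\<^sub>R z))"
    proof -
      have "integrable (distr lborel borel (\<lambda>x. x + (1 / real (Suc n)) *\<^sub>R z)) f"
        using i by (simp only: lborel_distr_translate)
      then show ?thesis by (subst (asm) integrable_distr_eq) auto
    qed
    show ?thesis
      unfolding s_def using i i2
        integral_translate[of f "(1 / real (Suc n)) *\<^sub>R z"] by simp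
  qed
  ultimately show ?thesis by (simp add: LIMSEQ_const_iff)
qed

lemma C1c_mult:
  assumes "f \<in> C1c U" "Ck 1 g"
  shows "(\<lambda>x. f x * g x) \<in> C1c U"
proof -
  obtain K where "compact K" "K \<subseteq> U" "\<forall>x. x \<notin> K \<longrightarrow> f x = 0" "Ck 1 f"
    using assms(1) by (rule C1cE)
  moreover have "Ck 1 (\<lambda>x. f x * g x)" using assms(2) calculation(4) by (rule_tac Ck_mult)
  moreover have "\<forall>x. x \<notin> K \<longrightarrow> f x * g x = 0" using calculation(3) by simp
  ultimately show ?thesis
    unfolding C1c_def mem_Collect_eq by blast
qed

text \<open>The gradient of the product integrates to zero. The support condition falls on
  \<open>f\<close> alone, so that \<open>g\<close> can be a reflected and translated kernel.\<close>

lemma integration_by_parts: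
  assumes "f \<in> C1c U" "Ck 1 g"
  shows "(LINT x|lborel. f x * (gradient g x \<bullet> z)) = - (LINT x|lborel. (gradient f x \<bullet> z) * g x)"
proof -
  obtain K where K: "compact K" "\<forall>x. x \<notin> K \<longrightarrow> f x = 0" "continuous_on UNIV f" "Ck 1 f" "\<forall>x. x \<notin> K \<longrightarrow> gradient f x = 0"
      "continuous_on UNIV (gradient f)"
    using assms(1) by (rule C1cE)
  note cg = Ck_1_continuous[OF assms(2)] Ck_1_continuous_gradient[OF assms(2)]
  have c: "continuous_on UNIV (\<lambda>x. f x * (gradient g x \<bullet> z))" "continuous_on UNIV (\<lambda>x. (gradient f x \<bullet> z) * g x)"
    by (intro continuous_intros cg K)+
  have i: "integrable lborel (\<lambda>x. f x * (gradient g x \<bullet> z))" "integrable lborel (\<lambda>x. (gradient f x \<bullet> z) * g x)"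
    using K by (auto intro!: integrable_compact_support[OF c(1) K(1)] integrable_compact_support[OF c(2) K(1)])
  have "gradient (\<lambda>x. f x * g x) x \<bullet> z = f x * (gradient g x \<bullet> z) + (gradient f x \<bullet> z) * g x" for x
    using gradient_mult[OF Ck_1_differentiable[OF K(4)] Ck_1_differentiable[OF assms(2)], of x]
    by (simp add: inner_add_left)
  then have "(LINT x|lborel. f x * (gradient g x \<bullet> z)) + (LINT x|lborel. (gradient f x \<bullet> z) * g x) = 0"
    using integral_gradient_zero[OF C1c_mult[OF assms], of z] i by simp
  then show ?thesis by simp
qed

section \<open>Mollification\<close>

lemma integral_pos_on_open:
  fixes f :: "'a::euclidean_space \<Rightarrow> real"
  assumes "integrable lborel f" "\<And>x. 0 \<le> f x" "open S" "S \<noteq> {}" "\<And>x. x \<in> S \<Longrightarrow> 0 < f x"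
  shows "0 < (LINT x|lborel. f x)"
proof -
  have "(LINT x|lborel. f x) \<noteq> 0"
  proof
    assume "(LINT x|lborel. f x) = 0"
    then have "AE x in lborel. f x = 0"
      using integral_nonneg_eq_0_iff_AE[OF assms(1)] assms(2) by simp
    then have "AE x in lborel. x \<notin> S" by eventually_elim (use assms(5) in force)
    moreover have "S \<in> sets lborel" using assms(3) by simp
    ultimately have "S \<in> null_sets lborel" by (simp add: AE_iff_null_sets)
    then have "negligible S"
      using negligible_iff_null_sets null_sets_completionI by blast
    then show False using open_not_negligible assms(3,4) by blast
  qed
  moreover have "0 \<le> (LINT x|lborel. f x)" using assms(2) by simp
  ultimately show ?thesis by simp
qed

text \<open>Uniform continuity on the closed unit neighbourhood \<open>L\<close> of \<open>K\<close>
  suffices: of two points closer than 1, either both lie in \<open>L\<close> or both lie outside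
  \<open>K\<close>, where \<open>g\<close> vanishes.\<close>

lemma uniform_continuity_compact_support:
  fixes g :: "'a::euclidean_space \<Rightarrow> 'b::real_normed_vector"
  assumes "continuous_on UNIV g" "compact K" "\<forall>x. x \<notin> K \<longrightarrow> g x = 0" "0 < e"
  obtains d where "0 < d" "\<And>x y. norm (x - y) < d \<Longrightarrow> norm (g x - g y) < e"
proof -
  define L where "L = (\<Union>x\<in>K. \<Union>y\<in>cball 0 1. {x + y})"
  have "compact L" unfolding L_def by (intro compact_sums' assms) auto
  then have "uniformly_continuous_on L g"
    using assms(1) by (intro compact_uniformly_continuous) (auto intro: continuous_on_subset)
  then obtain d where d: "d > 0" "\<And>x y. x \<in> L \<Longrightarrow> y \<in> L \<Longrightarrow> dist y x < d \<Longrightarrow> dist (g y) (g x) < e"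
    unfolding uniformly_continuous_on_def using assms(4) by meson
  have L: "x \<in> L" if "y \<in> K" "norm (x - y) < 1" for x y
  proof -
    have "x = y + (x - y)" "x - y \<in> cball 0 1" using that by auto
    then show ?thesis unfolding L_def using that(1) by blast
  qed
  show ?thesis
  proof (rule that[of "min d 1"])
    fix x y :: 'a assume xy: "norm (x - y) < min d 1"
    show "norm (g x - g y) < e"
    proof (cases "x \<in> K \<or> y \<in> K")
      case True
      then have "x \<in> L" "y \<in> L"
        using L[of x y] L[of y x] L[of x x] L[of y y] xy by (auto simp: norm_minus_commute)
      then show ?thesis using d(2)[of y x] xy by (simp add: dist_norm)
    next
      case False
      then show ?thesis using assms(3,4) by simp
    qed
  qed (use d in simp)
qed

lemma Ck_scaleR: "Ck k f \<Longrightarrow> Ck k (\<lambda>x::'a::euclidean_space. f (s *\<^sub>R x))"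
proof (induction k arbitrary: f)
  case 0
  then have "continuous_on UNIV f" by simp
  then have "continuous_on UNIV (\<lambda>x. f (s *\<^sub>R x))"
    by (rule continuous_on_compose2) (auto intro!: continuous_intros)
  then show ?case by simp
next
  case (Suc k)
  have D: "((\<lambda>x. f (s *\<^sub>R x)) has_derivative (\<lambda>h. frechet_derivative f (at (s *\<^sub>R x)) (s *\<^sub>R h))) (at x)" for x
  proof -
    have 1: "((*\<^sub>R) s has_derivative (*\<^sub>R) s) (at x)"
      by (rule bounded_linear_imp_has_derivative[OF bounded_linear_scaleR_right])
    have "(f has_derivative frechet_derivative f (at (s *\<^sub>R x))) (at (s *\<^sub>R x))"
      using Suc.prems frechet_derivative_works[of f "at (s *\<^sub>R x)"] by simp
    from has_derivative_compose[OF 1 this] show ?thesis .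
  qed
  have E: "frechet_derivative (\<lambda>x. f (s *\<^sub>R x)) (at x) i = s * frechet_derivative f (at (s *\<^sub>R x)) i" for x i
  proof -
    have "frechet_derivative (\<lambda>x. f (s *\<^sub>R x)) (at x) = (\<lambda>h. frechet_derivative f (at (s *\<^sub>R x)) (s *\<^sub>R h))"
      by (rule frechet_derivative_at[symmetric, OF D])
    moreover have "linear (frechet_derivative f (at (s *\<^sub>R x)))"
      using Suc.prems linear_frechet_derivative[of f "at (s *\<^sub>R x)"] by simp
    ultimately show ?thesis by (simp add: linear_scale)
  qed
  show ?case
    unfolding Ck.simps E
  proof (intro conjI allI ballI)
    show "(\<lambda>x. f (s *\<^sub>R x)) differentiable at x" for x using D differentiableI by blast
    fix i :: 'a assume "i \<in> Basis"
    then have "Ck k (\<lambda>x. frechet_derivative f (at x) i)" using Suc.prems by simp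
    from Ck_cmult[OF Suc.IH[OF this], of s]
    show "Ck k (\<lambda>x. s * frechet_derivative f (at (s *\<^sub>R x)) i)" .
  qed
qed

text \<open>The bump is rescaled to radius \<open>d\<close> and divided by its integral. Evenness is
  recorded because the kernel enters convolutions as \<open>\<psi> (x - y)\<close>, while its total
  mass is computed by a translation in \<open>y\<close>.\<close>

lemma mollifier_exists:
  fixes d :: real
  assumes "0 < d"
  obtains \<psi> :: "'a::euclidean_space \<Rightarrow> real" where "\<And>k. Ck k \<psi>" "\<And>x. 0 \<le> \<psi> x" "\<And>x. \<psi> (- x) = \<psi> x"
    "\<And>x. d \<le> norm x \<Longrightarrow> \<psi> x = 0" "(LINT x|lborel. \<psi> x) = 1"
proof -
  define p :: "'a \<Rightarrow> real" where "p = (\<lambda>x. exp_bump 0 (1 - ((1/d) *\<^sub>R x) \<bullet> ((1/d) *\<^sub>R x)))"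
  have C: "Ck k p" for k
    unfolding p_def by (rule Ck_scaleR[of k "\<lambda>x. exp_bump 0 (1 - x \<bullet> x)"]) (rule Ck_exp_bump)
  have eq: "((1/d) *\<^sub>R x) \<bullet> ((1/d) *\<^sub>R x) = (norm x / d)\<^sup>2" for x :: 'a
    by (simp add: power_divide dot_square_norm power2_eq_square)
  have nn: "0 \<le> p x" for x by (simp add: p_def exp_bump_le)
  have supp: "p x = 0" if "d \<le> norm x" for x
  proof -
    have "1 \<le> norm x / d" using that assms by simp
    then have "1 \<le> (norm x / d)\<^sup>2" by (rule one_le_power)
    then show ?thesis unfolding p_def eq by (simp add: exp_bump_def)
  qed
  have pos: "0 < p x" if "norm x < d" for x
  proof -
    have "norm x / d < 1" using that assms by simp
    then have "(norm x / d)\<^sup>2 < 1" using assms by (intro power_less_one_iff[THEN iffD2]) auto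
    then show ?thesis unfolding p_def eq by (simp add: exp_bump_def)
  qed
  have c: "continuous_on UNIV p" using C[of 0] by simp
  have i: "integrable lborel p"
    by (rule integrable_compact_support[OF c compact_cball[of 0 d]]) (use supp in auto)
  have I: "0 < (LINT x|lborel. p x)"
    by (rule integral_pos_on_open[OF i nn, of "ball 0 d"]) (use pos assms in auto)
  show ?thesis
  proof (rule that[of "\<lambda>x. (1 / (LINT x|lborel. p x)) * p x"])
    show "Ck k (\<lambda>x. (1 / (LINT x|lborel. p x)) * p x)" for k by (rule Ck_cmult[OF C])
    show "(LINT x|lborel. (1 / (LINT x|lborel. p x)) * p x) = 1" using I by simp
  qed (use I nn supp in \<open>auto simp: p_def\<close>)
qed

section \<open>Convolution with a smooth kernel\<close>

definition convolution :: "('a::euclidean_space \<Rightarrow> real) \<Rightarrow> ('a \<Rightarrow> real) \<Rightarrow> 'a \<Rightarrow> real" where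
  "convolution f \<psi> x = (LINT y|lborel. f y * \<psi> (x - y))"

context
  fixes f :: "'a::euclidean_space \<Rightarrow> real" and K
  assumes f: "continuous_on UNIV f" "compact K" "\<forall>x. x \<notin> K \<longrightarrow> f x = 0"
begin

text \<open>A bridge from the Lebesgue integral to an integral over a fixed box, the setting for
  continuity and differentiation under the integral sign.\<close>

lemma integral_compact_support_cbox:
  fixes h :: "'a \<Rightarrow> 'b::euclidean_space"
  assumes "continuous_on UNIV h" "K \<subseteq> cbox a b"
  shows "(LINT y|lborel. f y *\<^sub>R h y) = integral (cbox a b) (\<lambda>y. f y *\<^sub>R h y)"
proof -
  have c: "continuous_on UNIV (\<lambda>y. f y *\<^sub>R h y)" by (intro continuous_intros f assms)
  have "integrable lborel (\<lambda>y. f y *\<^sub>R h y)"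
    by (rule integrable_compact_support[OF c f(2)]) (use f(3) in simp)
  then have "(LINT y|lborel. f y *\<^sub>R h y) = integral UNIV (\<lambda>y. f y *\<^sub>R h y)"
    by (simp add: integral_lborel)
  also have "\<dots> = integral UNIV (\<lambda>y. if y \<in> cbox a b then f y *\<^sub>R h y else 0)"
    by (rule arg_cong[where f="integral UNIV"], rule ext) (use f(3) assms(2) in auto)
  also have "\<dots> = integral (cbox a b) (\<lambda>y. f y *\<^sub>R h y)"
    by (rule integral_restrict_UNIV)
  finally show ?thesis .
qed

lemma convolution_has_derivative:
  assumes "Ck 1 \<psi>"
  shows "(convolution f \<psi> has_derivative (\<lambda>h. (LINT y|lborel. f y *\<^sub>R gradient \<psi> (x - y)) \<bullet> h)) (at x)"
proof -
  obtain a where a: "K \<subseteq> cbox (- a) a"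
    using bounded_subset_cbox_symmetric[OF compact_imp_bounded[OF f(2)]] by blast
  note c = Ck_1_continuous[OF assms] Ck_1_continuous_gradient[OF assms]
  have cs: "continuous_on UNIV (\<lambda>y. \<psi> (x - y))" "continuous_on UNIV (\<lambda>y. gradient \<psi> (x - y))" for x
    by (rule continuous_on_compose2[OF c(1)], auto intro!: continuous_intros)
       (rule continuous_on_compose2[OF c(2)], auto intro!: continuous_intros)
  \<comment> \<open>This is the derivative in \<open>x\<close> as a bounded linear map, the form in
    which the Leibniz rule asks for joint continuity.\<close>
  define G where "G x y = blinfun_inner_right (f y *\<^sub>R gradient \<psi> (x - y))" for x y
  have cG: "continuous_on (UNIV \<times> cbox (- a) a) (\<lambda>(x, y). G x y)"
  proof -
    have "continuous_on (UNIV \<times> cbox (- a) a) (\<lambda>p. gradient \<psi> (fst p - snd p))"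
      by (rule continuous_on_compose2[OF c(2)]) (auto intro!: continuous_intros)
    moreover have "continuous_on (UNIV \<times> cbox (- a) a) (\<lambda>p. f (snd p))"
      by (rule continuous_on_compose2[OF f(1)]) (auto intro!: continuous_intros)
    ultimately have "continuous_on (UNIV \<times> cbox (- a) a) (\<lambda>p. f (snd p) *\<^sub>R gradient \<psi> (fst p - snd p))"
      by (rule_tac continuous_on_scaleR)
    then have "continuous_on (UNIV \<times> cbox (- a) a) (\<lambda>p. blinfun_inner_right (f (snd p) *\<^sub>R gradient \<psi> (fst p - snd p)))"
      by (rule bounded_linear.continuous_on[OF bounded_linear_blinfun_inner_right])
    then show ?thesis by (simp add: G_def case_prod_beta')
  qed
  have "((\<lambda>x. integral (cbox (-a) a) (\<lambda>y. f y * \<psi> (x - y))) has_derivative integral (cbox (-a) a) (G x)) (at x within UNIV)"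
  proof (rule leibniz_rule[OF _ _ cG])
    fix x y :: 'a
    have "((\<lambda>x. x - y) has_derivative (\<lambda>h. h)) (at x within UNIV)"
      by (auto intro!: derivative_eq_intros)
    from has_derivative_compose[OF this, of \<psi>, OF Ck_1_has_derivative[OF assms]]
    have "((\<lambda>x. f y * \<psi> (x - y)) has_derivative (\<lambda>h. f y * (gradient \<psi> (x - y) \<bullet> h))) (at x within UNIV)"
      by (rule has_derivative_mult_right)
    moreover have "blinfun_apply (G x y) = (\<lambda>h. f y * (gradient \<psi> (x - y) \<bullet> h))"
      by (simp add: G_def fun_eq_iff)
    ultimately show "((\<lambda>x. f y * \<psi> (x - y)) has_derivative blinfun_apply (G x y)) (at x within UNIV)"
      by simp
  next
    fix x
    show "(\<lambda>y. f y * \<psi> (x - y)) integrable_on cbox (-a) a"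
      by (intro integrable_continuous continuous_on_mult)
         (blast intro: continuous_on_subset f cs)+
  qed auto
  moreover have "(\<lambda>x. integral (cbox (-a) a) (\<lambda>y. f y * \<psi> (x - y))) = convolution f \<psi>"
    using integral_compact_support_cbox[OF cs(1) a] by (simp add: convolution_def fun_eq_iff)
  moreover have "integral (cbox (-a) a) (G x) = blinfun_inner_right (LINT y|lborel. f y *\<^sub>R gradient \<psi> (x - y))"
  proof -
    have "(\<lambda>y. f y *\<^sub>R gradient \<psi> (x - y)) integrable_on cbox (-a) a"
      by (intro integrable_continuous continuous_on_scaleR)
         (blast intro: continuous_on_subset f cs)+
    from integral_linear[OF this bounded_linear_blinfun_inner_right]
    show ?thesis
      unfolding integral_compact_support_cbox[OF cs(2) a] by (simp add: G_def[abs_def] comp_def)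
  qed
  ultimately show ?thesis by simp
qed

text \<open>All derivatives fall on the kernel, so continuity of \<open>f\<close> is enough. The
  induction generalizes over \<psi>, since a partial derivative of \<psi> is the next
  kernel.\<close>

lemma convolution_Ck: "Ck k \<psi> \<Longrightarrow> Ck k (convolution f \<psi>)"
proof (induction k arbitrary: \<psi>)
  case 0
  then have c: "continuous_on UNIV \<psi>" by simp
  obtain a where a: "K \<subseteq> cbox (- a) a"
    using bounded_subset_cbox_symmetric[OF compact_imp_bounded[OF f(2)]] by blast
  have cs: "continuous_on UNIV (\<lambda>y. \<psi> (x - y))" for x
    by (rule continuous_on_compose2[OF c]) (auto intro!: continuous_intros)
  have "continuous_on (UNIV \<times> cbox (- a) a) (\<lambda>p. \<psi> (fst p - snd p))"
    by (rule continuous_on_compose2[OF c]) (auto intro!: continuous_intros)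
  moreover have "continuous_on (UNIV \<times> cbox (- a) a) (\<lambda>p. f (snd p))"
    by (rule continuous_on_compose2[OF f(1)]) (auto intro!: continuous_intros)
  ultimately have "continuous_on (UNIV \<times> cbox (- a) a) (\<lambda>p. f (snd p) * \<psi> (fst p - snd p))"
    by (rule_tac continuous_on_mult)
  then have "continuous_on UNIV (\<lambda>x. integral (cbox (- a) a) (\<lambda>y. f y * \<psi> (x - y)))"
    by (intro integral_continuous_on_param) (simp add: case_prod_beta')
  moreover have "(\<lambda>x. integral (cbox (-a) a) (\<lambda>y. f y * \<psi> (x - y))) = convolution f \<psi>"
    using integral_compact_support_cbox[OF cs a] by (simp add: convolution_def fun_eq_iff)
  ultimately show ?case by (metis Ck.simps(1))
next
  case (Suc k)
  have C1: "Ck 1 \<psi>"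
    using Suc.prems
  proof (induction k)
    case 0 then show ?case by (simp only: One_nat_def)
  qed (blast dest: Ck_Suc_imp)
  have D: "frechet_derivative (convolution f \<psi>) (at x) i = convolution f (\<lambda>x. frechet_derivative \<psi> (at x) i) x"
    if "i \<in> Basis" for x i
  proof -
    have cs: "continuous_on UNIV (\<lambda>y. gradient \<psi> (x - y))"
      by (rule continuous_on_compose2[OF Ck_1_continuous_gradient[OF C1]]) (auto intro!: continuous_intros)
    have "integrable lborel (\<lambda>y. f y *\<^sub>R gradient \<psi> (x - y))"
      by (rule integrable_compact_support[OF continuous_on_scaleR[OF f(1) cs] f(2)]) (use f(3) in simp)
    then have "(LINT y|lborel. f y *\<^sub>R gradient \<psi> (x - y)) \<bullet> i = (LINT y|lborel. (f y *\<^sub>R gradient \<psi> (x - y)) \<bullet> i)"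
      by (intro integral_inner_left[symmetric])
    moreover have "frechet_derivative (convolution f \<psi>) (at x) = (\<lambda>h. (LINT y|lborel. f y *\<^sub>R gradient \<psi> (x - y)) \<bullet> h)"
      by (rule frechet_derivative_at[symmetric, OF convolution_has_derivative[OF C1]])
    ultimately show ?thesis
      by (simp add: convolution_def gradient_inner_Basis[OF that])
  qed
  show ?case
    unfolding Ck.simps
  proof (intro conjI allI ballI)
    show "convolution f \<psi> differentiable at x" for x
      using convolution_has_derivative[OF C1] differentiableI by blast
    fix i :: 'a assume i: "i \<in> Basis"
    have "Ck k (convolution f (\<lambda>x. frechet_derivative \<psi> (at x) i))"
      using Suc.prems i by (intro Suc.IH) simp
    then show "Ck k (\<lambda>x. frechet_derivative (convolution f \<psi>) (at x) i)"
      by (simp only: D[OF i])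
  qed
qed

end

text \<open>Integration by parts moves the derivative from the kernel to \<open>f\<close>. The
  gradient of a mollification is thereby an average of the gradient, which turns
  \<open>average_close\<close> into closeness in C^1.\<close>

lemma gradient_convolution:
  fixes f :: "'a::euclidean_space \<Rightarrow> real"
  assumes "f \<in> C1c U" "Ck 1 \<psi>"
  shows "gradient (convolution f \<psi>) x = (LINT y|lborel. \<psi> (x - y) *\<^sub>R gradient f y)"
proof -
  obtain K where K: "compact K" "\<forall>x. x \<notin> K \<longrightarrow> f x = 0" "continuous_on UNIV f" "\<forall>x. x \<notin> K \<longrightarrow> gradient f x = 0"
      "continuous_on UNIV (gradient f)"
    using assms(1) by (rule C1cE)
  note c = Ck_1_continuous[OF assms(2)] Ck_1_continuous_gradient[OF assms(2)]
  have cs: "continuous_on UNIV (\<lambda>y. \<psi> (x - y))" "continuous_on UNIV (\<lambda>y. gradient \<psi> (x - y))"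
    by (rule continuous_on_compose2[OF c(1)], auto intro!: continuous_intros)
       (rule continuous_on_compose2[OF c(2)], auto intro!: continuous_intros)
  have "(((\<lambda>y. \<psi> (x - y))) has_derivative (\<lambda>h. - gradient \<psi> (x - y) \<bullet> h)) (at y)" for y
  proof -
    have "((\<lambda>y. x - y) has_derivative (\<lambda>h. - h)) (at y)"
      by (auto intro!: derivative_eq_intros)
    from has_derivative_compose[OF this, of \<psi>, OF Ck_1_has_derivative[OF assms(2)]]
    show ?thesis by simp
  qed
  note g = Ck_1I[OF this continuous_on_minus[OF cs(2)]]
  have i1: "integrable lborel (\<lambda>y. f y *\<^sub>R gradient \<psi> (x - y))"
    by (rule integrable_compact_support[OF continuous_on_scaleR[OF K(3) cs(2)] K(1)]) (use K in simp)
  have i2: "integrable lborel (\<lambda>y. \<psi> (x - y) *\<^sub>R gradient f y)"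
    by (rule integrable_compact_support[OF continuous_on_scaleR[OF cs(1) K(5)] K(1)]) (use K in simp)
  have "(LINT y|lborel. f y *\<^sub>R gradient \<psi> (x - y)) = (LINT y|lborel. \<psi> (x - y) *\<^sub>R gradient f y)"
  proof (rule euclidean_eqI)
    fix i :: 'a
    have "(LINT y|lborel. f y *\<^sub>R gradient \<psi> (x - y)) \<bullet> i = - (LINT y|lborel. f y * (- gradient \<psi> (x - y) \<bullet> i))"
      using i1 by (simp flip: integral_inner_left)
    also have "\<dots> = (LINT y|lborel. (gradient f y \<bullet> i) * \<psi> (x - y))"
      using integration_by_parts[OF assms(1) g(1), of i] unfolding g(2) by simp
    also have "\<dots> = (LINT y|lborel. \<psi> (x - y) *\<^sub>R gradient f y) \<bullet> i"
      using i2 by (simp add: mult.commute flip: integral_inner_left)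
    finally show "(LINT y|lborel. f y *\<^sub>R gradient \<psi> (x - y)) \<bullet> i = (LINT y|lborel. \<psi> (x - y) *\<^sub>R gradient f y) \<bullet> i" .
  qed
  then show ?thesis
    using gradient_eqI[OF convolution_has_derivative[OF K(3,1,2) assms(2)]] by simp
qed

text \<open>The kernel is a probability density living at distance less than \<open>d\<close> from
  \<open>x\<close>, where \<open>g\<close> varies by less than \<open>e\<close>. Vector values let
  the lemma serve both a function and its gradient.\<close>

lemma average_close:
  fixes g :: "'a::euclidean_space \<Rightarrow> 'b::{banach, second_countable_topology}" and \<psi> :: "'a \<Rightarrow> real"
  assumes g: "continuous_on UNIV g" "compact K" "\<forall>x. x \<notin> K \<longrightarrow> g x = 0"
    and \<psi>: "continuous_on UNIV \<psi>" "\<And>x. 0 \<le> \<psi> x" "\<And>x. \<psi> (- x) = \<psi> x" "\<And>x. d \<le> norm x \<Longrightarrow> \<psi> x = 0"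
      "(LINT x|lborel. \<psi> x) = 1"
    and e: "\<And>x y. norm (x - y) < d \<Longrightarrow> norm (g x - g y) < e" "0 < e"
  shows "norm ((LINT y|lborel. \<psi> (x - y) *\<^sub>R g y) - g x) \<le> e"
proof -
  have cs: "continuous_on UNIV (\<lambda>y. \<psi> (x - y))"
    by (rule continuous_on_compose2[OF \<psi>(1)]) (auto intro!: continuous_intros)
  have z: "\<psi> (x - y) = 0" if "y \<notin> cball x d" for y
    using that by (intro \<psi>(4)) (simp add: dist_norm)
  have "(LINT y|lborel. \<psi> (y + (- x))) = 1"
    using integral_translate[of \<psi> "- x"] borel_measurable_continuous_onI[OF \<psi>(1)] \<psi>(5) by simp
  moreover have "\<psi> (y + (- x)) = \<psi> (x - y)" for y using \<psi>(3)[of "x - y"] by simp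
  ultimately have one: "(LINT y|lborel. \<psi> (x - y)) = 1" by simp
  have i0: "integrable lborel (\<lambda>y. \<psi> (x - y))"
    by (rule integrable_compact_support[OF cs compact_cball[of x d]]) (use z in blast)
  have i1: "integrable lborel (\<lambda>y. \<psi> (x - y) *\<^sub>R g y)"
    by (rule integrable_compact_support[OF continuous_on_scaleR[OF cs g(1)] g(2)]) (use g in simp)
  have i2: "integrable lborel (\<lambda>y. \<psi> (x - y) *\<^sub>R g x)" using i0 by simp
  have "(LINT y|lborel. \<psi> (x - y) *\<^sub>R g y) - g x = (LINT y|lborel. \<psi> (x - y) *\<^sub>R g y) - (LINT y|lborel. \<psi> (x - y) *\<^sub>R g x)"
    using integral_scaleR_left[of "g x" lborel "\<lambda>y. \<psi> (x - y)"] i0 one by simp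
  also have "\<dots> = (LINT y|lborel. \<psi> (x - y) *\<^sub>R (g y - g x))"
    using Bochner_Integration.integral_diff[OF i1 i2] by (simp add: scaleR_diff_right)
  also have "norm \<dots> \<le> (LINT y|lborel. norm (\<psi> (x - y) *\<^sub>R (g y - g x)))"
    by (rule integral_norm_bound)
  also have "\<dots> \<le> (LINT y|lborel. \<psi> (x - y) * e)"
  proof (rule integral_mono)
    show "integrable lborel (\<lambda>y. norm (\<psi> (x - y) *\<^sub>R (g y - g x)))"
      using Bochner_Integration.integrable_diff[OF i1 i2] by (intro integrable_norm) (simp add: scaleR_diff_right)
    fix y
    show "norm (\<psi> (x - y) *\<^sub>R (g y - g x)) \<le> \<psi> (x - y) * e"
    proof (cases "norm (x - y) < d")
      case True
      then have "norm (g y - g x) \<le> e" using e(1)[of y x] by (simp add: norm_minus_commute)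
      then show ?thesis using \<psi>(2)[of "x - y"] by (simp add: mult_left_mono)
    next
      case False
      then show ?thesis using \<psi>(4)[of "x - y"] by simp
    qed
  qed (use i0 in simp)
  also have "\<dots> = e" using one by simp
  finally show ?thesis .
qed

text \<open>The compact set is fixed before \<open>e\<close>: a support common to all approximants
  provides the dominating functions when limits of integrals are taken later.\<close>

lemma smooth_approximation:
  fixes f :: "'a::euclidean_space \<Rightarrow> real"
  assumes "f \<in> C1c U" "open U"
  obtains K where "compact K" "K \<subseteq> U" "\<forall>x. x \<notin> K \<longrightarrow> f x = 0"
    "\<And>e. 0 < e \<Longrightarrow> \<exists>g\<in>test_functions U. (\<forall>x. x \<notin> K \<longrightarrow> g x = 0) \<and>
        (\<forall>x. \<bar>g x - f x\<bar> \<le> e \<and> norm (gradient g x - gradient f x) \<le> e)"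
proof -
  obtain K where K: "compact K" "K \<subseteq> U" "\<forall>x. x \<notin> K \<longrightarrow> f x = 0" "\<forall>x. x \<notin> K \<longrightarrow> gradient f x = 0"
      "continuous_on UNIV f" "continuous_on UNIV (gradient f)"
    using assms(1) by (rule C1cE)
  obtain r where r: "r > 0" "(\<Union>x\<in>K. cball x r) \<subseteq> U"
    using compact_subset_open_imp_cball_epsilon_subset[OF K(1) assms(2) K(2)] by blast
  define L where "L = (\<Union>x\<in>K. \<Union>y\<in>cball 0 r. {x + y})"
  have cL: "compact L" unfolding L_def by (intro compact_sums' K) auto
  have "L \<subseteq> (\<Union>x\<in>K. cball x r)" unfolding L_def by (auto simp: dist_norm)
  then have LU: "L \<subseteq> U" using r(2) by (rule subset_trans)
  have KL: "K \<subseteq> L"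
  proof
    fix x assume "x \<in> K"
    moreover have "x = x + 0" "(0::'a) \<in> cball 0 r" using r by auto
    ultimately show "x \<in> L" unfolding L_def by blast
  qed
  show ?thesis
  proof (rule that[OF cL LU])
    show "\<forall>x. x \<notin> L \<longrightarrow> f x = 0" using K(3) KL by blast
    fix e :: real assume e: "0 < e"
    obtain d1 where d1: "0 < d1" "\<And>x y. norm (x - y) < d1 \<Longrightarrow> norm (f x - f y) < e"
      using uniform_continuity_compact_support[OF K(5,1,3) e] by blast
    obtain d2 where d2: "0 < d2" "\<And>x y. norm (x - y) < d2 \<Longrightarrow> norm (gradient f x - gradient f y) < e"
      using uniform_continuity_compact_support[OF K(6,1,4) e] by blast
    \<comment> \<open>\<open>d \<le> r\<close> keeps the mollification supported in
      \<open>L\<close>; the other two bounds give the accuracy for the function and for its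
      gradient.\<close>
    define d where "d = min r (min d1 d2)"
    have d: "0 < d" "d \<le> r" "d \<le> d1" "d \<le> d2" using r d1 d2 by (auto simp: d_def)
    obtain \<psi> :: "'a \<Rightarrow> real" where \<psi>: "\<And>k. Ck k \<psi>" "\<And>x. 0 \<le> \<psi> x" "\<And>x. \<psi> (- x) = \<psi> x"
      "\<And>x. d \<le> norm x \<Longrightarrow> \<psi> x = 0" "(LINT x|lborel. \<psi> x) = 1"
      using mollifier_exists[OF d(1)] by blast
    have c\<psi>: "continuous_on UNIV \<psi>" using \<psi>(1)[of 0] by simp
    define g where "g = convolution f \<psi>"
    have "Ck k g" for k unfolding g_def by (rule convolution_Ck[OF K(5,1,3) \<psi>(1)])
    moreover have z: "\<forall>x. x \<notin> L \<longrightarrow> g x = 0"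
    proof (intro allI impI)
      fix x assume x: "x \<notin> L"
      have "f y * \<psi> (x - y) = 0" for y
      proof (cases "y \<in> K")
        case True
        have "x - y \<notin> cball 0 r"
        proof
          assume "x - y \<in> cball 0 r"
          moreover have "x = y + (x - y)" by simp
          ultimately have "x \<in> L" unfolding L_def using True by blast
          then show False using x by simp
        qed
        then have "\<psi> (x - y) = 0" using d(2) by (intro \<psi>(4)) simp
        then show ?thesis by simp
      qed (use K(3) in simp)
      then have "(\<lambda>y. f y * \<psi> (x - y)) = (\<lambda>y. 0)" by (rule ext)
      then show "g x = 0" by (simp add: g_def convolution_def)
    qed
    ultimately have "g \<in> test_functions U"
      unfolding test_functions_iff using cL LU by blast
    moreover have "\<bar>g x - f x\<bar> \<le> e" for x
      using average_close[OF K(5,1,3) c\<psi> \<psi>(2-5) _ e, where x=x] d1(2) d(3)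
      by (simp add: g_def convolution_def mult.commute)
    moreover have "norm (gradient g x - gradient f x) \<le> e" for x
      unfolding g_def gradient_convolution[OF assms(1) \<psi>(1)]
      by (rule average_close[OF K(6,1,4) c\<psi> \<psi>(2-5) _ e]) (use d2(2) d(4) in auto)
    ultimately show "\<exists>g\<in>test_functions U. (\<forall>x. x \<notin> L \<longrightarrow> g x = 0) \<and>
        (\<forall>x. \<bar>g x - f x\<bar> \<le> e \<and> norm (gradient g x - gradient f x) \<le> e)"
      using z by blast
  qed
qed

section \<open>Volume-preserving maps\<close>

text \<open>Encoded as invariance of Lebesgue measure under push-forward: a change of variables then
  involves no determinant, and a shear qualifies as soon as it is continuous.\<close>

definition volume_preserving :: "('a::euclidean_space \<Rightarrow> 'a) \<Rightarrow> bool" where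
  "volume_preserving F \<longleftrightarrow> F \<in> borel_measurable borel \<and> distr lborel borel F = lborel"

lemma volume_preserving_compose:
  assumes "volume_preserving F" "volume_preserving G"
  shows "volume_preserving (\<lambda>x. F (G x))"
proof -
  have [measurable]: "F \<in> borel_measurable borel" "G \<in> borel_measurable borel"
    using assms by (auto simp: volume_preserving_def)
  have "distr lborel borel (\<lambda>x. F (G x)) = distr (distr lborel borel G) borel F"
    by (subst distr_distr) (auto simp: comp_def)
  then show ?thesis using assms by (simp add: volume_preserving_def)
qed

lemma volume_preserving_translation: "volume_preserving (\<lambda>x. x + z)"
  by (simp add: volume_preserving_def lborel_distr_translate)

lemma volume_preserving_integral:
  fixes f :: "'a::euclidean_space \<Rightarrow> 'b::{banach, second_countable_topology}"
  assumes "volume_preserving F" and [measurable]: "f \<in> borel_measurable borel"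
  shows "(LINT x|lborel. f (F x)) = (LINT x|lborel. f x)"
proof -
  have [measurable]: "F \<in> borel_measurable borel" and d: "distr lborel borel F = lborel"
    using assms by (auto simp: volume_preserving_def)
  have "(LINT x|lborel. f x) = (LINT x|distr lborel borel F. f x)" by (simp add: d)
  also have "\<dots> = (LINT x|lborel. f (F x))" by (subst integral_distr) auto
  finally show ?thesis by simp
qed

lemma volume_preserving_integrable:
  fixes f :: "'a::euclidean_space \<Rightarrow> 'b::{banach, second_countable_topology}"
  assumes "volume_preserving F" and [measurable]: "f \<in> borel_measurable borel"
  shows "integrable lborel (\<lambda>x. f (F x)) \<longleftrightarrow> integrable lborel f"
proof -
  have [measurable]: "F \<in> borel_measurable borel" and d: "distr lborel borel F = lborel"
    using assms by (auto simp: volume_preserving_def)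
  have "integrable lborel f \<longleftrightarrow> integrable (distr lborel borel F) f" by (simp add: d)
  also have "\<dots> \<longleftrightarrow> integrable lborel (\<lambda>x. f (F x))" by (subst integrable_distr_eq) auto
  finally show ?thesis by simp
qed

text \<open>
  The image measure under an orthogonal map is translation invariant, hence a multiple of Lebesgue
  measure; the unit ball shows that the factor is 1. The uniqueness of translation-invariant
  measures is unfolded into a double integral evaluated in both orders.
\<close>

lemma volume_preserving_orthogonal:
  fixes T :: "'a::euclidean_space \<Rightarrow> 'a"
  assumes T: "orthogonal_transformation T"
  shows "volume_preserving T"
proof -
  have lin: "linear T" using T by (rule orthogonal_transformation_linear)
  have cT: "continuous_on UNIV T" using lin linear_continuous_on linear_conv_bounded_linear by blast
  have [measurable]: "T \<in> borel_measurable borel"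
    using cT by (rule borel_measurable_continuous_onI)
  have nT: "norm (T x) = norm x" for x using T by (simp add: orthogonal_transformation)
  define B where "B = ball (0::'a) 1"
  have mB[measurable]: "B \<in> sets borel" by (simp add: B_def)
  have symB: "- T x \<in> B \<longleftrightarrow> x \<in> B" for x by (simp add: B_def nT)
  have B0: "emeasure lborel B \<noteq> 0"
  proof
    assume "emeasure lborel B = 0"
    then have "B \<in> null_sets lborel" using mB by (simp add: null_sets_def)
    then have "negligible B" using negligible_iff_null_sets null_sets_completionI by blast
    then show False using open_not_negligible[of B] by (simp add: B_def)
  qed
  have Bfin: "emeasure lborel B \<noteq> \<infinity>"
    unfolding B_def using emeasure_lborel_ball_finite[of "0::'a" 1] by simp
  have key: "emeasure (distr lborel borel T) A = emeasure lborel A" if A[measurable]: "A \<in> sets borel" for A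
  proof -
    have B1: "(\<integral>\<^sup>+y. indicator B (y - T x) \<partial>lborel) = emeasure lborel B" for x
      using nn_integral_translate[of "indicator B :: 'a \<Rightarrow> ennreal" "- T x"] by simp
    have A1: "(\<integral>\<^sup>+y. indicator A (T x + y) \<partial>lborel) = emeasure lborel A" for x
      using nn_integral_translate[of "indicator A :: 'a \<Rightarrow> ennreal" "T x"] by (simp add: add.commute)
    have "emeasure (distr lborel borel T) A * emeasure lborel B
      = (\<integral>\<^sup>+x. indicator A (T x) \<partial>lborel) * emeasure lborel B"
    proof -
      have "emeasure (distr lborel borel T) A = (\<integral>\<^sup>+x. indicator A x \<partial>distr lborel borel T)" by simp
      also have "\<dots> = (\<integral>\<^sup>+x. indicator A (T x) \<partial>lborel)" by (subst nn_integral_distr) auto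
      finally show ?thesis by simp
    qed
    also have "\<dots> = (\<integral>\<^sup>+x. (\<integral>\<^sup>+y. indicator A (T x) * indicator B (y - T x) \<partial>lborel) \<partial>lborel)"
      by (simp add: nn_integral_cmult nn_integral_multc B1)
    also have "\<dots> = (\<integral>\<^sup>+y. (\<integral>\<^sup>+x. indicator A (T x) * indicator B (y - T x) \<partial>lborel) \<partial>lborel)"
      by (rule lborel_pair.Fubini'[symmetric]) measurable
    also have "\<dots> = (\<integral>\<^sup>+y. (\<integral>\<^sup>+x. indicator A (T x + y) * indicator B (- T x) \<partial>lborel) \<partial>lborel)"
    proof (rule nn_integral_cong)
      fix y
      \<comment> \<open>Shifting \<open>x\<close> by a preimage of \<open>y\<close> replaces
        \<open>T x\<close> by \<open>T x + y\<close>, so that \<open>y\<close> leaves the argument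
        of \<open>B\<close> and appears only in that of \<open>A\<close>.\<close>
      obtain w where w: "T w = y"
        using T orthogonal_transformation_surj[OF T] by (metis surjE)
      have "T (x + w) = T x + y" for x using linear_add[OF lin] w by simp
      then show "(\<integral>\<^sup>+x. indicator A (T x) * indicator B (y - T x) \<partial>lborel)
         = (\<integral>\<^sup>+x. indicator A (T x + y) * indicator B (- T x) \<partial>lborel)"
        using nn_integral_translate[of "\<lambda>x. indicator A (T x) * indicator B (y - T x) :: ennreal" w] by simp
    qed
    also have "\<dots> = (\<integral>\<^sup>+x. (\<integral>\<^sup>+y. indicator A (T x + y) * indicator B (- T x) \<partial>lborel) \<partial>lborel)"
      by (rule lborel_pair.Fubini') measurable
    also have "\<dots> = emeasure lborel A * emeasure lborel B"
    proof -
      have "indicator B (- T x) = (indicator B x :: ennreal)" for x using symB by (simp add: indicator_def)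
      then show ?thesis by (simp add: nn_integral_multc nn_integral_cmult A1)
    qed
    finally show ?thesis
      using B0 Bfin ennreal_mult_cancel_left[of "emeasure lborel B" "emeasure (distr lborel borel T) A" "emeasure lborel A"]
      by (simp add: mult.commute)
  qed
  have "distr lborel borel T = lborel"
    by (rule measure_eqI) (use key in auto)
  then show ?thesis by (simp add: volume_preserving_def)
qed

text \<open>On each vertical line the map is a translation, so Fubini reduces the claim to
  translation invariance in one real variable.\<close>

lemma volume_preserving_shear:
  fixes g :: "'a::euclidean_space \<Rightarrow> real"
  assumes "continuous_on UNIV g"
  shows "volume_preserving (\<lambda>p. (fst p, snd p + g (fst p)))"
proof -
  have c: "continuous_on UNIV (\<lambda>p::'a \<times> real. g (fst p))"
    by (rule continuous_on_compose2[OF assms]) (auto intro!: continuous_intros)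
  then have "continuous_on UNIV (\<lambda>p::'a \<times> real. (fst p, snd p + g (fst p)))"
    by (auto intro!: continuous_intros)
  then have m[measurable]: "(\<lambda>p::'a \<times> real. (fst p, snd p + g (fst p))) \<in> borel_measurable borel"
    by (rule borel_measurable_continuous_onI)
  have [measurable]: "g \<in> borel_measurable borel" using assms by (rule borel_measurable_continuous_onI)
  have "emeasure (distr lborel borel (\<lambda>p. (fst p, snd p + g (fst p)))) A = emeasure lborel A"
    if A[measurable]: "A \<in> sets (borel :: ('a \<times> real) measure)" for A
  proof -
    have A'[measurable]: "A \<in> sets (borel \<Otimes>\<^sub>M borel)" by (subst borel_prod) (rule A)
    have "emeasure (distr lborel borel (\<lambda>p. (fst p, snd p + g (fst p)))) A
       = (\<integral>\<^sup>+p. indicator A (fst p, snd p + g (fst p)) \<partial>lborel)"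
    proof -
      have "emeasure (distr lborel borel (\<lambda>p. (fst p, snd p + g (fst p)))) A
        = (\<integral>\<^sup>+p. indicator A p \<partial>distr lborel borel (\<lambda>p. (fst p, snd p + g (fst p))))" by simp
      also have "\<dots> = (\<integral>\<^sup>+p. indicator A (fst p, snd p + g (fst p)) \<partial>lborel)"
        by (subst nn_integral_distr) auto
      finally show ?thesis .
    qed
    also have "\<dots> = (\<integral>\<^sup>+p. indicator A (fst p, snd p + g (fst p)) \<partial>(lborel \<Otimes>\<^sub>M lborel))"
      by (simp add: lborel_prod)
    also have "\<dots> = (\<integral>\<^sup>+y. (\<integral>\<^sup>+t. indicator A (y, t + g y) \<partial>lborel) \<partial>lborel)"
    proof -
      have "(\<lambda>p. indicator A (fst p, snd p + g (fst p)) :: ennreal) \<in> borel_measurable (lborel \<Otimes>\<^sub>M lborel)"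
        by measurable
      from lborel.nn_integral_fst[OF this] show ?thesis by simp
    qed
    also have "\<dots> = (\<integral>\<^sup>+y. (\<integral>\<^sup>+t. indicator A (y, t) \<partial>lborel) \<partial>lborel)"
    proof (rule nn_integral_cong)
      fix y :: 'a
      have "(\<lambda>t. indicator A (y, t) :: ennreal) \<in> borel_measurable borel" by measurable
      then show "(\<integral>\<^sup>+t. indicator A (y, t + g y) \<partial>lborel) = (\<integral>\<^sup>+t. indicator A (y, t) \<partial>lborel)"
        by (rule nn_integral_translate)
    qed
    also have "\<dots> = (\<integral>\<^sup>+p. indicator A p \<partial>(lborel \<Otimes>\<^sub>M lborel))"
    proof -
      have "(\<lambda>p. indicator A p :: ennreal) \<in> borel_measurable (lborel \<Otimes>\<^sub>M lborel)"
        by measurable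
      from lborel.nn_integral_fst[OF this] show ?thesis by simp
    qed
    also have "\<dots> = emeasure lborel A"
      by (simp add: lborel_prod)
    finally show ?thesis .
  qed
  then have "distr lborel borel (\<lambda>p::'a \<times> real. (fst p, snd p + g (fst p))) = lborel"
    by (intro measure_eqI) auto
  then show ?thesis using m by (simp add: volume_preserving_def)
qed

text \<open>The witness is the Householder reflection in the bisector of \<open>v\<close> and \<open>e\<close>.\<close>

lemma reflection_exchanging:
  fixes v e :: "'a::euclidean_space"
  assumes "norm v = 1" "norm e = 1"
  obtains S where "orthogonal_transformation S" "\<And>x. S (S x) = x" "\<And>x. e \<bullet> S x = v \<bullet> x"
proof (cases "v = e")
  case True
  then show ?thesis
    by (intro that[of "\<lambda>x. x"]) (simp_all add: orthogonal_transformation_def linear_ident)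
next
  case False
  define w where "w = v - e"
  have ve: "v \<bullet> v = 1" "e \<bullet> e = 1" using assms by (simp_all add: dot_square_norm)
  have ww: "w \<bullet> w \<noteq> 0" "w \<bullet> w = 2 - 2 * (e \<bullet> v)"
  proof -
    show "w \<bullet> w \<noteq> 0" using False by (simp add: w_def)
    show "w \<bullet> w = 2 - 2 * (e \<bullet> v)"
      using ve by (simp add: w_def inner_diff_left inner_diff_right inner_commute)
  qed
  define S where "S x = x - (2 * (w \<bullet> x) / (w \<bullet> w)) *\<^sub>R w" for x
  have lin: "linear S"
    by (rule linearI) (simp_all add: S_def inner_add_right algebra_simps add_divide_distrib scaleR_add_left)
  have in1: "S x \<bullet> S y = x \<bullet> y" for x y
    using ww(1) by (simp add: S_def inner_diff_left inner_diff_right inner_commute[of x w] inner_commute[of y w] field_simps)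
  show ?thesis
  proof (rule that[of S])
    show "orthogonal_transformation S" using lin in1 by (simp add: orthogonal_transformation_def)
    show "S (S x) = x" for x
      using ww(1) by (simp add: S_def inner_diff_right algebra_simps flip: scaleR_add_left)
    fix x
    have "e \<bullet> S x = e \<bullet> x - (2 * (w \<bullet> x) / (w \<bullet> w)) * (e \<bullet> w)"
      by (simp add: S_def inner_diff_right)
    also have "e \<bullet> w = - (w \<bullet> w) / 2"
      unfolding ww(2) using ve by (simp add: w_def inner_diff_right)
    also have "(2 * (w \<bullet> x) / (w \<bullet> w)) * (- (w \<bullet> w) / 2) = - (w \<bullet> x)"
      using ww(1) by simp
    also have "e \<bullet> x - - (w \<bullet> x) = v \<bullet> x" by (simp add: w_def inner_diff_left)
    finally show "e \<bullet> S x = v \<bullet> x" .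
  qed
qed

section \<open>Weighted functionals\<close>

text \<open>The quantities of the problem are integrals over \<open>lebesgue_on U\<close>, while the
  analysis uses \<open>lborel\<close> and functions extended by zero. This is the passage between
  the two.\<close>

lemma lebesgue_on_eq_lborel:
  fixes f :: "'a::euclidean_space \<Rightarrow> 'b::{banach, second_countable_topology}"
  assumes [measurable]: "f \<in> borel_measurable borel" and U: "U \<in> sets borel" and z: "\<forall>x. x \<notin> U \<longrightarrow> f x = 0"
  shows "integral\<^sup>L (lebesgue_on U) f = integral\<^sup>L lborel f"
    and "integrable (lebesgue_on U) f \<longleftrightarrow> integrable lborel f"
proof -
  have eq: "(\<lambda>x. indicator U x *\<^sub>R f x) = f" using z by (auto simp: indicator_def)
  have U': "U \<inter> space lebesgue \<in> sets lebesgue" using U by simp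
  have "integral\<^sup>L (lebesgue_on U) f = integral\<^sup>L lebesgue f"
    using integral_restrict_space[OF U', of f] by (simp add: eq)
  also have "\<dots> = integral\<^sup>L lborel f" by (rule integral_completion) simp
  finally show "integral\<^sup>L (lebesgue_on U) f = integral\<^sup>L lborel f" .
  have "integrable (lebesgue_on U) f \<longleftrightarrow> integrable lebesgue f"
    using integrable_restrict_space[OF U', of f] by (simp add: eq)
  also have "\<dots> \<longleftrightarrow> integrable lborel f" by (rule integrable_completion) simp
  finally show "integrable (lebesgue_on U) f \<longleftrightarrow> integrable lborel f" .
qed

text \<open>The functional \<Phi> for a general weight and exponent, so that the domain and the
  half-space share their estimates.\<close>

definition weighted_power :: "('a::euclidean_space \<Rightarrow> real) \<Rightarrow> real \<Rightarrow> ('a \<Rightarrow> real) \<Rightarrow> real" where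
  "weighted_power w p u = (LINT x|lborel. w x * \<bar>u x\<bar> powr p)"

lemma weighted_power_nonneg: "(\<And>x. 0 \<le> w x) \<Longrightarrow> 0 \<le> weighted_power w p u"
  by (simp add: weighted_power_def)

text \<open>The weight may blow up at the frontier of \<open>U\<close>, but the compact support of
  \<open>u\<close> keeps away from it.\<close>

lemma C1c_integrable_weighted:
  assumes "u \<in> C1c U" "continuous_on U w" "0 < p"
  shows "integrable lborel (\<lambda>x. w x * \<bar>u x\<bar> powr p)"
proof -
  obtain K where K: "compact K" "K \<subseteq> U" "\<forall>x. x \<notin> K \<longrightarrow> u x = 0" "continuous_on UNIV u"
    using assms(1) by (rule C1cE)
  have "continuous_on K u" "continuous_on K w"
    using K assms(2) by (auto intro: continuous_on_subset)
  then have "continuous_on K (\<lambda>x. w x * \<bar>u x\<bar> powr p)"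
    using assms(3) by (intro continuous_intros continuous_on_powr') auto
  then have "integrable lborel (\<lambda>x. indicator K x *\<^sub>R (w x * \<bar>u x\<bar> powr p))"
    by (rule borel_integrable_compact[OF K(1)])
  also have "(\<lambda>x. indicator K x *\<^sub>R (w x * \<bar>u x\<bar> powr p)) = (\<lambda>x. w x * \<bar>u x\<bar> powr p)"
    by (rule ext) (use K(3) in \<open>auto simp: indicator_def\<close>)
  finally show ?thesis .
qed

text \<open>A boundary chart turns a smooth function into one that is merely C^1, whereas the
  infimum controls smooth ones. Approximants with a common compact support transfer the inequality
  by dominated convergence on both sides.\<close>

lemma test_function_inequality_C1c:
  fixes w :: "'a::euclidean_space \<Rightarrow> real"
  assumes U: "open U" and w: "continuous_on U w" "\<And>x. 0 \<le> w x" and wm[measurable]: "w \<in> borel_measurable borel"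
    and p: "0 < p" "0 < s"
    and ineq: "\<And>g. g \<in> test_functions U \<Longrightarrow> m * weighted_power w p g powr s \<le> energy g"
    and u: "u \<in> C1c U"
  shows "m * weighted_power w p u powr s \<le> energy u"
proof -
  obtain K where K: "compact K" "K \<subseteq> U" "\<forall>x. x \<notin> K \<longrightarrow> u x = 0"
    and app: "\<And>e. 0 < e \<Longrightarrow> \<exists>g\<in>test_functions U. (\<forall>x. x \<notin> K \<longrightarrow> g x = 0) \<and>
        (\<forall>x. \<bar>g x - u x\<bar> \<le> e \<and> norm (gradient g x - gradient u x) \<le> e)"
    using smooth_approximation[OF u U] by blast
  have "\<forall>k. \<exists>g. g \<in> test_functions U \<and> (\<forall>x. x \<notin> K \<longrightarrow> g x = 0) \<and>
      (\<forall>x. \<bar>g x - u x\<bar> \<le> 1 / real (Suc k) \<and> norm (gradient g x - gradient u x) \<le> 1 / real (Suc k))"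
    using app[of "1 / real (Suc _)"] by (meson of_nat_0_less_iff zero_less_Suc zero_less_divide_1_iff)
  then obtain g where g: "\<And>k. g k \<in> test_functions U" "\<And>k x. x \<notin> K \<Longrightarrow> g k x = 0"
      "\<And>k x. \<bar>g k x - u x\<bar> \<le> 1 / real (Suc k)" "\<And>k x. norm (gradient (g k) x - gradient u x) \<le> 1 / real (Suc k)"
    by metis
  obtain M where M: "0 \<le> M" "\<And>x. \<bar>u x\<bar> \<le> M" "\<And>x. norm (gradient u x) \<le> M"
    using C1c_Lipschitz[OF u] by metis
  have one: "1 / real (Suc k) \<le> 1" for k by simp
  have gb: "\<bar>g k x\<bar> \<le> M + 1" "norm (gradient (g k) x) \<le> M + 1" for k x
    using g(3)[of k x] M(2)[of x] one[of k] g(4)[of k x] M(3)[of x]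
      norm_triangle_sub[of "gradient (g k) x" "gradient u x"] by linarith+
  have gz: "gradient (g k) x = 0" if "x \<notin> K" for k x
    using C1c_gradient_zero[OF compact_imp_closed[OF K(1)] _ that] g(2) by blast
  have L0: "(\<lambda>k. 1 / real (Suc k)) \<longlonglongrightarrow> 0" by (rule LIMSEQ_Suc[OF lim_1_over_n])
  have c1: "(\<lambda>k. g k x) \<longlonglongrightarrow> u x" for x
  proof -
    have "(\<lambda>k. g k x - u x) \<longlonglongrightarrow> 0"
      by (rule Lim_null_comparison[OF _ L0]) (use g(3) in auto)
    then show ?thesis by (simp add: LIM_zero_iff)
  qed
  have c2: "(\<lambda>k. gradient (g k) x) \<longlonglongrightarrow> gradient u x" for x
  proof -
    have "(\<lambda>k. gradient (g k) x - gradient u x) \<longlonglongrightarrow> 0"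
      by (rule Lim_null_comparison[OF _ L0]) (use g(4) in auto)
    then show ?thesis by (simp add: LIM_zero_iff)
  qed
  have meas[measurable]: "u \<in> borel_measurable borel" "gradient u \<in> borel_measurable borel"
    using u C1cE borel_measurable_continuous_onI by metis+
  have gm[measurable]: "g k \<in> borel_measurable borel" "gradient (g k) \<in> borel_measurable borel" for k
    using test_functions_C1c[OF g(1)] C1cE borel_measurable_continuous_onI by metis+
  have "compact (w ` K)"
    using w(1) K by (intro compact_continuous_image) (auto intro: continuous_on_subset)
  then obtain W where "\<forall>y\<in>w ` K. norm y \<le> W" using compact_imp_bounded bounded_iff by metis
  then have W: "\<And>x. x \<in> K \<Longrightarrow> w x \<le> W" by force
  have iK: "integrable lborel (\<lambda>x. indicator K x *\<^sub>R c)" for c :: real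
    using K(1) by (intro borel_integrable_compact) auto
  have E: "(\<lambda>k. energy (g k)) \<longlonglongrightarrow> energy u"
    unfolding energy_def
  proof (rule integral_dominated_convergence[where w="\<lambda>x. indicator K x *\<^sub>R (M + 1)\<^sup>2"])
    show "AE x in lborel. (\<lambda>k. (norm (gradient (g k) x))\<^sup>2) \<longlonglongrightarrow> (norm (gradient u x))\<^sup>2"
      using c2 by (intro AE_I2 tendsto_intros) auto
    show "AE x in lborel. norm ((norm (gradient (g k) x))\<^sup>2) \<le> indicator K x *\<^sub>R (M + 1)\<^sup>2" for k
      using gb(2)[of k] gz[of _ k] by (intro AE_I2) (auto simp: indicator_def intro!: power_mono)
  qed (use iK in auto)
  have "(\<lambda>k. weighted_power w p (g k)) \<longlonglongrightarrow> weighted_power w p u"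
    unfolding weighted_power_def
  proof (rule integral_dominated_convergence[where w="\<lambda>x. indicator K x *\<^sub>R (W * (M + 1) powr p)"])
    show "AE x in lborel. (\<lambda>k. w x * \<bar>g k x\<bar> powr p) \<longlonglongrightarrow> w x * \<bar>u x\<bar> powr p"
      using c1 p by (intro AE_I2 tendsto_mult tendsto_powr2 tendsto_rabs tendsto_const) auto
    show "AE x in lborel. norm (w x * \<bar>g k x\<bar> powr p) \<le> indicator K x *\<^sub>R (W * (M + 1) powr p)" for k
    proof (rule AE_I2)
      fix x
      show "norm (w x * \<bar>g k x\<bar> powr p) \<le> indicator K x *\<^sub>R (W * (M + 1) powr p)"
      proof (cases "x \<in> K")
        case True
        have "w x * \<bar>g k x\<bar> powr p \<le> W * (M + 1) powr p"
          using W[OF True] w(2)[of x] gb(1)[of k x] p by (intro mult_mono powr_mono2) auto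
        then show ?thesis using True w(2)[of x] by simp
      next
        case False
        then show ?thesis using g(2)[of x k] by simp
      qed
    qed
  qed (use iK in auto)
  then have "(\<lambda>k. weighted_power w p (g k) powr s) \<longlonglongrightarrow> weighted_power w p u powr s"
    using p w(2) by (intro tendsto_powr2 tendsto_const) (auto simp: weighted_power_nonneg)
  then have "(\<lambda>k. m * weighted_power w p (g k) powr s) \<longlonglongrightarrow> m * weighted_power w p u powr s"
    by (rule tendsto_mult_left)
  then show ?thesis
    by (rule LIMSEQ_le[OF _ E]) (use ineq[OF g(1)] in blast)
qed

text \<open>The sign convention makes \<sigma> the order of the singularity at the frontier. For the
  values of \<beta> in the theorem, \<sigma> lies between 0 and 2.\<close>

definition boundary_weight :: "real \<Rightarrow> 'a::euclidean_space set \<Rightarrow> 'a \<Rightarrow> real" where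
  "boundary_weight \<sigma> U x = infdist x (frontier U) powr (- \<sigma>)"

lemma boundary_weight_nonneg: "0 \<le> boundary_weight \<sigma> U x"
  by (simp add: boundary_weight_def)

lemma boundary_weight_measurable[measurable]: "boundary_weight \<sigma> U \<in> borel_measurable borel"
proof -
  have "continuous_on UNIV (\<lambda>x. infdist x (frontier U))" by (intro continuous_intros)
  then have [measurable]: "(\<lambda>x. infdist x (frontier U)) \<in> borel_measurable borel"
    by (rule borel_measurable_continuous_onI)
  show ?thesis unfolding boundary_weight_def[abs_def] by measurable
qed

lemma infdist_frontier_pos:
  assumes "open U" "frontier U \<noteq> {}" "x \<in> U"
  shows "0 < infdist x (frontier U)"
proof -
  have "x \<notin> frontier U" using assms frontier_disjoint_eq by blast
  then show ?thesis
    using infdist_pos_not_in_closed[OF frontier_closed[of U] assms(2)] by blast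
qed

lemma boundary_weight_continuous:
  assumes "open U" "frontier U \<noteq> {}"
  shows "continuous_on U (boundary_weight \<sigma> U)"
  unfolding boundary_weight_def[abs_def]
  using infdist_frontier_pos[OF assms]
  by (intro continuous_intros) (metis less_irrefl)

lemma weighted_density_eq:
  fixes U :: "((real^'n) \<times> real) set"
  shows "weighted_density \<beta> U u x =
    boundary_weight (2 - (real CARD('n) - 1) / (real CARD('n) + 1) * \<beta>) U x * \<bar>u x\<bar> powr (2 + 2 * \<beta> / (real CARD('n) + 1))"
  by (simp add: weighted_density_def boundary_weight_def Let_def)

lemma J_test_function:
  fixes U :: "((real^'n) \<times> real) set"
  assumes "open U" "u \<in> test_functions U"
  defines "N \<equiv> real CARD('n) + 1"
  shows "J \<beta> U u (gradient u) = energy u /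
    weighted_power (boundary_weight (2 - (real CARD('n) - 1) / N * \<beta>) U) (2 + 2 * \<beta> / N) u powr (N / (N + \<beta>))"
proof -
  obtain K where K: "K \<subseteq> U" "\<forall>x. x \<notin> K \<longrightarrow> u x = 0" "\<forall>x. x \<notin> K \<longrightarrow> gradient u x = 0"
      "continuous_on UNIV u" "continuous_on UNIV (gradient u)"
    using test_functions_C1c[OF assms(2)] by (rule C1cE)
  have [measurable]: "u \<in> borel_measurable borel" "gradient u \<in> borel_measurable borel"
    using K borel_measurable_continuous_onI by blast+
  have U: "U \<in> sets borel" using assms(1) by simp
  have z: "u x = 0" "gradient u x = 0" if "x \<notin> U" for x using K that by blast+
  have "(LINT x|lebesgue_on U. (norm (gradient u x))\<^sup>2) = energy u"
    unfolding energy_def by (rule lebesgue_on_eq_lborel(1)[OF _ U]) (simp_all add: z)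
  moreover have "(LINT x|lebesgue_on U. weighted_density \<beta> U u x) =
     weighted_power (boundary_weight (2 - (real CARD('n) - 1) / N * \<beta>) U) (2 + 2 * \<beta> / N) u"
    unfolding weighted_power_def weighted_density_eq N_def[symmetric]
    by (rule lebesgue_on_eq_lborel(1)[OF _ U]) (simp_all add: z)
  ultimately show ?thesis by (simp add: J_def Let_def N_def add_ac)
qed

text \<open>The multiplied form also covers functions whose weighted integral is 0, for which the
  quotient would be a division by zero.\<close>

lemma \<mu>_le_energy:
  fixes U :: "((real^'n) \<times> real) set"
  assumes "open U" "u \<in> test_functions U"
  defines "N \<equiv> real CARD('n) + 1"
  shows "\<mu> \<beta> U *
    weighted_power (boundary_weight (2 - (real CARD('n) - 1) / N * \<beta>) U) (2 + 2 * \<beta> / N) u powr (N / (N + \<beta>)) \<le> energy u"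
proof (cases "weighted_power (boundary_weight (2 - (real CARD('n) - 1) / N * \<beta>) U) (2 + 2 * \<beta> / N) u = 0")
  case True
  then show ?thesis using energy_nonneg by simp
next
  case False
  let ?P = "weighted_power (boundary_weight (2 - (real CARD('n) - 1) / N * \<beta>) U) (2 + 2 * \<beta> / N) u"
  have pos: "0 < ?P powr (N / (N + \<beta>))" using False by simp
  have "u \<noteq> (\<lambda>x. 0)" using False by (auto simp: weighted_power_def)
  then have "\<mu> \<beta> U \<le> J \<beta> U u (gradient u)"
    unfolding \<mu>_def using assms(2)
    by (intro cINF_lower) (auto simp: bdd_below_def J_def Let_def intro!: exI[of _ 0] divide_nonneg_nonneg)
  also have "\<dots> = energy u / ?P powr (N / (N + \<beta>))"
    unfolding N_def by (rule J_test_function[OF assms(1,2)])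
  finally show ?thesis using pos by (simp add: pos_le_divide_eq)
qed

subsection \<open>The half-space\<close>

lemma open_half_space: "open (half_space :: ((real^'n) \<times> real) set)"
  and frontier_half_space: "frontier (half_space :: ((real^'n) \<times> real) set) = {x. snd x = 0}"
proof -
  have eq: "(half_space :: ((real^'n) \<times> real) set) = {x. (0, 1) \<bullet> x > 0}"
    by (auto simp: half_space_def inner_prod_def)
  show "open (half_space :: ((real^'n) \<times> real) set)" unfolding eq by (rule open_halfspace_gt)
  have "((0, 1) :: (real^'n) \<times> real) \<noteq> 0" by (simp add: zero_prod_def)
  then show "frontier (half_space :: ((real^'n) \<times> real) set) = {x. snd x = 0}"
    unfolding eq by (subst frontier_halfspace_gt) (auto simp: inner_prod_def)
qed

lemma infdist_frontier_half_space:
  fixes x :: "(real^'n) \<times> real"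
  assumes "0 \<le> snd x"
  shows "infdist x (frontier half_space) = snd x"
proof (rule antisym)
  have "infdist x (frontier half_space) \<le> dist x (fst x, 0)"
    by (rule infdist_le) (simp add: frontier_half_space)
  also have "\<dots> = snd x" using assms by (cases x) (simp add: dist_Pair_Pair dist_norm)
  finally show "infdist x (frontier half_space) \<le> snd x" .
  have ne: "frontier (half_space :: ((real^'n) \<times> real) set) \<noteq> {}"
    by (auto simp: frontier_half_space intro: exI[of _ 0])
  have "snd x \<le> dist x y" if "y \<in> frontier half_space" for y
    using dist_snd_le[of x y] that by (simp add: frontier_half_space dist_real_def)
  then show "snd x \<le> infdist x (frontier half_space)"
    unfolding infdist_notempty[OF ne] by (intro cINF_greatest[OF ne])
qed

lemma half_space_inequality:
  fixes v :: "((real^'n) \<times> real) \<Rightarrow> real"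
  assumes v: "v \<in> C1c half_space" and \<beta>: "0 \<le> \<beta>"
  defines "N \<equiv> real CARD('n) + 1"
  shows "\<mu> \<beta> (half_space :: ((real^'n) \<times> real) set) *
    weighted_power (boundary_weight (2 - (real CARD('n) - 1) / N * \<beta>) half_space) (2 + 2 * \<beta> / N) v powr (N / (N + \<beta>)) \<le> energy v"
proof (rule test_function_inequality_C1c[OF open_half_space _ _ _ _ _ _ v])
  have "N > 0" by (simp add: N_def)
  then show "0 < 2 + 2 * \<beta> / N" "0 < N / (N + \<beta>)"
    using \<beta> by (auto intro!: add_pos_nonneg divide_pos_pos)
  have "frontier (half_space :: ((real^'n) \<times> real) set) \<noteq> {}"
    by (auto simp: frontier_half_space intro: exI[of _ 0])
  then show "continuous_on (half_space :: ((real^'n) \<times> real) set) (boundary_weight (2 - (real CARD('n) - 1) / N * \<beta>) half_space)"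
    by (rule boundary_weight_continuous[OF open_half_space])
  show "\<mu> \<beta> (half_space :: ((real^'n) \<times> real) set) * weighted_power (boundary_weight (2 - (real CARD('n) - 1) / N * \<beta>) half_space) (2 + 2 * \<beta> / N) g powr (N / (N + \<beta>)) \<le> energy g"
    if "g \<in> test_functions half_space" for g :: "((real^'n) \<times> real) \<Rightarrow> real"
    using \<mu>_le_energy[OF open_half_space that, of \<beta>] by (simp add: N_def)
qed (auto simp: boundary_weight_nonneg)

section \<open>The local inequality near a point of the closure\<close>

text \<open>The half-space inequality is applied to the transported function
  \<open>v = u \<circ> G\<close>. Since \<open>F\<close> preserves volume, only pointwise
  comparisons remain. The gradient bound costs two powers of \<open>1 + e\<close> in the energy. The
  weight decreases with the distance, so an upper bound on the height suffices; it costs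
  \<open>(1 + e) powr (\<sigma> * s)\<close>, again at most two powers because
  \<open>\<sigma> \<le> 2\<close> and \<open>s \<le> 1\<close>.\<close>

lemma inequality_in_chart:
  fixes U :: "((real^'n) \<times> real) set" and F G :: "(real^'n) \<times> real \<Rightarrow> (real^'n) \<times> real"
  assumes U: "open U" "frontier U \<noteq> {}" "A \<subseteq> U"
    and \<beta>: "0 \<le> \<beta>" and \<mu>: "0 \<le> \<mu> \<beta> (half_space :: ((real^'n) \<times> real) set)"
    and F: "volume_preserving F" "continuous_on UNIV F" "\<And>x. G (F x) = x" "\<And>y. F (G y) = y"
    and G: "\<And>y. (G has_derivative G' y) (at y)" "\<And>h. continuous_on UNIV (\<lambda>y. G' y h)"
    and e: "0 \<le> e" and A: "\<And>x. x \<in> A \<Longrightarrow> 0 < snd (F x)"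
      "\<And>x. x \<in> A \<Longrightarrow> snd (F x) \<le> (1 + e) * infdist x (frontier U)"
      "\<And>x h. x \<in> A \<Longrightarrow> norm (G' (F x) h) \<le> (1 + e) * norm h"
    and u: "u \<in> C1c A"
  defines "N \<equiv> real CARD('n) + 1"
  defines "\<sigma> \<equiv> 2 - (real CARD('n) - 1) / N * \<beta>"
  assumes \<sigma>: "0 \<le> \<sigma>"
  shows "\<mu> \<beta> (half_space :: ((real^'n) \<times> real) set) *
      weighted_power (boundary_weight \<sigma> U) (2 + 2 * \<beta> / N) u powr (N / (N + \<beta>)) \<le> (1 + e) ^ 4 * energy u"
proof -
  define p where "p = 2 + 2 * \<beta> / N"
  define s where "s = N / (N + \<beta>)"
  have N: "N > 0" by (simp add: N_def)
  have p: "0 < p" using N \<beta> by (auto simp: p_def intro!: add_pos_nonneg)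
  have s: "0 < s" "s \<le> 1" using N \<beta> by (auto simp: s_def divide_le_eq intro!: divide_pos_pos)
  have "0 \<le> (real CARD('n) - 1) / N * \<beta>"
  proof -
    have "1 \<le> real CARD('n)" by (simp add: Suc_leI)
    then show ?thesis using N \<beta> by simp
  qed
  then have \<sigma>2: "\<sigma> \<le> 2" by (simp add: \<sigma>_def)
  obtain K where K: "compact K" "K \<subseteq> A" "\<forall>x. x \<notin> K \<longrightarrow> u x = 0" "\<forall>x. x \<notin> K \<longrightarrow> gradient u x = 0" "Ck 1 u"
      "continuous_on UNIV u" "continuous_on UNIV (gradient u)"
    using u by (rule C1cE)
  define v where "v y = u (G y)" for y
  define gv where "gv y = (\<Sum>i\<in>Basis. (gradient u (G y) \<bullet> G' y i) *\<^sub>R i)" for y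
  have cG: "continuous_on UNIV G"
    using has_derivative_continuous[OF G(1)] by (simp add: continuous_at_imp_continuous_on)
  have gv: "gv y \<bullet> h = gradient u (G y) \<bullet> G' y h" for y h
  proof -
    have lin: "linear (G' y)" by (rule has_derivative_linear[OF G(1)])
    have "G' y h = G' y (\<Sum>i\<in>Basis. (h \<bullet> i) *\<^sub>R i)" by (simp add: euclidean_representation)
    also have "\<dots> = (\<Sum>i\<in>Basis. (h \<bullet> i) *\<^sub>R G' y i)"
      using lin by (simp add: linear_sum linear_scale)
    finally have "gradient u (G y) \<bullet> G' y h = (\<Sum>i\<in>Basis. (h \<bullet> i) * (gradient u (G y) \<bullet> G' y i))"
      by (simp add: inner_sum_right)
    then show ?thesis by (simp add: gv_def inner_sum_left inner_commute[of h] mult.commute)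
  qed
  have Dv: "(v has_derivative (\<lambda>h. gv y \<bullet> h)) (at y)" for y
    using has_derivative_compose[OF G(1) Ck_1_has_derivative[OF K(5)], of y] by (simp add: v_def[abs_def] gv)
  have cgv: "continuous_on UNIV gv"
  proof -
    have "continuous_on UNIV (\<lambda>y. gradient u (G y))"
      by (rule continuous_on_compose2[OF K(7) cG]) simp
    then show ?thesis unfolding gv_def by (intro continuous_intros G(2))
  qed
  note v1 = Ck_1I[OF Dv cgv]
  have vH: "v \<in> C1c half_space"
    unfolding C1c_def mem_Collect_eq
  proof (intro conjI exI)
    show "Ck 1 v" by (rule v1)
    show "compact (F ` K)" using K(1) F(2) by (intro compact_continuous_image) (auto intro: continuous_on_subset)
    show "F ` K \<subseteq> half_space"
    proof
      fix y assume "y \<in> F ` K"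
      then obtain x where "x \<in> A" "y = F x" using K(2) by blast
      then have "0 < snd y" using A(1) by simp
      then show "y \<in> half_space" by (simp add: half_space_def case_prod_beta')
    qed
    show "\<forall>y. y \<notin> F ` K \<longrightarrow> v y = 0"
    proof (intro allI impI)
      fix y assume "y \<notin> F ` K"
      then have "G y \<notin> K" using F(4)[of y] by (metis imageI)
      then have "u (G y) = 0" using K(3) by blast
      then show "v y = 0" by (simp add: v_def)
    qed
  qed
  \<comment> \<open>A bound on \<open>G'\<close> also bounds its transpose: pairing
    \<open>gv (F x)\<close> with itself brings \<open>G'\<close> back onto the vector
    \<open>gv (F x)\<close>, and one factor of its norm cancels.\<close>
  have gvF: "norm (gv (F x)) \<le> (1 + e) * norm (gradient u x)" for x
  proof (cases "x \<in> K")
    case True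
    then have x: "x \<in> A" using K(2) by blast
    have "norm (gv (F x)) * norm (gv (F x)) = gv (F x) \<bullet> gv (F x)"
      by (simp add: dot_square_norm power2_eq_square)
    also have "\<dots> = gradient u x \<bullet> G' (F x) (gv (F x))" by (simp add: gv F(3))
    also have "\<dots> \<le> norm (gradient u x) * norm (G' (F x) (gv (F x)))" by (rule norm_cauchy_schwarz)
    also have "\<dots> \<le> norm (gradient u x) * ((1 + e) * norm (gv (F x)))"
      by (intro mult_left_mono A(3)[OF x]) simp
    finally have "norm (gv (F x)) * norm (gv (F x)) \<le> ((1 + e) * norm (gradient u x)) * norm (gv (F x))"
      by (simp add: mult_ac)
    then show ?thesis using e by (cases "gv (F x) = 0") (simp_all add: mult_le_cancel_right)
  next
    case False
    then have "gradient u x = 0" using K(4) by blast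
    then have "gv (F x) = 0" by (simp add: gv_def F(3))
    then show ?thesis using e by simp
  qed
  have meas[measurable]: "gradient v \<in> borel_measurable borel" "v \<in> borel_measurable borel" "u \<in> borel_measurable borel"
    using borel_measurable_continuous_onI[OF Ck_1_continuous_gradient[OF v1(1)]]
      borel_measurable_continuous_onI[OF Ck_1_continuous[OF v1(1)]] borel_measurable_continuous_onI[OF K(6)] by auto
  have Ev: "energy v \<le> (1 + e)^2 * energy u"
  proof -
    have "energy v = (LINT x|lborel. (norm (gradient v (F x)))\<^sup>2)"
      unfolding energy_def by (rule volume_preserving_integral[OF F(1), symmetric]) measurable
    also have "\<dots> \<le> (LINT x|lborel. (1 + e)^2 * (norm (gradient u x))\<^sup>2)"
    proof (rule integral_mono)
      show "integrable lborel (\<lambda>x. (norm (gradient v (F x)))\<^sup>2)"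
        using C1c_integrable(4)[OF vH] volume_preserving_integrable[OF F(1), of "\<lambda>x. (norm (gradient v x))\<^sup>2"] by simp
      show "integrable lborel (\<lambda>x. (1 + e)^2 * (norm (gradient u x))\<^sup>2)"
        using C1c_integrable(4)[OF u] by simp
      show "(norm (gradient v (F x)))\<^sup>2 \<le> (1 + e)^2 * (norm (gradient u x))\<^sup>2" for x
        using power_mono[OF gvF[of x], of 2] by (simp add: v1(2) power_mult_distrib)
    qed
    finally show ?thesis by (simp add: energy_def)
  qed
  let ?wU = "boundary_weight \<sigma> U" and ?wH = "boundary_weight \<sigma> (half_space :: ((real^'n) \<times> real) set)"
  have neH: "frontier (half_space :: ((real^'n) \<times> real) set) \<noteq> {}"
    by (auto simp: frontier_half_space intro: exI[of _ 0])
  have Pv: "weighted_power ?wU p u \<le> (1 + e) powr \<sigma> * weighted_power ?wH p v"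
  proof -
    have i: "integrable lborel (\<lambda>y. ?wH y * \<bar>v y\<bar> powr p)"
      by (rule C1c_integrable_weighted[OF vH boundary_weight_continuous[OF open_half_space neH] p])
    have m: "(\<lambda>y. ?wH y * \<bar>v y\<bar> powr p) \<in> borel_measurable borel" by measurable
    have "weighted_power ?wU p u \<le> (LINT x|lborel. (1 + e) powr \<sigma> * (?wH (F x) * \<bar>v (F x)\<bar> powr p))"
      unfolding weighted_power_def
    proof (rule integral_mono)
      show "integrable lborel (\<lambda>x. ?wU x * \<bar>u x\<bar> powr p)"
        by (rule C1c_integrable_weighted[OF C1c_mono[OF u U(3)] boundary_weight_continuous[OF U(1,2)] p])
      show "integrable lborel (\<lambda>x. (1 + e) powr \<sigma> * (?wH (F x) * \<bar>v (F x)\<bar> powr p))"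
        using i volume_preserving_integrable[OF F(1) m] by simp
      fix x
      show "?wU x * \<bar>u x\<bar> powr p \<le> (1 + e) powr \<sigma> * (?wH (F x) * \<bar>v (F x)\<bar> powr p)"
      proof (cases "x \<in> K")
        case True
        then have x: "x \<in> A" using K(2) by blast
        define \<delta> where "\<delta> = infdist x (frontier U)"
        have h: "0 < snd (F x)" "snd (F x) \<le> (1 + e) * \<delta>" using A(1,2)[OF x] by (auto simp: \<delta>_def)
        have \<delta>: "0 < \<delta>" unfolding \<delta>_def by (rule infdist_frontier_pos[OF U(1,2) subsetD[OF U(3) x]])
        have "((1 + e) * \<delta>) powr (- \<sigma>) \<le> snd (F x) powr (- \<sigma>)"
          using h \<sigma> by (intro powr_mono2') auto
        then have "(1 + e) powr (- \<sigma>) * \<delta> powr (- \<sigma>) \<le> snd (F x) powr (- \<sigma>)"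
          using e \<delta> by (simp add: powr_mult)
        then have "(1 + e) powr \<sigma> * ((1 + e) powr (- \<sigma>) * \<delta> powr (- \<sigma>)) \<le> (1 + e) powr \<sigma> * snd (F x) powr (- \<sigma>)"
          by (intro mult_left_mono) auto
        then have "\<delta> powr (- \<sigma>) \<le> (1 + e) powr \<sigma> * snd (F x) powr (- \<sigma>)"
          using e by (simp add: powr_minus field_simps)
        then have "?wU x \<le> (1 + e) powr \<sigma> * ?wH (F x)"
          using h(1) by (simp add: boundary_weight_def \<delta>_def infdist_frontier_half_space)
        then have "?wU x * \<bar>u x\<bar> powr p \<le> ((1 + e) powr \<sigma> * ?wH (F x)) * \<bar>u x\<bar> powr p"
          by (intro mult_right_mono) auto
        then show ?thesis by (simp add: v_def F(3) mult.assoc)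
      next
        case False
        then have "u x = 0" using K(3) by blast
        then show ?thesis by (simp add: v_def F(3))
      qed
    qed
    also have "\<dots> = (1 + e) powr \<sigma> * weighted_power ?wH p v"
      unfolding weighted_power_def using volume_preserving_integral[OF F(1) m] by simp
    finally show ?thesis .
  qed
  have "weighted_power ?wU p u powr s \<le> ((1 + e) powr \<sigma> * weighted_power ?wH p v) powr s"
    using Pv s by (intro powr_mono2) (auto simp: weighted_power_nonneg boundary_weight_nonneg)
  also have "\<dots> = (1 + e) powr (\<sigma> * s) * weighted_power ?wH p v powr s"
    using e by (simp add: powr_mult powr_powr weighted_power_nonneg boundary_weight_nonneg)
  also have "\<dots> \<le> (1 + e)^2 * weighted_power ?wH p v powr s"
  proof (rule mult_right_mono)
    have "\<sigma> * s \<le> 2 * 1" using \<sigma> \<sigma>2 s by (intro mult_mono) auto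
    then have "(1 + e) powr (\<sigma> * s) \<le> (1 + e) powr 2" using e by (intro powr_mono) auto
    then show "(1 + e) powr (\<sigma> * s) \<le> (1 + e)^2" using e by (simp add: powr_numeral)
  qed simp
  finally have 1: "weighted_power ?wU p u powr s \<le> (1 + e)^2 * weighted_power ?wH p v powr s" .
  have "\<mu> \<beta> (half_space :: ((real^'n) \<times> real) set) * weighted_power ?wU p u powr s
      \<le> \<mu> \<beta> (half_space :: ((real^'n) \<times> real) set) * ((1 + e)^2 * weighted_power ?wH p v powr s)"
    by (rule mult_left_mono[OF 1 \<mu>])
  also have "\<dots> = (1 + e)^2 * (\<mu> \<beta> (half_space :: ((real^'n) \<times> real) set) * weighted_power ?wH p v powr s)"
    by simp
  also have "\<dots> \<le> (1 + e)^2 * energy v"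
    using half_space_inequality[OF vH \<beta>] by (intro mult_left_mono) (simp_all add: \<sigma>_def p_def s_def N_def)
  also have "\<dots> \<le> (1 + e)^2 * ((1 + e)^2 * energy u)"
    by (rule mult_left_mono[OF Ev]) simp
  also have "\<dots> = (1 + e)^4 * energy u"
    by (simp add: power4_eq_xxxx power2_eq_square)
  finally show ?thesis by (simp add: p_def s_def)
qed

text \<open>Away from the frontier a translation is enough: it puts \<open>x0\<close> at a height
  equal to its distance \<open>d\<close> from the frontier. On a ball of radius \<open>r\<close>
  both height and distance change by at most \<open>r\<close>.\<close>

lemma chart_at_interior_point:
  fixes U :: "((real^'n) \<times> real) set"
  assumes U: "open U" "frontier U \<noteq> {}" "x0 \<in> U" and e: "0 < e"
  obtains r z where "0 < r" "\<And>x. x \<in> ball x0 r \<Longrightarrow> 0 < snd (x + z)"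
    "\<And>x. x \<in> ball x0 r \<Longrightarrow> snd (x + z) \<le> (1 + e) * infdist x (frontier U)"
proof -
  define d where "d = infdist x0 (frontier U)"
  have d: "0 < d" using infdist_frontier_pos[OF U] by (simp add: d_def)
  \<comment> \<open>This solves \<open>(1 + e) * (d - r) = d + r\<close>, the worst case of distance
    against height.\<close>
  define r where "r = e * d / (2 + e)"
  have r: "0 < r" "r < d" using e d by (auto simp: r_def divide_less_eq algebra_simps)
  have re: "r * (2 + e) = e * d" using e by (simp add: r_def)
  show ?thesis
  proof (rule that[OF r(1)])
    fix x assume "x \<in> ball x0 r"
    then have x: "dist x x0 < r" by (simp add: dist_commute)
    then have 1: "\<bar>snd x - snd x0\<bar> < r" using dist_snd_le[of x x0] by (simp add: dist_real_def)
    then show "0 < snd (x + ((0, d) - x0))" using r by simp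
    have "d \<le> infdist x (frontier U) + dist x0 x" unfolding d_def by (rule infdist_triangle)
    then have "d - r \<le> infdist x (frontier U)" using x by (simp add: dist_commute)
    then have "(1 + e) * (d - r) \<le> (1 + e) * infdist x (frontier U)" using e by (intro mult_left_mono) auto
    moreover have "(1 + e) * (d - r) = d + r" using re by (simp add: algebra_simps)
    ultimately show "snd (x + ((0, d) - x0)) \<le> (1 + e) * infdist x (frontier U)" using 1 by simp
  qed
qed

text \<open>
  The boundary is flattened by a shear which agrees at the centre with the identity up to first order,
  followed by a reflection making the tangent plane horizontal; both preserve volume, and the
  composition is nearly isometric near the centre.
\<close>

lemma chart_at_boundary_point:
  fixes U :: "((real^'n) \<times> real) set"
  assumes U: "open U" "C1_boundary U" "x0 \<in> frontier U" and e: "0 < e"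
  obtains r F G G' where "0 < r" "volume_preserving F" "continuous_on UNIV F" "\<And>x. G (F x) = x" "\<And>y. F (G y) = y"
    "\<And>y. (G has_derivative G' y) (at y)" "\<And>h. continuous_on UNIV (\<lambda>y. G' y h)"
    "\<And>x. x \<in> U \<inter> ball x0 r \<Longrightarrow> 0 < snd (F x)"
    "\<And>x. x \<in> U \<inter> ball x0 r \<Longrightarrow> snd (F x) \<le> (1 + e) * infdist x (frontier U)"
    "\<And>x h. x \<in> U \<inter> ball x0 r \<Longrightarrow> norm (G' (F x) h) \<le> (1 + e) * norm h"
proof -
  obtain r0 T and \<gamma> :: "real^'n \<Rightarrow> real" where r0: "r0 > 0" and T: "orthogonal_transformation T" and \<gamma>: "Ck 1 \<gamma>"
    and graph: "U \<inter> ball x0 r0 = {x \<in> ball x0 r0. snd (T x) > \<gamma> (fst (T x))}"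
    using U(2,3) unfolding C1_boundary_def by blast
  have linT: "linear T" using T by (rule orthogonal_transformation_linear)
  have nT: "norm (T x) = norm x" for x using T unfolding orthogonal_transformation by blast
  have cT: "continuous_on S T" for S using linT linear_continuous_on linear_conv_bounded_linear by blast
  have nf: "norm (fst q) \<le> norm q" for q :: "(real^'n) \<times> real"
    using norm_fst_le[of "fst q" "snd q"] by simp
  define y0 where "y0 = fst (T x0)"
  define a where "a = gradient \<gamma> y0"
  \<comment> \<open>The shear by \<open>g\<close> sends the graph of \<gamma> to the hyperplane
    \<open>snd q = a \<bullet> fst q\<close> through the origin, with unit normal \<open>w\<close>;
    the reflection then makes it horizontal. By the choice of \<open>a\<close> the gradient of
    \<open>g\<close> vanishes at \<open>y0\<close>, so the shear is close to an isometry
    there.\<close>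
  define g where "g y = a \<bullet> y - \<gamma> y" for y
  have c\<gamma>: "continuous_on UNIV \<gamma>" "continuous_on UNIV (gradient \<gamma>)"
    using Ck_1_continuous[OF \<gamma>] Ck_1_continuous_gradient[OF \<gamma>] by auto
  have cg: "continuous_on UNIV g" unfolding g_def by (intro continuous_intros c\<gamma>)
  define c where "c = 1 / norm ((- a, 1) :: (real^'n) \<times> real)"
  have na: "norm ((- a, 1) :: (real^'n) \<times> real) \<ge> 1" by (simp add: norm_Pair real_le_rsqrt)
  have n0: "0 < norm ((- a, 1) :: (real^'n) \<times> real)" using na by linarith
  have c: "0 < c" "c \<le> 1" using na n0 by (simp_all add: c_def divide_le_eq)
  define w where "w = c *\<^sub>R ((- a, 1) :: (real^'n) \<times> real)"
  have nw: "norm w = 1" by (simp only: w_def norm_scaleR) (use n0 in \<open>simp add: c_def\<close>)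
  have ne: "norm ((0, 1) :: (real^'n) \<times> real) = 1" by (simp add: norm_Pair)
  obtain S where S: "orthogonal_transformation S" "\<And>x. S (S x) = x" "\<And>x. (0, 1) \<bullet> S x = w \<bullet> x"
    using reflection_exchanging[OF nw ne] by blast
  have sndS: "snd (S x) = w \<bullet> x" for x using S(3)[of x] by (simp add: inner_prod_def)
  have linS: "linear S" using S(1) by (rule orthogonal_transformation_linear)
  have nS: "norm (S x) = norm x" for x using S(1) unfolding orthogonal_transformation by blast
  have cS: "continuous_on X S" for X using linS linear_continuous_on linear_conv_bounded_linear by blast
  define R where "R = inv T"
  have R: "orthogonal_transformation R" "\<And>x. R (T x) = x" "\<And>x. T (R x) = x"
    unfolding R_def using orthogonal_transformation_inv[OF T] orthogonal_transformation_inj[OF T]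
      orthogonal_transformation_surj[OF T] by (auto simp: surj_f_inv_f)
  have linR: "linear R" using R(1) by (rule orthogonal_transformation_linear)
  have nR: "norm (R x) = norm x" for x using R(1) unfolding orthogonal_transformation by blast
  have cR: "continuous_on X R" for X using linR linear_continuous_on linear_conv_bounded_linear by blast
  define P where "P q = (fst q, snd q + g (fst q))" for q
  define Q where "Q q = (fst q, snd q - g (fst q))" for q
  have QP: "Q (P q) = q" "P (Q q) = q" for q by (simp_all add: P_def Q_def)
  define D where "D q h = (fst h, snd h - (a - gradient \<gamma> (fst q)) \<bullet> fst h)" for q h :: "(real^'n) \<times> real"
  define F where "F x = S (P (T x))" for x
  define G where "G y = R (Q (S y))" for y
  define G' where "G' y h = R (D (S y) (S h))" for y h
  have vF: "volume_preserving F"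
  proof -
    have "volume_preserving P" unfolding P_def using volume_preserving_shear[OF cg] .
    then have "volume_preserving (\<lambda>x. P (T x))"
      by (rule volume_preserving_compose[OF _ volume_preserving_orthogonal[OF T]])
    then show ?thesis unfolding F_def[abs_def]
      by (rule volume_preserving_compose[OF volume_preserving_orthogonal[OF S(1)]])
  qed
  have cF: "continuous_on UNIV F"
  proof -
    have "continuous_on UNIV (\<lambda>x. g (fst (T x)))"
      by (rule continuous_on_compose2[OF cg]) (auto intro!: continuous_intros cT)
    then have "continuous_on UNIV (\<lambda>x. P (T x))"
      unfolding P_def by (intro continuous_intros cT)
    then show ?thesis unfolding F_def[abs_def] by (rule continuous_on_compose2[OF cS]) auto
  qed
  have GF: "G (F x) = x" "F (G y) = y" for x y by (simp_all add: F_def G_def S(2) QP R)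
  have DG: "(G has_derivative G' y) (at y)" for y
  proof -
    have 1: "(S has_derivative S) (at y)" using linS by (simp add: linear_imp_has_derivative)
    have 2: "(Q has_derivative D q) (at q)" for q
    proof -
      have f: "((\<lambda>q::(real^'n) \<times> real. fst q) has_derivative (\<lambda>h. fst h)) (at q)" by (auto intro!: derivative_eq_intros)
      have "((\<lambda>q. \<gamma> (fst q)) has_derivative (\<lambda>h. gradient \<gamma> (fst q) \<bullet> fst h)) (at q)"
        using has_derivative_compose[OF f Ck_1_has_derivative[OF \<gamma>]] .
      then have "((\<lambda>q. (fst q, snd q - (a \<bullet> fst q - \<gamma> (fst q)))) has_derivative
         (\<lambda>h. (fst h, snd h - (a \<bullet> fst h - gradient \<gamma> (fst q) \<bullet> fst h)))) (at q)"
        by (auto intro!: derivative_eq_intros)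
      then show ?thesis by (simp add: Q_def[abs_def] g_def D_def[abs_def] inner_diff_left)
    qed
    have 3: "(R has_derivative R) (at z)" for z using linR by (simp add: linear_imp_has_derivative)
    show ?thesis
      using has_derivative_compose[OF has_derivative_compose[OF 1 2] 3]
      by (simp add: G_def[abs_def] G'_def[abs_def])
  qed
  have cG': "continuous_on UNIV (\<lambda>y. G' y h)" for h
  proof -
    have "continuous_on UNIV (\<lambda>y. gradient \<gamma> (fst (S y)))"
      by (rule continuous_on_compose2[OF c\<gamma>(2)]) (auto intro!: continuous_intros cS)
    then have "continuous_on UNIV (\<lambda>y. D (S y) (S h))"
      unfolding D_def by (intro continuous_intros)
    then show ?thesis unfolding G'_def by (rule continuous_on_compose2[OF cR]) auto
  qed
  have sndF: "snd (F x) = c * (snd (T x) - \<gamma> (fst (T x)))" for x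
    by (simp add: F_def sndS w_def P_def g_def inner_prod_def algebra_simps)
  obtain r1 where r1: "r1 > 0" "\<And>y. norm (y - y0) < r1 \<Longrightarrow> norm (gradient \<gamma> y - a) < e"
    using c\<gamma>(2) e unfolding continuous_on_iff a_def dist_norm by (metis UNIV_I)
  define \<rho> where "\<rho> = min r0 r1"
  have \<rho>: "\<rho> > 0" "\<rho> \<le> r0" "\<rho> \<le> r1" using r0 r1 by (auto simp: \<rho>_def)
  have fy: "norm (fst (T x) - y0) < r1" if "x \<in> ball x0 \<rho>" for x
  proof -
    have "norm (fst (T x) - y0) = norm (fst (T (x - x0)))" by (simp add: y0_def linear_diff[OF linT])
    also have "\<dots> \<le> norm (x - x0)" using nf[of "T (x - x0)"] by (simp only: nT)
    finally show ?thesis using that \<rho> by (simp add: dist_norm norm_minus_commute)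
  qed
  have bdry: "snd (T z) = \<gamma> (fst (T z))" if z: "z \<in> frontier U" "z \<in> ball x0 r0" for z
  proof (rule antisym)
    have "z \<notin> U" using z(1) U(1) frontier_disjoint_eq by blast
    then have "z \<notin> {x \<in> ball x0 r0. snd (T x) > \<gamma> (fst (T x))}" unfolding graph[symmetric] by blast
    then show "snd (T z) \<le> \<gamma> (fst (T z))" using z(2) by simp
    have zc: "z \<in> closure (U \<inter> ball x0 r0)"
    proof -
      have "z \<in> ball x0 r0 \<inter> closure U" using z by (simp add: frontier_def)
      then have "z \<in> closure (ball x0 r0 \<inter> U)" by (rule subsetD[OF open_Int_closure_subset[OF open_ball]])
      then show ?thesis by (simp only: Int_commute)
    qed
    have "closed {x. \<gamma> (fst (T x)) \<le> snd (T x)}"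
      by (intro closed_Collect_le continuous_on_compose2[OF c\<gamma>(1)]) (auto intro!: continuous_intros cT)
    moreover have "U \<inter> ball x0 r0 \<subseteq> {x. \<gamma> (fst (T x)) \<le> snd (T x)}" unfolding graph by auto
    ultimately have "closure (U \<inter> ball x0 r0) \<subseteq> {x. \<gamma> (fst (T x)) \<le> snd (T x)}" by (rule closure_minimal[rotated])
    then show "\<gamma> (fst (T z)) \<le> snd (T z)" using zc by blast
  qed
  have lip: "\<bar>(\<gamma> y - a \<bullet> y) - (\<gamma> y' - a \<bullet> y')\<bar> \<le> e * norm (y - y')" if "norm (y - y0) < r1" "norm (y' - y0) < r1" for y y'
  proof -
    have "norm ((\<gamma> y - a \<bullet> y) - (\<gamma> y' - a \<bullet> y')) \<le> e * norm (y - y')"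
    proof (rule differentiable_bound[where S="ball y0 r1" and f="\<lambda>y. \<gamma> y - a \<bullet> y" and f'="\<lambda>y h. (gradient \<gamma> y - a) \<bullet> h"])
      fix y assume y: "y \<in> ball y0 r1"
      have "((\<lambda>y. a \<bullet> y) has_derivative (\<lambda>h. a \<bullet> h)) (at y within ball y0 r1)"
        by (auto intro!: derivative_eq_intros)
      from has_derivative_diff[OF has_derivative_at_withinI[OF Ck_1_has_derivative[OF \<gamma>]] this]
      show "((\<lambda>y. \<gamma> y - a \<bullet> y) has_derivative (\<lambda>h. (gradient \<gamma> y - a) \<bullet> h)) (at y within ball y0 r1)"
        by (simp add: inner_diff_left)
      show "onorm (\<lambda>h. (gradient \<gamma> y - a) \<bullet> h) \<le> e"
      proof (rule onorm_bound)
        have n: "norm (gradient \<gamma> y - a) \<le> e" using r1(2)[of y] y by (simp add: dist_norm norm_minus_commute)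
        show "norm ((gradient \<gamma> y - a) \<bullet> h) \<le> e * norm h" for h
          using Cauchy_Schwarz_ineq2[of "gradient \<gamma> y - a" h] mult_right_mono[OF n, of "norm h"] by simp
      qed (use e in simp)
    qed (use that in \<open>auto simp: dist_norm norm_minus_commute\<close>)
    then show ?thesis by simp
  qed
  show ?thesis
  \<comment> \<open>With half the radius, the frontier point nearest to \<open>x\<close> is no
    farther from \<open>x\<close> than \<open>x0\<close> is, hence stays in the ball of radius
    \<rho>, where the graph description and the Lipschitz estimate hold.\<close>
  proof (rule that[of "\<rho> / 2" F G G'])
    fix x assume x: "x \<in> U \<inter> ball x0 (\<rho> / 2)"
    then have xr: "x \<in> ball x0 r0" "x \<in> ball x0 \<rho>" using \<rho> by auto
    have "x \<in> {x \<in> ball x0 r0. snd (T x) > \<gamma> (fst (T x))}" unfolding graph[symmetric] using x xr by blast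
    then have pos: "0 < snd (T x) - \<gamma> (fst (T x))" by simp
    then show "0 < snd (F x)" using c by (simp add: sndF)
    have "frontier U \<noteq> {}" using U(3) by blast
    then obtain z where z: "z \<in> frontier U" "infdist x (frontier U) = dist x z"
      using infdist_attains_inf[OF frontier_closed] by blast
    have "dist x z \<le> dist x x0" using infdist_le[OF U(3), of x] z(2) by simp
    moreover have "dist x0 z \<le> dist x0 x + dist x z" by (rule dist_triangle)
    ultimately have "dist x0 z < \<rho>" using x by (simp add: dist_commute)
    then have zr: "z \<in> ball x0 r0" "z \<in> ball x0 \<rho>" using \<rho> by auto
    define k where "k = fst (T x) - fst (T z)"
    have kle: "norm k \<le> dist x z"
    proof -
      have "norm k = norm (fst (T (x - z)))" by (simp add: k_def linear_diff[OF linT])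
      also have "\<dots> \<le> norm (x - z)" using nf[of "T (x - z)"] by (simp only: nT)
      finally show ?thesis by (simp add: dist_norm)
    qed
    \<comment> \<open>The nearest frontier point \<open>z\<close> has image of height 0 and is
      subtracted. The linear part is at most \<open>dist x z\<close> since \<open>w\<close> is a
      unit vector; the deviation of \<gamma> from its linear part is
      \<open>e\<close>-Lipschitz.\<close>
    have "snd (F x) = w \<bullet> T (x - z) - c * ((\<gamma> (fst (T x)) - a \<bullet> fst (T x)) - (\<gamma> (fst (T z)) - a \<bullet> fst (T z)))"
      using bdry[OF z(1) zr(1)]
      by (simp add: sndF w_def inner_prod_def linear_diff[OF linT] inner_diff_right algebra_simps)
    also have "\<dots> \<le> norm w * norm (T (x - z)) + c * (e * norm k)"
    proof -
      have "- ((\<gamma> (fst (T x)) - a \<bullet> fst (T x)) - (\<gamma> (fst (T z)) - a \<bullet> fst (T z))) \<le> e * norm k"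
        using lip[OF fy[OF xr(2)] fy[OF zr(2)]] by (simp add: k_def abs_le_iff)
      then have "c * (- ((\<gamma> (fst (T x)) - a \<bullet> fst (T x)) - (\<gamma> (fst (T z)) - a \<bullet> fst (T z)))) \<le> c * (e * norm k)"
        using c by (intro mult_left_mono) auto
      then have "- (c * ((\<gamma> (fst (T x)) - a \<bullet> fst (T x)) - (\<gamma> (fst (T z)) - a \<bullet> fst (T z)))) \<le> c * (e * norm k)"
        by (simp only: mult_minus_right)
      then show ?thesis using norm_cauchy_schwarz[of w "T (x - z)"] by linarith
    qed
    also have "\<dots> \<le> dist x z + 1 * (e * dist x z)"
      using c e kle by (intro add_mono mult_mono) (auto simp: nw nT dist_norm)
    finally show "snd (F x) \<le> (1 + e) * infdist x (frontier U)"
      by (simp add: z(2) algebra_simps)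
    fix h
    define b where "b = a - gradient \<gamma> (fst (T x))"
    have b: "norm b \<le> e" using r1(2)[OF fy[OF xr(2)]] by (simp add: b_def norm_minus_commute)
    \<comment> \<open>\<open>R\<close> and \<open>S\<close> are isometries and
      \<open>S (F x)\<close> has the horizontal coordinate of \<open>T x\<close>, so
      \<open>G'\<close> differs from an isometry only by a vertical term of size at most
      \<open>norm b\<close>.\<close>
    have "norm (G' (F x) h) = norm (S h - (0, b \<bullet> fst (S h)))"
      by (simp add: G'_def F_def S(2) nR D_def P_def b_def prod_eq_iff minus_prod_def)
    also have "\<dots> \<le> norm (S h) + norm ((0, b \<bullet> fst (S h)) :: (real^'n) \<times> real)" by (rule norm_triangle_ineq4)
    also have "\<dots> \<le> norm h + e * norm h"
    proof -
      have "\<bar>b \<bullet> fst (S h)\<bar> \<le> norm b * norm (fst (S h))" by (rule Cauchy_Schwarz_ineq2)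
      also have "\<dots> \<le> e * norm h"
        using b e nf[of "S h"] nS[of h] by (intro mult_mono) auto
      finally show ?thesis by (simp add: nS norm_Pair)
    qed
    finally show "norm (G' (F x) h) \<le> (1 + e) * norm h" by (simp add: algebra_simps)
  qed (use \<rho> vF cF GF DG cG' in auto)
qed

lemma local_inequality:
  fixes U :: "((real^'n) \<times> real) set"
  assumes U: "open U" "C1_boundary U" "frontier U \<noteq> {}" "x0 \<in> closure U"
    and \<beta>: "0 \<le> \<beta>" and \<mu>: "0 \<le> \<mu> \<beta> (half_space :: ((real^'n) \<times> real) set)" and e: "0 < e"
  defines "N \<equiv> real CARD('n) + 1"
  defines "\<sigma> \<equiv> 2 - (real CARD('n) - 1) / N * \<beta>"
  assumes \<sigma>: "0 \<le> \<sigma>"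
  obtains r where "0 < r" "\<And>u. u \<in> C1c (U \<inter> ball x0 r) \<Longrightarrow>
    \<mu> \<beta> (half_space :: ((real^'n) \<times> real) set) *
      weighted_power (boundary_weight \<sigma> U) (2 + 2 * \<beta> / N) u powr (N / (N + \<beta>)) \<le> (1 + e) ^ 4 * energy u"
proof (cases "x0 \<in> U")
  case True
  obtain r z where r: "0 < r" and z: "\<And>x. x \<in> ball x0 r \<Longrightarrow> 0 < snd (x + z)"
    "\<And>x. x \<in> ball x0 r \<Longrightarrow> snd (x + z) \<le> (1 + e) * infdist x (frontier U)"
    using chart_at_interior_point[OF U(1,3) True e] by metis
  show ?thesis
  proof (rule that[OF r])
    fix u assume u: "u \<in> C1c (U \<inter> ball x0 r)"
    show "\<mu> \<beta> (half_space :: ((real^'n) \<times> real) set) *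
      weighted_power (boundary_weight \<sigma> U) (2 + 2 * \<beta> / N) u powr (N / (N + \<beta>)) \<le> (1 + e) ^ 4 * energy u"
      unfolding \<sigma>_def N_def
    proof (rule inequality_in_chart[OF U(1,3) _ \<beta> \<mu> volume_preserving_translation[of z], where G="\<lambda>x. x - z" and G'="\<lambda>y h. h"])
      show "((\<lambda>x. x - z) has_derivative (\<lambda>h. h)) (at y)" for y by (auto intro!: derivative_eq_intros)
      show "norm h \<le> (1 + e) * norm h" for h :: "(real^'n) \<times> real"
        using e by (simp add: algebra_simps)
    qed (use u z e \<sigma> in \<open>auto intro!: continuous_intros simp: \<sigma>_def N_def\<close>)
  qed
next
  case False
  then have "x0 \<in> frontier U" using U(1,4) by (simp add: frontier_def interior_open)
  note * = chart_at_boundary_point[OF U(1,2) this e]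
  obtain r F G G' where r: "0 < r" and F: "volume_preserving F" "continuous_on UNIV F" "\<And>x. G (F x) = x" "\<And>y. F (G y) = y"
    "\<And>y. (G has_derivative G' y) (at y)" "\<And>h. continuous_on UNIV (\<lambda>y. G' y h)"
    "\<And>x. x \<in> U \<inter> ball x0 r \<Longrightarrow> 0 < snd (F x)"
    "\<And>x. x \<in> U \<inter> ball x0 r \<Longrightarrow> snd (F x) \<le> (1 + e) * infdist x (frontier U)"
    "\<And>x h. x \<in> U \<inter> ball x0 r \<Longrightarrow> norm (G' (F x) h) \<le> (1 + e) * norm h" by (rule *) blast
  show ?thesis
  proof (rule that[OF r])
    fix u assume u: "u \<in> C1c (U \<inter> ball x0 r)"
    show "\<mu> \<beta> (half_space :: ((real^'n) \<times> real) set) *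
      weighted_power (boundary_weight \<sigma> U) (2 + 2 * \<beta> / N) u powr (N / (N + \<beta>)) \<le> (1 + e) ^ 4 * energy u"
      unfolding \<sigma>_def N_def
      by (rule inequality_in_chart[OF U(1,3) _ \<beta> \<mu> F(1-6) _ F(7-9) u]) (use e \<sigma> in \<open>auto simp: \<sigma>_def N_def\<close>)
  qed
qed

section \<open>From local to global inequalities\<close>

lemma Ck_1_compose:
  fixes f :: "'a::euclidean_space \<Rightarrow> real"
  assumes f: "Ck 1 f" "\<And>x. f x \<in> X"
    and \<phi>: "\<And>t. t \<in> X \<Longrightarrow> (\<phi> has_field_derivative \<phi>' t) (at t)" "continuous_on X \<phi>'"
  shows "Ck 1 (\<lambda>x. \<phi> (f x))"
proof (rule Ck_1I)
  show "((\<lambda>x. \<phi> (f x)) has_derivative (\<lambda>h. (\<phi>' (f x) *\<^sub>R gradient f x) \<bullet> h)) (at x)" for x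
  proof -
    have "((\<lambda>x. \<phi> (f x)) has_derivative (\<lambda>h. \<phi>' (f x) * (gradient f x \<bullet> h))) (at x)"
      using has_derivative_compose[OF Ck_1_has_derivative[OF f(1)] \<phi>(1)[OF f(2), unfolded has_field_derivative_def]] .
    then show ?thesis by simp
  qed
  show "continuous_on UNIV (\<lambda>x. \<phi>' (f x) *\<^sub>R gradient f x)"
    by (intro continuous_on_scaleR Ck_1_continuous_gradient[OF f(1)] continuous_on_compose2[OF \<phi>(2) Ck_1_continuous[OF f(1)]])
       (use f(2) in blast)
qed

lemma Ck_1_exp_bump:
  assumes "Ck 1 f" shows "Ck 1 (\<lambda>x. exp_bump 0 (f x))"
proof (rule Ck_1_compose[where X=UNIV and \<phi>="exp_bump 0", OF assms])
  show "(exp_bump 0 has_field_derivative exp_bump (0 + 2) t - real 0 * exp_bump (0 + 1) t) (at t)" for t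
    by (rule exp_bump_has_derivative)
  have cb: "isCont (exp_bump m) t" for m t by (rule DERIV_isCont[OF exp_bump_has_derivative])
  have "continuous_on UNIV (exp_bump m)" for m by (rule continuous_at_imp_continuous_on) (simp add: cb)
  then show "continuous_on UNIV (\<lambda>t. exp_bump (0 + 2) t - real 0 * exp_bump (0 + 1) t)"
    by (intro continuous_intros)
qed simp_all

lemma exp_bump_pos_iff: "0 < exp_bump m t \<longleftrightarrow> 0 < t"
  by (simp add: exp_bump_def)

lemma Ck_sum:
  assumes "finite I" "\<And>i. i \<in> I \<Longrightarrow> Ck k (f i)"
  shows "Ck k (\<lambda>x. \<Sum>i\<in>I. f i x)"
  using assms
proof (induction I)
  case empty then show ?case by (simp add: Ck_const)
next
  case (insert i I)
  then have "Ck k (\<lambda>x. f i x + (\<Sum>i\<in>I. f i x))" by (intro Ck_add) auto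
  then show ?case using insert by simp
qed

text \<open>Squares summing to 1 are the right normalization: they split \<open>u^2\<close> and, up
  to lower-order terms, the squared gradient into localized parts.\<close>

lemma partition_of_unity:
  fixes X :: "'a::euclidean_space set"
  assumes X: "compact X" and r: "\<And>x. x \<in> X \<Longrightarrow> 0 < r x"
  shows "\<exists>I (\<theta> :: 'a \<Rightarrow> 'a \<Rightarrow> real). finite I \<and> I \<subseteq> X \<and> (\<forall>i. Ck 1 (\<theta> i)) \<and>
    (\<forall>x\<in>X. (\<Sum>i\<in>I. (\<theta> i x)\<^sup>2) = 1) \<and> (\<forall>i x. r i \<le> dist i x \<longrightarrow> 0 \<le> r i \<longrightarrow> \<theta> i x = 0)"
proof -
  obtain I where I: "I \<subseteq> X" "finite I" "X \<subseteq> (\<Union>i\<in>I. ball i (r i))"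
    using compactE_image[OF X, of X "\<lambda>x. ball x (r x)"] r by (metis (no_types, lifting) UN_I centre_in_ball open_ball subsetI)
  define \<eta> where "\<eta> i x = exp_bump 0 ((r i)\<^sup>2 - (x - i) \<bullet> (x - i))" for i x :: 'a
  have C\<eta>: "Ck 1 (\<eta> i)" for i
    unfolding \<eta>_def
  proof (rule Ck_1_exp_bump, rule Ck_1I)
    show "((\<lambda>x. (r i)\<^sup>2 - (x - i) \<bullet> (x - i)) has_derivative (\<lambda>h. ((-2) *\<^sub>R (x - i)) \<bullet> h)) (at x)" for x
      by (auto intro!: derivative_eq_intros simp: inner_commute)
  qed (auto intro!: continuous_intros)
  have dd: "(x - i) \<bullet> (x - i) = (dist i x)\<^sup>2" for i x :: 'a
    by (metis dist_commute dist_norm power2_norm_eq_inner)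
  have \<eta>0: "\<eta> i x = 0" if "r i \<le> dist i x" "0 \<le> r i" for i x
  proof -
    have "(r i)\<^sup>2 \<le> (dist i x)\<^sup>2" using that by (intro power_mono) auto
    then show ?thesis by (simp add: \<eta>_def dd exp_bump_def)
  qed
  have \<eta>p: "0 < \<eta> i x" if "dist i x < r i" for i x
  proof -
    have "(dist i x)\<^sup>2 < (r i)\<^sup>2" using that by (intro power_strict_mono) auto
    then show ?thesis by (simp add: \<eta>_def dd exp_bump_pos_iff)
  qed
  define S where "S x = (\<Sum>i\<in>I. \<eta> i x * \<eta> i x)" for x
  have CS: "Ck 1 S" unfolding S_def[abs_def] by (intro Ck_sum I Ck_mult C\<eta>)
  have S0: "0 \<le> S x" for x by (simp add: S_def sum_nonneg)
  have SX: "0 < S x" if xX: "x \<in> X" for x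
  proof -
    obtain i where i: "i \<in> I" "dist i x < r i" using I(3) xX by auto
    have "0 < \<eta> i x * \<eta> i x" using \<eta>p[OF i(2)] by simp
    then show ?thesis unfolding S_def using I(2) i(1) by (intro sum_pos2) auto
  qed
  obtain c where c: "0 < c" "\<And>x. x \<in> X \<Longrightarrow> c \<le> S x"
  proof (cases "X = {}")
    case False
    have "continuous_on X S" using Ck_1_continuous[OF CS] continuous_on_subset by blast
    from continuous_attains_inf[OF X False this] obtain y where "y \<in> X" "\<forall>x\<in>X. S y \<le> S x" by blast
    then show ?thesis using that[of "S y"] SX by blast
  qed (use that[of 1] in auto)
  \<comment> \<open>The added bump vanishes where \<open>S x \<ge> c\<close>, in particular on
    \<open>X\<close>, and is positive where \<open>S x = 0\<close>. Thus \<open>S'\<close> agrees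
    with \<open>S\<close> on \<open>X\<close> and is positive everywhere, so that dividing by its
    root is C^1 on the whole space.\<close>
  define S' where "S' x = S x + exp_bump 0 (c + (-1) * S x)" for x
  have CS': "Ck 1 S'" unfolding S'_def[abs_def]
    by (rule Ck_add[OF CS Ck_1_exp_bump[OF Ck_add[OF Ck_const Ck_cmult[OF CS]]]])
  have S'p: "0 < S' x" for x
  proof (cases "S x = 0")
    case True
    then show ?thesis using c(1) by (simp add: S'_def exp_bump_pos_iff)
  next
    case False
    then show ?thesis using S0[of x] exp_bump_le(1)[of 0 "c + (-1) * S x"] by (simp add: S'_def)
  qed
  have S'X: "S' x = S x" if "x \<in> X" for x using c(2)[OF that] by (simp add: S'_def exp_bump_def)
  define \<theta> where "\<theta> i x = \<eta> i x * S' x powr (- 1/2)" for i x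
  have CP: "Ck 1 (\<lambda>x. S' x powr (- 1/2))"
  proof (rule Ck_1_compose[where X="{0<..}", OF CS'])
    show "((\<lambda>t. t powr (- 1/2)) has_field_derivative (- 1/2) * t powr (- 1/2 - 1)) (at t)" if "t \<in> {0<..}" for t :: real
      using that by (intro has_real_derivative_powr) simp
    show "continuous_on {0<..} (\<lambda>t::real. (- 1/2) * t powr (- 1/2 - 1))"
      by (auto intro!: continuous_intros)
  qed (use S'p in auto)
  show ?thesis
  proof (intro exI[of _ I] exI[of _ \<theta>] conjI I allI ballI impI)
    show "Ck 1 (\<theta> i)" for i unfolding \<theta>_def[abs_def] by (rule Ck_mult[OF C\<eta> CP])
    fix x assume x: "x \<in> X"
    have "(\<theta> i x)\<^sup>2 = \<eta> i x * \<eta> i x / S x" for i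
    proof -
      have "(S x powr (- 1/2))\<^sup>2 = S x powr (-1)"
        by (simp add: power2_eq_square flip: powr_add)
      also have "S x powr (-1) = 1 / S x"
        using SX[OF x] powr_minus[of "S x" 1] by (simp add: divide_inverse)
      finally have "(S x powr (- 1/2))\<^sup>2 = 1 / S x" .
      then show ?thesis
        unfolding \<theta>_def S'X[OF x] power_mult_distrib by (simp add: power2_eq_square)
    qed
    then have "(\<Sum>i\<in>I. (\<theta> i x)\<^sup>2) = (\<Sum>i\<in>I. \<eta> i x * \<eta> i x) / S x" by (simp only: sum_divide_distrib)
    also have "\<dots> = S x / S x" by (simp only: S_def)
    finally have "(\<Sum>i\<in>I. (\<theta> i x)\<^sup>2) = S x / S x" .
    then show "(\<Sum>i\<in>I. (\<theta> i x)\<^sup>2) = 1" using SX[OF x] by simp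
  next
    fix i x assume "r i \<le> dist i x" "0 \<le> r i"
    then show "\<theta> i x = 0" using \<eta>0 by (simp add: \<theta>_def)
  qed
qed

text \<open>On the positive axis this is convexity of powers; if one endpoint is 0 it reduces to
  \<open>t powr q \<le> t\<close> for \<open>0 < t < 1\<close>.\<close>

lemma powr_convex_nonneg:
  assumes "1 \<le> q" shows "convex_on {0..} (\<lambda>x::real. x powr q)"
proof (rule convex_onI)
  fix t x y :: real assume t: "0 < t" "t < 1" and xy: "x \<in> {0..}" "y \<in> {0..}"
  have le: "s powr q \<le> s" if "0 < s" "s < 1" for s :: real
    using that assms powr_mono'[of 1 q s] by simp
  consider "x = 0" | "y = 0" | "0 < x" "0 < y" using xy by force
  then show "((1 - t) *\<^sub>R x + t *\<^sub>R y) powr q \<le> (1 - t) * x powr q + t * y powr q"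
  proof cases
    case 1
    then show ?thesis using t xy le[of t] by (simp add: powr_mult mult_right_mono)
  next
    case 2
    then show ?thesis using t xy le[of "1 - t"] by (simp add: powr_mult mult_right_mono)
  next
    case 3
    then show ?thesis using convex_onD[OF powr_convex[OF assms], of t x y] t by simp
  qed
qed (simp add: convex_real_interval)

text \<open>Minkowski's inequality, by convexity with the weights \<open>b i / (\<Sum>j. b j)\<close>.\<close>

lemma minkowski_sum:
  fixes f :: "'i \<Rightarrow> 'a \<Rightarrow> real" and w :: "'a \<Rightarrow> real"
  assumes I: "finite I" "I \<noteq> {}" and q: "1 \<le> q" and w: "\<And>x. 0 \<le> w x"
    and f: "\<And>i x. i \<in> I \<Longrightarrow> 0 \<le> f i x" "\<And>i. i \<in> I \<Longrightarrow> integrable M (\<lambda>x. w x * f i x powr q)"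
    and b: "\<And>i. i \<in> I \<Longrightarrow> 0 < b i" "\<And>i. i \<in> I \<Longrightarrow> (LINT x|M. w x * f i x powr q) \<le> b i powr q"
    and int: "integrable M (\<lambda>x. w x * (\<Sum>i\<in>I. f i x) powr q)"
  shows "(LINT x|M. w x * (\<Sum>i\<in>I. f i x) powr q) \<le> (\<Sum>i\<in>I. b i) powr q"
proof -
  define B where "B = (\<Sum>i\<in>I. b i)"
  have B: "0 < B" unfolding B_def using I b(1) by (intro sum_pos) auto
  define l where "l i = b i / B" for i
  have l: "(\<Sum>i\<in>I. l i) = 1" "\<And>i. i \<in> I \<Longrightarrow> 0 < l i"
    using B b(1) by (auto simp: l_def B_def simp flip: sum_divide_distrib)
  have pt: "w x * (\<Sum>i\<in>I. f i x) powr q \<le> (\<Sum>i\<in>I. (l i / l i powr q) * (w x * f i x powr q))" for x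
  proof -
    have "(\<Sum>i\<in>I. f i x) = (\<Sum>i\<in>I. l i *\<^sub>R (f i x / l i))"
    proof (rule sum.cong)
      show "f i x = l i *\<^sub>R (f i x / l i)" if "i \<in> I" for i using l(2)[OF that] by simp
    qed simp
    also have "\<dots> powr q \<le> (\<Sum>i\<in>I. l i * (f i x / l i) powr q)"
      by (rule convex_on_sum[OF I powr_convex_nonneg[OF q] l(1)])
         (use l(2) f(1) in \<open>auto intro: less_imp_le divide_nonneg_pos\<close>)
    also have "\<dots> = (\<Sum>i\<in>I. (l i / l i powr q) * f i x powr q)"
      using l(2) f(1) by (intro sum.cong) (auto simp: powr_divide less_imp_le)
    finally have "w x * (\<Sum>i\<in>I. f i x) powr q \<le> w x * (\<Sum>i\<in>I. (l i / l i powr q) * f i x powr q)"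
      by (rule mult_left_mono[OF _ w])
    then show ?thesis by (simp add: sum_distrib_left mult_ac)
  qed
  have "(LINT x|M. w x * (\<Sum>i\<in>I. f i x) powr q) \<le> (LINT x|M. (\<Sum>i\<in>I. (l i / l i powr q) * (w x * f i x powr q)))"
    using pt int f(2) by (intro integral_mono) auto
  also have "\<dots> = (\<Sum>i\<in>I. (l i / l i powr q) * (LINT x|M. w x * f i x powr q))"
    using f(2) by simp
  also have "\<dots> \<le> (\<Sum>i\<in>I. (l i / l i powr q) * b i powr q)"
  proof (intro sum_mono mult_left_mono b(2))
    show "0 \<le> l i / l i powr q" if "i \<in> I" for i using l(2)[OF that] by simp
  qed
  also have "\<dots> = (\<Sum>i\<in>I. l i * B powr q)"
  proof (rule sum.cong)
    fix i assume i: "i \<in> I"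
    have "b i powr q = l i powr q * B powr q" using B b(1)[OF i] by (simp add: l_def powr_divide)
    then show "(l i / l i powr q) * b i powr q = l i * B powr q" using l(2)[OF i] by simp
  qed simp
  also have "\<dots> = B powr q" by (simp add: l(1) flip: sum_distrib_right)
  finally show ?thesis by (simp add: B_def)
qed

text \<open>Young's inequality with a parameter: the factor on \<open>a\<close> stays near 1 at the
  price of a large factor on \<open>b\<close>.\<close>

lemma norm_add_square_le:
  fixes a b :: "'a::real_inner"
  assumes "0 < (\<eta>::real)"
  shows "(norm (a + b))\<^sup>2 \<le> (1 + \<eta>) * (norm a)\<^sup>2 + (1 + 1 / \<eta>) * (norm b)\<^sup>2"
proof -
  have "0 \<le> (\<eta> *\<^sub>R a - b) \<bullet> (\<eta> *\<^sub>R a - b)" by simp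
  also have "\<dots> = \<eta> * (\<eta> * (a \<bullet> a)) - \<eta> * (2 * (a \<bullet> b)) + b \<bullet> b"
    by (simp add: inner_diff_left inner_diff_right inner_commute[of b a] algebra_simps)
  finally have "\<eta> * (2 * (a \<bullet> b)) \<le> \<eta> * (\<eta> * (a \<bullet> a) + (b \<bullet> b) / \<eta>)"
    using assms by (simp add: distrib_left)
  then have "2 * (a \<bullet> b) \<le> \<eta> * (a \<bullet> a) + (b \<bullet> b) / \<eta>"
    using assms by (simp only: mult_le_cancel_left_pos)
  then show ?thesis
    by (simp add: power2_norm_eq_inner inner_add_left inner_add_right inner_commute[of b a] algebra_simps)
qed

text \<open>\<open>weighted_power w (2 * q) u powr (1 / q)\<close> is the weighted
  \<open>L^q\<close> norm of \<open>u^2\<close>, and \<open>u^2\<close> is the sum of the squares of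
  the pieces \<open>u * \<theta> i\<close>. The triangle inequality for this norm loses no factor,
  so the local constant survives up to \<open>1 + \<eta>\<close>; the derivatives of the cutoffs
  enter only through the \<open>L^2\<close> term.\<close>

lemma global_inequality:
  fixes U :: "'a::euclidean_space set"
  assumes U: "open U" "bounded U" "U \<noteq> {}" and w: "continuous_on U w" "\<And>x. 0 \<le> w x"
    and q: "1 \<le> q" and A: "0 \<le> A" and \<eta>: "0 < \<eta>"
    and loc: "\<And>x0. x0 \<in> closure U \<Longrightarrow> \<exists>r>0. \<forall>u\<in>C1c (U \<inter> ball x0 r). weighted_power w (2 * q) u powr (1 / q) \<le> A * energy u"
  obtains C where "0 \<le> C"
    "\<And>u. u \<in> C1c U \<Longrightarrow> weighted_power w (2 * q) u powr (1 / q) \<le> (1 + \<eta>) * A * energy u + C * sqnorm u"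
proof -
  have cU: "compact (closure U)" using U(2) by (simp add: compact_closure)
  obtain r where r: "\<And>x. x \<in> closure U \<Longrightarrow> 0 < r x"
    and rloc: "\<And>x u. x \<in> closure U \<Longrightarrow> u \<in> C1c (U \<inter> ball x (r x)) \<Longrightarrow> weighted_power w (2 * q) u powr (1 / q) \<le> A * energy u"
    using loc by metis
  \<comment> \<open>Half the radius leaves room for a closed ball inside the open one, so that the
    localized pieces have compact support in \<open>ball i (r i)\<close>.\<close>
  have "0 < r x / 2" if "x \<in> closure U" for x using r[OF that] by simp
  note part = partition_of_unity[of "closure U" "\<lambda>x. r x / 2", OF cU this]
  obtain I and \<theta> :: "'a \<Rightarrow> 'a \<Rightarrow> real" where
    I: "finite I" "I \<subseteq> closure U" and \<theta>: "\<And>i. Ck 1 (\<theta> i)"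
    and \<theta>1: "\<And>x. x \<in> closure U \<Longrightarrow> (\<Sum>i\<in>I. (\<theta> i x)\<^sup>2) = 1"
    and \<theta>0: "\<And>i x. r i / 2 \<le> dist i x \<Longrightarrow> 0 \<le> r i / 2 \<Longrightarrow> \<theta> i x = 0" using part by blast
  have Ine: "I \<noteq> {}"
  proof
    assume "I = {}"
    moreover obtain x where "x \<in> closure U" using U(3) closure_subset by blast
    ultimately show False using \<theta>1[of x] by simp
  qed
  have "\<exists>M. \<forall>i\<in>I. \<forall>x\<in>closure U. norm (gradient (\<theta> i) x) \<le> M"
  proof -
    have "\<forall>i\<in>I. \<exists>M. \<forall>x\<in>closure U. norm (gradient (\<theta> i) x) \<le> M"
    proof
      fix i
      have "compact (gradient (\<theta> i) ` closure U)"
        by (rule compact_continuous_image[OF continuous_on_subset[OF Ck_1_continuous_gradient[OF \<theta>]] cU]) simp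
      then have "bounded (gradient (\<theta> i) ` closure U)" by (rule compact_imp_bounded)
      then show "\<exists>M. \<forall>x\<in>closure U. norm (gradient (\<theta> i) x) \<le> M" unfolding bounded_iff by blast
    qed
    then obtain M where M: "\<And>i x. i \<in> I \<Longrightarrow> x \<in> closure U \<Longrightarrow> norm (gradient (\<theta> i) x) \<le> M i" by metis
    have "norm (gradient (\<theta> i) x) \<le> Max (M ` I)" if "i \<in> I" "x \<in> closure U" for i x
      using M[OF that] I(1) that(1) by (meson Max_ge finite_imageI imageI order_trans)
    then show ?thesis by blast
  qed
  then obtain M where M: "\<And>i x. i \<in> I \<Longrightarrow> x \<in> closure U \<Longrightarrow> norm (gradient (\<theta> i) x) \<le> M" by blast
  define C where "C = A * ((1 + 1 / \<eta>) * (real (card I) * M\<^sup>2))"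
  show ?thesis
  proof (rule that[of C])
    show "0 \<le> C" unfolding C_def using A \<eta> by (intro mult_nonneg_nonneg) auto
    fix u assume u: "u \<in> C1c U"
    obtain K where K: "compact K" "K \<subseteq> U" "\<forall>x. x \<notin> K \<longrightarrow> u x = 0" "\<forall>x. x \<notin> K \<longrightarrow> gradient u x = 0" "Ck 1 u"
      using u by (rule C1cE)
    define f where "f i x = u x * \<theta> i x" for i x
    have fU: "f i \<in> C1c U" for i unfolding f_def[abs_def] by (rule C1c_mult[OF u \<theta>])
    have floc: "weighted_power w (2 * q) (f i) powr (1 / q) \<le> A * energy (f i)" if i: "i \<in> I" for i
    proof (rule rloc)
      show ii: "i \<in> closure U" using i I(2) by blast
      show "f i \<in> C1c (U \<inter> ball i (r i))"
        unfolding C1c_def mem_Collect_eq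
      proof (intro conjI exI)
        show "Ck 1 (f i)" using fU C1cE by blast
        show "compact (K \<inter> cball i (r i / 2))" using K(1) by (simp add: compact_Int_closed)
        show "K \<inter> cball i (r i / 2) \<subseteq> U \<inter> ball i (r i)" using K(2) r[OF ii] by auto
        show "\<forall>x. x \<notin> K \<inter> cball i (r i / 2) \<longrightarrow> f i x = 0"
        proof (intro allI impI)
          fix x assume "x \<notin> K \<inter> cball i (r i / 2)"
          then have "x \<notin> K \<or> r i / 2 \<le> dist i x" by auto
          then show "f i x = 0" using K(3) \<theta>0[of i x] r[OF ii] by (auto simp: f_def)
        qed
      qed
    qed
    have Esum: "(\<Sum>i\<in>I. energy (f i)) \<le> (1 + \<eta>) * energy u + (1 + 1 / \<eta>) * (real (card I) * M\<^sup>2) * sqnorm u"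
    proof -
      have pt: "(\<Sum>i\<in>I. (norm (gradient (f i) x))\<^sup>2) \<le> (1 + \<eta>) * (norm (gradient u x))\<^sup>2 + (1 + 1 / \<eta>) * (real (card I) * M\<^sup>2) * (u x)\<^sup>2" for x
      proof (cases "x \<in> K")
        case True
        then have x: "x \<in> closure U" using K(2) closure_subset by blast
        have "(norm (gradient (f i) x))\<^sup>2 \<le> (1 + \<eta>) * (norm (gradient u x))\<^sup>2 * (\<theta> i x)\<^sup>2 + (1 + 1 / \<eta>) * M\<^sup>2 * (u x)\<^sup>2" if i: "i \<in> I" for i
        proof -
          have "gradient (f i) x = \<theta> i x *\<^sub>R gradient u x + u x *\<^sub>R gradient (\<theta> i) x"
            unfolding f_def[abs_def] gradient_mult[OF Ck_1_differentiable[OF K(5)] Ck_1_differentiable[OF \<theta>]] by simp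
          then have "(norm (gradient (f i) x))\<^sup>2 \<le> (1 + \<eta>) * (norm (\<theta> i x *\<^sub>R gradient u x))\<^sup>2 + (1 + 1 / \<eta>) * (norm (u x *\<^sub>R gradient (\<theta> i) x))\<^sup>2"
            using norm_add_square_le[OF \<eta>] by (simp only:)
          moreover have "(1 + 1 / \<eta>) * (norm (u x *\<^sub>R gradient (\<theta> i) x))\<^sup>2 \<le> (1 + 1 / \<eta>) * (M\<^sup>2 * (u x)\<^sup>2)"
          proof (rule mult_left_mono)
            have "(norm (gradient (\<theta> i) x))\<^sup>2 \<le> M\<^sup>2" using M[OF i x] by (intro power_mono) auto
            then have "(u x)\<^sup>2 * (norm (gradient (\<theta> i) x))\<^sup>2 \<le> (u x)\<^sup>2 * M\<^sup>2" by (rule mult_left_mono) simp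
            then show "(norm (u x *\<^sub>R gradient (\<theta> i) x))\<^sup>2 \<le> M\<^sup>2 * (u x)\<^sup>2"
              by (simp add: power_mult_distrib mult.commute)
          qed (use \<eta> in simp)
          ultimately show ?thesis by (simp add: power_mult_distrib mult_ac)
        qed
        then have "(\<Sum>i\<in>I. (norm (gradient (f i) x))\<^sup>2) \<le> (\<Sum>i\<in>I. (1 + \<eta>) * (norm (gradient u x))\<^sup>2 * (\<theta> i x)\<^sup>2 + (1 + 1 / \<eta>) * M\<^sup>2 * (u x)\<^sup>2)"
          by (rule sum_mono)
        also have "\<dots> = (1 + \<eta>) * (norm (gradient u x))\<^sup>2 * (\<Sum>i\<in>I. (\<theta> i x)\<^sup>2) + (1 + 1 / \<eta>) * (real (card I) * M\<^sup>2) * (u x)\<^sup>2"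
          by (simp add: sum.distrib sum_distrib_left mult_ac)
        finally show ?thesis by (simp add: \<theta>1[OF x])
      next
        case False
        have "gradient (f i) x = 0" for i
          by (rule C1c_gradient_zero[OF compact_imp_closed[OF K(1)] _ False]) (use K(3) in \<open>simp add: f_def\<close>)
        then show ?thesis using \<eta> by simp
      qed
      have "(\<Sum>i\<in>I. energy (f i)) = (LINT x|lborel. (\<Sum>i\<in>I. (norm (gradient (f i) x))\<^sup>2))"
        unfolding energy_def using C1c_integrable(4)[OF fU] by simp
      also have "\<dots> \<le> (LINT x|lborel. (1 + \<eta>) * (norm (gradient u x))\<^sup>2 + (1 + 1 / \<eta>) * (real (card I) * M\<^sup>2) * (u x)\<^sup>2)"
        using C1c_integrable[OF u] C1c_integrable(4)[OF fU] pt by (intro integral_mono) auto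
      also have "\<dots> = (1 + \<eta>) * energy u + (1 + 1 / \<eta>) * (real (card I) * M\<^sup>2) * sqnorm u"
        unfolding energy_def sqnorm_def using C1c_integrable[OF u] by simp
      finally show ?thesis .
    qed
    have sq: "((z::real)\<^sup>2) powr q = \<bar>z\<bar> powr (2 * q)" for z
    proof (cases "z = 0")
      case False
      then have "z\<^sup>2 = \<bar>z\<bar> powr 2" by (simp add: powr_numeral)
      then show ?thesis by (simp only: powr_powr)
    qed simp
    \<comment> \<open>The weights in \<open>minkowski_sum\<close> are proportional to the bounds,
      which therefore must be positive; \<epsilon> takes care of pieces with zero energy.\<close>
    have le: "weighted_power w (2 * q) u powr (1 / q) \<le> (\<Sum>i\<in>I. A * energy (f i) + \<epsilon>)" if \<epsilon>: "0 < \<epsilon>" for \<epsilon>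
    proof -
      have uu: "(\<Sum>i\<in>I. (f i x)\<^sup>2) = (u x)\<^sup>2" for x
      proof (cases "x \<in> K")
        case True
        then have x: "x \<in> closure U" using K(2) closure_subset by blast
        have "(\<Sum>i\<in>I. (f i x)\<^sup>2) = (u x)\<^sup>2 * (\<Sum>i\<in>I. (\<theta> i x)\<^sup>2)"
          by (simp add: f_def power_mult_distrib sum_distrib_left)
        then show ?thesis by (simp add: \<theta>1[OF x])
      next
        case False
        then have "u x = 0" using K(3) by blast
        then show ?thesis by (simp add: f_def)
      qed
      have p2: "0 < 2 * q" using q by simp
      have "(LINT x|lborel. w x * (\<Sum>i\<in>I. (f i x)\<^sup>2) powr q) \<le> (\<Sum>i\<in>I. A * energy (f i) + \<epsilon>) powr q"
      proof (rule minkowski_sum[OF I(1) Ine q w(2)])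
        show "integrable lborel (\<lambda>x. w x * ((f i x)\<^sup>2) powr q)" for i
          unfolding sq by (rule C1c_integrable_weighted[OF fU w(1) p2])
        show "integrable lborel (\<lambda>x. w x * (\<Sum>i\<in>I. (f i x)\<^sup>2) powr q)"
          unfolding uu sq by (rule C1c_integrable_weighted[OF u w(1) p2])
        fix i assume i: "i \<in> I"
        show pos: "0 < A * energy (f i) + \<epsilon>" using A energy_nonneg[of "f i"] \<epsilon> by (simp add: add_nonneg_pos)
        have W: "0 \<le> weighted_power w (2 * q) (f i)" by (rule weighted_power_nonneg[OF w(2)])
        have "weighted_power w (2 * q) (f i) = (weighted_power w (2 * q) (f i) powr (1 / q)) powr q"
          using q W by (simp add: powr_powr)
        also have "\<dots> \<le> (A * energy (f i) + \<epsilon>) powr q"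
          using floc[OF i] \<epsilon> q by (intro powr_mono2) auto
        finally show "(LINT x|lborel. w x * ((f i x)\<^sup>2) powr q) \<le> (A * energy (f i) + \<epsilon>) powr q"
          unfolding sq weighted_power_def .
      qed simp
      then have "weighted_power w (2 * q) u \<le> (\<Sum>i\<in>I. A * energy (f i) + \<epsilon>) powr q"
        unfolding uu sq weighted_power_def .
      then have "weighted_power w (2 * q) u powr (1 / q) \<le> ((\<Sum>i\<in>I. A * energy (f i) + \<epsilon>) powr q) powr (1 / q)"
        using q weighted_power_nonneg[OF w(2)] by (intro powr_mono2) auto
      also have "\<dots> = (\<Sum>i\<in>I. A * energy (f i) + \<epsilon>)"
      proof -
        have "0 \<le> (\<Sum>i\<in>I. A * energy (f i) + \<epsilon>)" using A \<epsilon> energy_nonneg by (intro sum_nonneg add_nonneg_nonneg mult_nonneg_nonneg) auto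
        then show ?thesis using q by (simp add: powr_powr)
      qed
      finally show ?thesis .
    qed
    have "weighted_power w (2 * q) u powr (1 / q) \<le> A * (\<Sum>i\<in>I. energy (f i))"
    proof (rule field_le_epsilon)
      fix \<epsilon> :: real assume "0 < \<epsilon>"
      moreover have cI: "0 < real (card I)" using I(1) Ine by (simp add: card_gt_0_iff)
      ultimately have "weighted_power w (2 * q) u powr (1 / q) \<le> (\<Sum>i\<in>I. A * energy (f i) + \<epsilon> / real (card I))"
        by (intro le) simp
      also have "\<dots> = A * (\<Sum>i\<in>I. energy (f i)) + \<epsilon>"
        using cI by (simp add: sum.distrib sum_distrib_left)
      finally show "weighted_power w (2 * q) u powr (1 / q) \<le> A * (\<Sum>i\<in>I. energy (f i)) + \<epsilon>" .
    qed
    also have "\<dots> \<le> A * ((1 + \<eta>) * energy u + (1 + 1 / \<eta>) * (real (card I) * M\<^sup>2) * sqnorm u)"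
      by (rule mult_left_mono[OF Esum A])
    also have "\<dots> = (1 + \<eta>) * A * energy u + C * sqnorm u"
      by (simp add: C_def distrib_left mult_ac)
    finally show "weighted_power w (2 * q) u powr (1 / q) \<le> (1 + \<eta>) * A * energy u + C * sqnorm u" .
  qed
qed

section \<open>Compactness in \<open>L^2\<close>\<close>

text \<open>Integrability of the limit belongs to the conclusion: the Bochner integral of a
  non-integrable function is 0, so the bound alone would say nothing.\<close>

lemma fatou_real:
  fixes f :: "nat \<Rightarrow> 'a \<Rightarrow> real"
  assumes f: "\<And>n. integrable M (f n)" "\<And>n x. 0 \<le> f n x" and g[measurable]: "g \<in> borel_measurable M"
    and lim: "AE x in M. (\<lambda>n. f n x) \<longlonglongrightarrow> g x" and B: "\<forall>\<^sub>F n in sequentially. integral\<^sup>L M (f n) \<le> B"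
  shows "integrable M g" and "integral\<^sup>L M g \<le> B"
proof -
  have fm[measurable]: "f n \<in> borel_measurable M" for n using f(1) by (rule borel_measurable_integrable)
  have g0: "AE x in M. 0 \<le> g x"
    using lim by eventually_elim (use f(2) in \<open>auto intro: LIMSEQ_le_const\<close>)
  have B0: "0 \<le> B"
  proof -
    obtain n where "integral\<^sup>L M (f n) \<le> B" using B by (auto simp: eventually_sequentially)
    moreover have "0 \<le> integral\<^sup>L M (f n)" using f(2) by simp
    ultimately show ?thesis by simp
  qed
  have "(\<integral>\<^sup>+x. ennreal (g x) \<partial>M) = (\<integral>\<^sup>+x. liminf (\<lambda>n. ennreal (f n x)) \<partial>M)"
  proof (rule nn_integral_cong_AE)
    show "AE x in M. ennreal (g x) = liminf (\<lambda>n. ennreal (f n x))"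
      using lim
    proof eventually_elim
      case (elim x)
      have "(\<lambda>n. ennreal (f n x)) \<longlonglongrightarrow> ennreal (g x)" using elim by (rule tendsto_ennrealI)
      then show ?case by (simp add: lim_imp_Liminf)
    qed
  qed
  also have "\<dots> \<le> liminf (\<lambda>n. \<integral>\<^sup>+x. ennreal (f n x) \<partial>M)"
    by (rule nn_integral_liminf) measurable
  also have "\<dots> \<le> ennreal B"
  proof -
    have "\<forall>\<^sub>F n in sequentially. (\<integral>\<^sup>+x. ennreal (f n x) \<partial>M) \<le> ennreal B"
      using B
    proof eventually_elim
      case (elim n)
      have "(\<integral>\<^sup>+x. ennreal (f n x) \<partial>M) = ennreal (integral\<^sup>L M (f n))"
        using f by (intro nn_integral_eq_integral) auto
      then show ?case using elim by (simp add: ennreal_leI)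
    qed
    then have "liminf (\<lambda>n. \<integral>\<^sup>+x. ennreal (f n x) \<partial>M) \<le> liminf (\<lambda>n. ennreal B)"
      by (rule Liminf_mono)
    then show ?thesis by (simp add: Liminf_const)
  qed
  finally have le: "(\<integral>\<^sup>+x. ennreal (g x) \<partial>M) \<le> ennreal B" .
  show i: "integrable M g"
  proof (rule integrableI_nonneg[OF g g0])
    show "(\<integral>\<^sup>+x. ennreal (g x) \<partial>M) < \<infinity>" using le by (simp add: le_less_trans)
  qed
  have "ennreal (integral\<^sup>L M g) \<le> ennreal B"
    using le nn_integral_eq_integral[OF i g0] by simp
  then show "integral\<^sup>L M g \<le> B" using B0 by (simp add: ennreal_le_iff)
qed

text \<open>Integrated over a set of finite measure, this turns smallness in \<open>L^2\<close> into
  smallness in \<open>L^1\<close>; \<epsilon> is chosen first to make its own contribution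
  small.\<close>

lemma abs_le_square:
  fixes t :: real assumes "0 < \<epsilon>" shows "\<bar>t\<bar> \<le> \<epsilon> + t\<^sup>2 / \<epsilon>"
proof (cases "\<bar>t\<bar> \<le> \<epsilon>")
  case True
  then show ?thesis using assms by (simp add: add_increasing2)
next
  case False
  then have "\<bar>t\<bar> * \<epsilon> \<le> \<bar>t\<bar> * \<bar>t\<bar>" by (intro mult_left_mono) auto
  then have "\<bar>t\<bar> \<le> t\<^sup>2 / \<epsilon>" using assms by (simp add: pos_le_divide_eq power2_eq_square)
  then show ?thesis using assms by simp
qed

lemma norm_diff_square_le:
  fixes a b :: "'a::real_inner"
  shows "(norm (a - b))\<^sup>2 \<le> 2 * (norm a)\<^sup>2 + 2 * (norm b)\<^sup>2"
proof -
  have "0 \<le> (a + b) \<bullet> (a + b)" by simp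
  then show ?thesis
    by (simp add: power2_norm_eq_inner inner_diff_left inner_diff_right inner_add_left inner_add_right inner_commute[of b a])
qed

lemma integrable_norm_diff_square:
  fixes f g :: "'a \<Rightarrow> 'b::euclidean_space"
  assumes [measurable]: "f \<in> borel_measurable M" "g \<in> borel_measurable M"
    and "integrable M (\<lambda>x. (norm (f x))\<^sup>2)" "integrable M (\<lambda>x. (norm (g x))\<^sup>2)"
  shows "integrable M (\<lambda>x. (norm (f x - g x))\<^sup>2)"
proof (rule Bochner_Integration.integrable_bound)
  show "integrable M (\<lambda>x. 2 * (norm (f x))\<^sup>2 + 2 * (norm (g x))\<^sup>2)" using assms by simp
  show "AE x in M. norm ((norm (f x - g x))\<^sup>2) \<le> norm (2 * (norm (f x))\<^sup>2 + 2 * (norm (g x))\<^sup>2)"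
    unfolding real_norm_def abs_of_nonneg[OF zero_le_power2]
    by (intro AE_I2 order_trans[OF norm_diff_square_le abs_ge_self])
qed measurable

text \<open>On a bounded set an \<open>L^2\<close> Cauchy sequence is Cauchy in \<open>L^1\<close>,
  which yields a subsequence converging almost everywhere. Fatou along that subsequence bounds the
  distance of each late term from the limit, so the whole sequence converges in
  \<open>L^2\<close>.\<close>

lemma L2_cauchy_limit:
  fixes s :: "nat \<Rightarrow> 'a::euclidean_space \<Rightarrow> 'b::euclidean_space"
  assumes U: "bounded U" and s: "\<And>n. s n \<in> borel_measurable borel" "\<And>n. integrable lborel (\<lambda>x. (norm (s n x))\<^sup>2)"
    "\<And>n x. x \<notin> U \<Longrightarrow> s n x = 0"
    and cauchy: "\<And>e. 0 < e \<Longrightarrow> \<exists>N. \<forall>i\<ge>N. \<forall>j\<ge>N. (LINT x|lborel. (norm (s i x - s j x))\<^sup>2) < e"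
  shows "\<exists>r u. strict_mono (r :: nat \<Rightarrow> nat) \<and> u \<in> borel_measurable borel \<and> (\<forall>x. x \<notin> U \<longrightarrow> u x = 0) \<and>
    (AE x in lborel. (\<lambda>i. s (r i) x) \<longlonglongrightarrow> u x) \<and> integrable lborel (\<lambda>x. (norm (u x))\<^sup>2) \<and>
    (\<lambda>n. LINT x|lborel. (norm (s n x - u x))\<^sup>2) \<longlonglongrightarrow> 0"
proof -
  note [measurable] = s(1)
  obtain R where R: "R > 0" "U \<subseteq> cball 0 R"
    using bounded_subset_ballD[OF U, of 0] ball_subset_cball by blast
  define V where "V = measure lborel (cball (0::'a) R)"
  have iV: "integrable lborel (\<lambda>x. indicator (cball (0::'a) R) x *\<^sub>R c)" for c :: real
    by (intro borel_integrable_compact) auto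
  have IV: "(LINT x|lborel. indicator (cball (0::'a) R) x *\<^sub>R c) = V * c" for c :: real
    by (simp add: V_def)
  have V0: "0 \<le> V" by (simp add: V_def)
  have i2: "integrable lborel (\<lambda>x. (norm (s i x - s j x))\<^sup>2)" for i j
    by (rule integrable_norm_diff_square) (use s in auto)
  have bnd: "norm y \<le> indicator (cball 0 R) x *\<^sub>R \<epsilon> + (norm y)\<^sup>2 / \<epsilon>" if "0 < \<epsilon>" "x \<notin> U \<Longrightarrow> y = 0" for x y \<epsilon>
  proof (cases "x \<in> U")
    case True
    then have "x \<in> cball 0 R" using R by blast
    then show ?thesis using abs_le_square[OF that(1), of "norm y"] by simp
  next
    case False
    then show ?thesis using that by simp
  qed
  have i1: "integrable lborel (s n)" for n
  proof (rule Bochner_Integration.integrable_bound)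
    show "integrable lborel (\<lambda>x. indicator (cball (0::'a) R) x *\<^sub>R 1 + (norm (s n x))\<^sup>2 / 1)"
      using iV[of 1] s(2)[of n] by simp
    show "AE x in lborel. norm (s n x) \<le> norm (indicator (cball (0::'a) R) x *\<^sub>R 1 + (norm (s n x))\<^sup>2 / 1)"
    proof (rule AE_I2)
      fix x
      have "norm (s n x) \<le> indicator (cball 0 R) x *\<^sub>R 1 + (norm (s n x))\<^sup>2 / 1"
        by (rule bnd) (simp_all add: s(3))
      then show "norm (s n x) \<le> norm (indicator (cball (0::'a) R) x *\<^sub>R 1 + (norm (s n x))\<^sup>2 / 1)"
        unfolding real_norm_def by (rule order_trans[OF _ abs_ge_self])
    qed
  qed measurable
  have "\<exists>N. \<forall>i\<ge>N. \<forall>j\<ge>N. (LINT x|lborel. norm (s i x - s j x)) < e" if e: "0 < e" for e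
  proof -
    define \<epsilon> where "\<epsilon> = e / (2 * (V + 1))"
    have \<epsilon>: "0 < \<epsilon>" using e V0 by (simp add: \<epsilon>_def)
    have V\<epsilon>: "V * \<epsilon> < e / 2 + \<epsilon> * 0" using e V0 by (simp add: \<epsilon>_def field_simps)
    obtain N where N: "\<forall>i\<ge>N. \<forall>j\<ge>N. (LINT x|lborel. (norm (s i x - s j x))\<^sup>2) < \<epsilon> * (e / 2)"
      using cauchy[of "\<epsilon> * (e / 2)"] e \<epsilon> by auto
    have "(LINT x|lborel. norm (s i x - s j x)) < e" if ij: "i \<ge> N" "j \<ge> N" for i j
    proof -
      have "(LINT x|lborel. norm (s i x - s j x)) \<le> (LINT x|lborel. indicator (cball 0 R) x *\<^sub>R \<epsilon> + (norm (s i x - s j x))\<^sup>2 / \<epsilon>)"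
      proof (rule integral_mono)
        show "integrable lborel (\<lambda>x. norm (s i x - s j x))" using i1 by simp
        show "integrable lborel (\<lambda>x. indicator (cball 0 R) x *\<^sub>R \<epsilon> + (norm (s i x - s j x))\<^sup>2 / \<epsilon>)"
          by (rule Bochner_Integration.integrable_add[OF iV]) (use i2 in simp)
        show "norm (s i x - s j x) \<le> indicator (cball 0 R) x *\<^sub>R \<epsilon> + (norm (s i x - s j x))\<^sup>2 / \<epsilon>" for x
          by (rule bnd[OF \<epsilon>]) (simp add: s(3))
      qed
      also have "\<dots> = V * \<epsilon> + (LINT x|lborel. (norm (s i x - s j x))\<^sup>2) / \<epsilon>"
        using iV[of \<epsilon>] i2 IV by (subst Bochner_Integration.integral_add) auto
      also have "\<dots> < e / 2 + e / 2"
      proof (rule add_strict_mono)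
        show "V * \<epsilon> < e / 2" using V\<epsilon> by simp
        show "(LINT x|lborel. (norm (s i x - s j x))\<^sup>2) / \<epsilon> < e / 2"
          using N ij \<epsilon> by (simp add: pos_divide_less_eq mult.commute)
      qed
      finally show ?thesis by simp
    qed
    then show ?thesis by blast
  qed
  from cauchy_L1_AE_cauchy_subseq[OF i1 this]
  obtain r where r: "strict_mono r" "AE x in lborel. Cauchy (\<lambda>i. s (r i) x)" by blast
  \<comment> \<open>The pointwise \<open>lim\<close> is measurable whatever value it takes on the
    null set of divergence, and off \<open>U\<close> it is the limit of zeros.\<close>
  define u where "u x = lim (\<lambda>i. s (r i) x)" for x
  have um[measurable]: "u \<in> borel_measurable borel"
    unfolding u_def[abs_def] by (rule borel_measurable_lim_metric) (rule s(1))
  have uz: "\<forall>x. x \<notin> U \<longrightarrow> u x = 0" using s(3) by (simp add: u_def)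
  have lim: "AE x in lborel. (\<lambda>i. s (r i) x) \<longlonglongrightarrow> u x"
    using r(2) by eventually_elim (simp add: u_def Cauchy_convergent convergent_LIMSEQ_iff[symmetric])
  have key: "\<exists>N. \<forall>n\<ge>N. integrable lborel (\<lambda>x. (norm (s n x - u x))\<^sup>2) \<and> (LINT x|lborel. (norm (s n x - u x))\<^sup>2) \<le> e"
    if e: "0 < e" for e
  proof -
    obtain N where N: "\<forall>i\<ge>N. \<forall>j\<ge>N. (LINT x|lborel. (norm (s i x - s j x))\<^sup>2) < e" using cauchy[OF e] by blast
    have "integrable lborel (\<lambda>x. (norm (s n x - u x))\<^sup>2) \<and> (LINT x|lborel. (norm (s n x - u x))\<^sup>2) \<le> e" if n: "n \<ge> N" for n
    proof -
      have lm: "AE x in lborel. (\<lambda>i. (norm (s n x - s (r i) x))\<^sup>2) \<longlonglongrightarrow> (norm (s n x - u x))\<^sup>2"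
        using lim by eventually_elim (intro tendsto_intros)
      have "(LINT x|lborel. (norm (s n x - s (r i) x))\<^sup>2) \<le> e" if "i \<ge> N" for i
        using N n that seq_suble[OF r(1), of i] by (meson less_imp_le order_trans)
      then have ev: "\<forall>\<^sub>F i in sequentially. (LINT x|lborel. (norm (s n x - s (r i) x))\<^sup>2) \<le> e"
        by (auto simp: eventually_sequentially)
      have m: "(\<lambda>x. (norm (s n x - u x))\<^sup>2) \<in> borel_measurable lborel" by measurable
      note F = fatou_real[where f="\<lambda>i x. (norm (s n x - s (r i) x))\<^sup>2", OF i2 _ m lm ev]
      show ?thesis using F by simp
    qed
    then show ?thesis by blast
  qed
  obtain N where N: "integrable lborel (\<lambda>x. (norm (s N x - u x))\<^sup>2)" using key[of 1] by force
  have "integrable lborel (\<lambda>x. (norm (s N x - (s N x - u x)))\<^sup>2)"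
    by (rule integrable_norm_diff_square) (use N s in auto)
  then have iu: "integrable lborel (\<lambda>x. (norm (u x))\<^sup>2)" by simp
  have "(\<lambda>n. LINT x|lborel. (norm (s n x - u x))\<^sup>2) \<longlonglongrightarrow> 0"
  proof (rule LIMSEQ_I)
    fix e :: real assume e: "0 < e"
    obtain N where N: "\<forall>n\<ge>N. (LINT x|lborel. (norm (s n x - u x))\<^sup>2) \<le> e / 2" using key[of "e/2"] e by auto
    have "norm ((LINT x|lborel. (norm (s n x - u x))\<^sup>2) - 0) < e" if "n \<ge> N" for n
    proof -
      have "0 \<le> (LINT x|lborel. (norm (s n x - u x))\<^sup>2)" by simp
      moreover have "(LINT x|lborel. (norm (s n x - u x))\<^sup>2) \<le> e / 2" using N that by blast
      ultimately show ?thesis using e by simp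
    qed
    then show "\<exists>no. \<forall>n\<ge>no. norm ((LINT x|lborel. (norm (s n x - u x))\<^sup>2) - 0) < e" by blast
  qed
  then show ?thesis using r(1) um uz lim iu by blast
qed

lemma C1c_lincomb:
  assumes "f \<in> C1c U" "g \<in> C1c U"
  shows "(\<lambda>x. a * f x + b * g x) \<in> C1c U"
proof -
  obtain K where K: "compact K" "K \<subseteq> U" "\<forall>x. x \<notin> K \<longrightarrow> f x = 0" "Ck 1 f" using assms(1) by (rule C1cE)
  obtain L where L: "compact L" "L \<subseteq> U" "\<forall>x. x \<notin> L \<longrightarrow> g x = 0" "Ck 1 g" using assms(2) by (rule C1cE)
  have "Ck 1 (\<lambda>x. a * f x + b * g x)" by (rule Ck_add[OF Ck_cmult[OF K(4)] Ck_cmult[OF L(4)]])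
  moreover have "compact (K \<union> L)" "K \<union> L \<subseteq> U" using K L by auto
  moreover have "\<forall>x. x \<notin> K \<union> L \<longrightarrow> a * f x + b * g x = 0" using K(3) L(3) by simp
  ultimately show ?thesis unfolding C1c_def mem_Collect_eq by blast
qed

lemma C1c_diff: "f \<in> C1c U \<Longrightarrow> g \<in> C1c U \<Longrightarrow> (\<lambda>x. f x - g x) \<in> C1c U"
  using C1c_lincomb[of f U g 1 "-1"] by simp

lemma gradient_diff:
  assumes "f \<in> C1c U" "g \<in> C1c V"
  shows "gradient (\<lambda>x. f x - g x) x = gradient f x - gradient g x"
proof -
  have d: "f differentiable at x" "g differentiable at x"
    using assms by (auto elim!: C1cE intro: Ck_1_differentiable)
  have "(\<lambda>x. - 1 * g x) differentiable at x" using d(2) by (intro differentiable_mult) auto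
  from gradient_add[OF d(1) this] gradient_cmult[OF d(2), of "-1"] show ?thesis by simp
qed

section \<open>The \<open>L^2\<close> error of mollification\<close>

context
  fixes f \<psi> :: "'a::euclidean_space \<Rightarrow> real" and U and d :: real
  assumes f: "f \<in> C1c U"
    and \<psi>: "\<And>k. Ck k \<psi>" "\<And>x. 0 \<le> \<psi> x" "\<And>x. \<psi> (- x) = \<psi> x" "\<And>x. d \<le> norm x \<Longrightarrow> \<psi> x = 0" "(LINT x|lborel. \<psi> x) = 1"
    and d: "0 < d"
begin

lemma mollifier_continuous: "continuous_on UNIV \<psi>" using \<psi>(1)[of 0] by simp

lemma mollifier_translate_integrable: "integrable lborel (\<lambda>y. \<psi> (x - y))" "(LINT y|lborel. \<psi> (x - y)) = 1"
proof -
  have cs: "continuous_on UNIV (\<lambda>y. \<psi> (x - y))"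
    by (rule continuous_on_compose2[OF mollifier_continuous]) (auto intro!: continuous_intros)
  have z: "\<psi> (x - y) = 0" if "y \<notin> cball x d" for y
    using that by (intro \<psi>(4)) (simp add: dist_norm)
  show "integrable lborel (\<lambda>y. \<psi> (x - y))"
    by (rule integrable_compact_support[OF cs compact_cball[of x d]]) (use z in blast)
  have "(LINT y|lborel. \<psi> (y + (- x))) = 1"
    using integral_translate[of \<psi> "- x"] borel_measurable_continuous_onI[OF mollifier_continuous] \<psi>(5) by simp
  moreover have "\<psi> (y + (- x)) = \<psi> (x - y)" for y using \<psi>(3)[of "x - y"] by simp
  ultimately show "(LINT y|lborel. \<psi> (x - y)) = 1" by simp
qed

text \<open>\<open>\<psi> (x - y)\<close> is a probability density in \<open>y\<close>, and the left
  side is the square of the mean of \<open>f x - f y\<close>; the variance is nonnegative.\<close>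

lemma convolution_jensen:
  "ennreal ((f x - convolution f \<psi> x)\<^sup>2) \<le> (\<integral>\<^sup>+y. ennreal (\<psi> (x - y) * (f x - f y)\<^sup>2) \<partial>lborel)"
proof -
  obtain K where K: "compact K" "\<forall>x. x \<notin> K \<longrightarrow> f x = 0" "continuous_on UNIV f" using f by (rule C1cE)
  have cs: "continuous_on UNIV (\<lambda>y. \<psi> (x - y))"
    by (rule continuous_on_compose2[OF mollifier_continuous]) (auto intro!: continuous_intros)
  have z: "\<psi> (x - y) = 0" if "y \<notin> cball x d" for y
    using that by (intro \<psi>(4)) (simp add: dist_norm)
  have i: "integrable lborel (\<lambda>y. \<psi> (x - y) * h y)" if "continuous_on UNIV h" for h
    by (rule integrable_compact_support[OF continuous_on_mult[OF cs that] compact_cball[of x d]]) (use z in simp)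
  define m where "m = f x - convolution f \<psi> x"
  have I1: "(LINT y|lborel. \<psi> (x - y) * (f x - f y)) = m"
  proof -
    have "(LINT y|lborel. \<psi> (x - y) * (f x - f y)) = (LINT y|lborel. \<psi> (x - y) * f x) - (LINT y|lborel. \<psi> (x - y) * f y)"
      using i[OF K(3)] mollifier_translate_integrable(1)[of x] by (simp add: right_diff_distrib)
    also have "(LINT y|lborel. \<psi> (x - y) * f y) = convolution f \<psi> x"
      by (simp add: convolution_def mult.commute)
    finally show ?thesis using mollifier_translate_integrable[of x] by (simp add: m_def)
  qed
  have cD: "continuous_on UNIV (\<lambda>y. f x - f y)" "continuous_on UNIV (\<lambda>y. (f x - f y)\<^sup>2)" by (intro continuous_intros K(3))+
  have "0 \<le> (LINT y|lborel. \<psi> (x - y) * ((f x - f y) - m)\<^sup>2)" using \<psi>(2) by simp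
  also have "(\<lambda>y. \<psi> (x - y) * ((f x - f y) - m)\<^sup>2) =
      (\<lambda>y. \<psi> (x - y) * (f x - f y)\<^sup>2 - 2 * m * (\<psi> (x - y) * (f x - f y)) + m\<^sup>2 * \<psi> (x - y))"
    by (rule ext) (simp add: power2_eq_square algebra_simps)
  also have "(LINT y|lborel. \<psi> (x - y) * (f x - f y)\<^sup>2 - 2 * m * (\<psi> (x - y) * (f x - f y)) + m\<^sup>2 * \<psi> (x - y))
      = (LINT y|lborel. \<psi> (x - y) * (f x - f y)\<^sup>2) - 2 * m * m + m\<^sup>2"
    using i[OF cD(1)] i[OF cD(2)] mollifier_translate_integrable[of x] I1 by simp
  finally have "m\<^sup>2 \<le> (LINT y|lborel. \<psi> (x - y) * (f x - f y)\<^sup>2)" by (simp add: power2_eq_square)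
  also have "ennreal \<dots> = (\<integral>\<^sup>+y. ennreal (\<psi> (x - y) * (f x - f y)\<^sup>2) \<partial>lborel)"
    using i[OF cD(2)] \<psi>(2) by (intro nn_integral_eq_integral[symmetric]) auto
  finally show ?thesis by (simp add: m_def ennreal_leI)
qed

lemma convolution_continuous: "continuous_on UNIV (convolution f \<psi>)"
proof -
  obtain K where K: "compact K" "\<forall>x. x \<notin> K \<longrightarrow> f x = 0" "continuous_on UNIV f" using f by (rule C1cE)
  show ?thesis using convolution_Ck[OF K(3,1,2) \<psi>(1)[of 0]] by simp
qed

lemma convolution_support:
  assumes "U \<subseteq> cball 0 R" "R + d < norm x" shows "convolution f \<psi> x = 0"
proof -
  obtain K where K: "K \<subseteq> U" "\<forall>x. x \<notin> K \<longrightarrow> f x = 0" using f by (rule C1cE)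
  have "f y * \<psi> (x - y) = 0" for y
  proof (cases "y \<in> K")
    case True
    then have "norm y \<le> R" using K(1) assms(1) by auto
    then have "d \<le> norm (x - y)" using norm_triangle_sub[of x y] assms(2) by linarith
    then show ?thesis using \<psi>(4) by simp
  qed (use K(2) in simp)
  then have "(\<lambda>y. f y * \<psi> (x - y)) = (\<lambda>y. 0)" by (rule ext)
  then show ?thesis by (simp add: convolution_def)
qed

text \<open>After Jensen and the substitution \<open>y = x + z\<close>, the kernel averages the
  translation estimate over \<open>norm z < d\<close>. The rate depends on \<open>f\<close> only
  through its energy, hence is uniform along an energy-bounded sequence.\<close>

lemma convolution_close_L2:
  "(\<integral>\<^sup>+x. ennreal ((f x - convolution f \<psi> x)\<^sup>2) \<partial>lborel) \<le> ennreal (d\<^sup>2 * energy f)"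
proof -
  obtain K where K: "compact K" "\<forall>x. x \<notin> K \<longrightarrow> f x = 0" "continuous_on UNIV f" using f by (rule C1cE)
  have [measurable]: "f \<in> borel_measurable borel" "\<psi> \<in> borel_measurable borel"
    using K(3) mollifier_continuous by (auto intro: borel_measurable_continuous_onI)
  have "(\<integral>\<^sup>+x. ennreal ((f x - convolution f \<psi> x)\<^sup>2) \<partial>lborel)
     \<le> (\<integral>\<^sup>+x. (\<integral>\<^sup>+y. ennreal (\<psi> (x - y) * (f x - f y)\<^sup>2) \<partial>lborel) \<partial>lborel)"
    by (intro nn_integral_mono convolution_jensen)
  also have "\<dots> = (\<integral>\<^sup>+x. (\<integral>\<^sup>+z. ennreal (\<psi> z * (f (x + z) - f x)\<^sup>2) \<partial>lborel) \<partial>lborel)"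
  proof (rule nn_integral_cong)
    fix x
    have "(\<integral>\<^sup>+y. ennreal (\<psi> (x - y) * (f x - f y)\<^sup>2) \<partial>lborel) = (\<integral>\<^sup>+z. ennreal (\<psi> (x - (z + x)) * (f x - f (z + x))\<^sup>2) \<partial>lborel)"
      by (rule nn_integral_translate[symmetric]) measurable
    also have "\<dots> = (\<integral>\<^sup>+z. ennreal (\<psi> z * (f (x + z) - f x)\<^sup>2) \<partial>lborel)"
      using \<psi>(3) by (simp add: power2_commute[of "f x"] add.commute)
    finally show "(\<integral>\<^sup>+y. ennreal (\<psi> (x - y) * (f x - f y)\<^sup>2) \<partial>lborel) = (\<integral>\<^sup>+z. ennreal (\<psi> z * (f (x + z) - f x)\<^sup>2) \<partial>lborel)" .
  qed
  also have "\<dots> = (\<integral>\<^sup>+z. (\<integral>\<^sup>+x. ennreal (\<psi> z * (f (x + z) - f x)\<^sup>2) \<partial>lborel) \<partial>lborel)"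
    by (rule lborel_pair.Fubini'[symmetric]) measurable
  also have "\<dots> \<le> (\<integral>\<^sup>+z. ennreal (d\<^sup>2 * energy f * \<psi> z) \<partial>lborel)"
  proof (rule nn_integral_mono)
    fix z
    have "(\<integral>\<^sup>+x. ennreal (\<psi> z * (f (x + z) - f x)\<^sup>2) \<partial>lborel) = ennreal (\<psi> z) * (\<integral>\<^sup>+x. ennreal ((f (x + z) - f x)\<^sup>2) \<partial>lborel)"
      using \<psi>(2) by (simp add: ennreal_mult nn_integral_cmult)
    also have "\<dots> \<le> ennreal (\<psi> z) * ennreal (norm z ^ 2 * energy f)"
      by (intro mult_left_mono translation_estimate_nn[OF f]) simp
    also have "\<dots> = ennreal (\<psi> z * (norm z ^ 2 * energy f))"
      by (rule ennreal_mult[symmetric]) (use \<psi>(2) energy_nonneg in \<open>auto intro!: mult_nonneg_nonneg\<close>)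
    also have "\<dots> \<le> ennreal (d\<^sup>2 * energy f * \<psi> z)"
    proof (rule ennreal_leI)
      show "\<psi> z * (norm z ^ 2 * energy f) \<le> d\<^sup>2 * energy f * \<psi> z"
      proof (cases "d \<le> norm z")
        case True
        then show ?thesis using \<psi>(4) by simp
      next
        case False
        then have "norm z ^ 2 * energy f \<le> d\<^sup>2 * energy f"
          by (intro mult_right_mono power_mono energy_nonneg) auto
        from mult_left_mono[OF this \<psi>(2)[of z]] show ?thesis by (simp add: mult.commute)
      qed
    qed
    finally show "(\<integral>\<^sup>+x. ennreal (\<psi> z * (f (x + z) - f x)\<^sup>2) \<partial>lborel) \<le> ennreal (d\<^sup>2 * energy f * \<psi> z)" .
  qed
  also have "\<dots> = ennreal (d\<^sup>2 * energy f)"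
  proof -
    have i: "integrable lborel \<psi>"
    proof -
      have "integrable lborel (\<lambda>y. \<psi> (- y))" using mollifier_translate_integrable(1)[of 0] by simp
      then show ?thesis by (simp add: \<psi>(3))
    qed
    have "(\<integral>\<^sup>+z. ennreal (d\<^sup>2 * energy f * \<psi> z) \<partial>lborel) = ennreal (LINT z|lborel. d\<^sup>2 * energy f * \<psi> z)"
      using i \<psi>(2) energy_nonneg[of f] by (intro nn_integral_eq_integral) auto
    then show ?thesis using \<psi>(5) by simp
  qed
  finally show ?thesis .
qed

end

text \<open>At a fixed scale the mollified functions are uniformly bounded and Lipschitz, because
  the \<open>f k\<close> are bounded in \<open>L^1\<close> by Poincare. A diagonal subsequence
  converges on a dense set, by the Lipschitz bound everywhere, and by dominated convergence in
  \<open>L^2\<close>. The mollification error is uniform in \<open>k\<close>, so the original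
  subsequence is Cauchy.\<close>

lemma rellich:
  fixes f :: "nat \<Rightarrow> 'a::euclidean_space \<Rightarrow> real"
  assumes U: "bounded U" and f: "\<And>k. f k \<in> C1c U" "\<And>k. energy (f k) \<le> M"
  shows "\<exists>r. strict_mono (r :: nat \<Rightarrow> nat) \<and>
    (\<forall>e>0. \<exists>N. \<forall>i\<ge>N. \<forall>j\<ge>N. sqnorm (\<lambda>x. f (r i) x - f (r j) x) < e)"
proof -
  obtain R where R: "R > 0" "U \<subseteq> cball 0 R"
    using bounded_subset_ballD[OF U, of 0] ball_subset_cball by blast
  obtain C where C: "C \<ge> 0" "\<And>g. g \<in> C1c U \<Longrightarrow> sqnorm g \<le> C * energy g" using poincare[OF U] by blast
  have M: "0 \<le> M" using f(2)[of 0] energy_nonneg[of "f 0"] by linarith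
  have fm[measurable]: "f k \<in> borel_measurable borel" for k
    using C1cE[OF f(1)] borel_measurable_continuous_onI by metis
  define V where "V = measure lborel (cball (0::'a) R)"
  define B where "B = V + C * M"
  have B0: "0 \<le> B" using C(1) M by (simp add: B_def V_def)
  have L1: "(LINT x|lborel. \<bar>f k x\<bar>) \<le> B" for k
  proof -
    have i: "integrable lborel (\<lambda>x. indicator (cball (0::'a) R) x *\<^sub>R (1::real))" by (intro borel_integrable_compact) auto
    have "(LINT x|lborel. \<bar>f k x\<bar>) \<le> (LINT x|lborel. indicator (cball 0 R) x *\<^sub>R 1 + (f k x)\<^sup>2)"
    proof (rule integral_mono)
      show "integrable lborel (\<lambda>x. \<bar>f k x\<bar>)" by (rule C1c_integrable(5)[OF f(1)])
      show "integrable lborel (\<lambda>x. indicator (cball 0 R) x *\<^sub>R 1 + (f k x)\<^sup>2)"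
        by (rule Bochner_Integration.integrable_add[OF i C1c_integrable(3)[OF f(1)]])
      fix x
      obtain K where K: "K \<subseteq> U" "\<forall>x. x \<notin> K \<longrightarrow> f k x = 0" using f(1) by (rule C1cE)
      show "\<bar>f k x\<bar> \<le> indicator (cball 0 R) x *\<^sub>R 1 + (f k x)\<^sup>2"
      proof (cases "x \<in> K")
        case True
        then have "x \<in> cball 0 R" using K(1) R(2) by blast
        then show ?thesis using abs_le_square[of 1 "f k x"] by simp
      qed (use K(2) in simp)
    qed
    also have "\<dots> = V + sqnorm (f k)"
      unfolding sqnorm_def V_def
      using Bochner_Integration.integral_add[OF i C1c_integrable(3)[OF f(1)[of k]]] by simp
    also have "\<dots> \<le> B"
      unfolding B_def using C(2)[OF f(1)[of k]] mult_left_mono[OF f(2)[of k] C(1)] by linarith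
    finally show ?thesis .
  qed
  have "\<exists>\<psi> L. (\<forall>k. Ck k \<psi>) \<and> (\<forall>x. 0 \<le> \<psi> x) \<and> (\<forall>x::'a. \<psi> (- x) = \<psi> x) \<and>
      (\<forall>x. 1 / real (Suc j) \<le> norm x \<longrightarrow> \<psi> x = 0) \<and> (LINT x|lborel. \<psi> x) = 1 \<and>
      0 \<le> L \<and> (\<forall>x. \<bar>\<psi> x\<bar> \<le> L) \<and> (\<forall>x y. \<bar>\<psi> x - \<psi> y\<bar> \<le> L * norm (x - y))" for j
  proof -
    have "0 < 1 / real (Suc j)" by simp
    then obtain \<psi> :: "'a \<Rightarrow> real" where \<psi>: "\<And>k. Ck k \<psi>" "\<And>x. 0 \<le> \<psi> x" "\<And>x. \<psi> (- x) = \<psi> x"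
      "\<And>x. 1 / real (Suc j) \<le> norm x \<Longrightarrow> \<psi> x = 0" "(LINT x|lborel. \<psi> x) = 1"
      using mollifier_exists by blast
    have "\<psi> \<in> C1c UNIV"
      unfolding C1c_def mem_Collect_eq
      by (intro conjI \<psi>(1) exI[of _ "cball 0 (1 / real (Suc j))"]) (auto intro!: \<psi>(4))
    from C1c_Lipschitz[OF this] obtain L where "0 \<le> L" "\<And>x. \<bar>\<psi> x\<bar> \<le> L" "\<And>x y. \<bar>\<psi> x - \<psi> y\<bar> \<le> L * norm (x - y)" by metis
    then show ?thesis using \<psi> by blast
  qed
  then obtain \<psi> :: "nat \<Rightarrow> 'a \<Rightarrow> real" and L where \<psi>: "\<And>j k. Ck k (\<psi> j)" "\<And>j x. 0 \<le> \<psi> j x" "\<And>j x. \<psi> j (- x) = \<psi> j x"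
      "\<And>j x. 1 / real (Suc j) \<le> norm x \<Longrightarrow> \<psi> j x = 0" "\<And>j. (LINT x|lborel. \<psi> j x) = 1"
    and L: "\<And>j. 0 \<le> L j" "\<And>j x. \<bar>\<psi> j x\<bar> \<le> L j" "\<And>j x y. \<bar>\<psi> j x - \<psi> j y\<bar> \<le> L j * norm (x - y)"
    by metis
  have dpos: "0 < 1 / real (Suc j)" for j by simp
  have c\<psi>: "continuous_on UNIV (\<lambda>y. \<psi> j (x - y))" for j x
  proof -
    have "continuous_on UNIV (\<psi> j)" using \<psi>(1)[of 0 j] by simp
    then show ?thesis by (rule continuous_on_compose2) (auto intro!: continuous_intros)
  qed
  define G where "G j k = convolution (f k) (\<psi> j)" for j k
  have iG: "integrable lborel (\<lambda>y. f k y * \<psi> j (x - y))" for j k x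
  proof -
    obtain K where K: "compact K" "\<forall>x. x \<notin> K \<longrightarrow> f k x = 0" "continuous_on UNIV (f k)" using f(1) by (rule C1cE)
    show ?thesis
      by (rule integrable_compact_support[OF continuous_on_mult[OF K(3) c\<psi>] K(1)]) (use K(2) in simp)
  qed
  have Gbound: "\<bar>G j k x\<bar> \<le> B * L j" for j k x
  proof -
    have "\<bar>G j k x\<bar> \<le> (LINT y|lborel. \<bar>f k y * \<psi> j (x - y)\<bar>)"
      unfolding G_def convolution_def using integral_norm_bound[of lborel "\<lambda>y. f k y * \<psi> j (x - y)"] by simp
    also have "\<dots> \<le> (LINT y|lborel. \<bar>f k y\<bar> * L j)"
    proof (rule integral_mono)
      show "integrable lborel (\<lambda>y. \<bar>f k y * \<psi> j (x - y)\<bar>)" by (rule integrable_abs[OF iG])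
      show "integrable lborel (\<lambda>y. \<bar>f k y\<bar> * L j)" using C1c_integrable(5)[OF f(1)] by simp
      show "\<bar>f k y * \<psi> j (x - y)\<bar> \<le> \<bar>f k y\<bar> * L j" for y
        unfolding abs_mult by (rule mult_left_mono[OF L(2)]) simp
    qed
    also have "\<dots> \<le> B * L j" using L1[of k] L(1)[of j] by (simp add: mult_right_mono)
    finally show ?thesis .
  qed
  have Glip: "\<bar>G j k x - G j k y\<bar> \<le> B * (L j * norm (x - y))" for j k x y
  proof -
    have "G j k x - G j k y = (LINT z|lborel. f k z * (\<psi> j (x - z) - \<psi> j (y - z)))"
      unfolding G_def convolution_def using Bochner_Integration.integral_diff[OF iG[of k j x] iG[of k j y]]
      by (simp add: right_diff_distrib)
    also have "\<bar>\<dots>\<bar> \<le> (LINT z|lborel. \<bar>f k z * (\<psi> j (x - z) - \<psi> j (y - z))\<bar>)"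
      using integral_norm_bound[of lborel "\<lambda>z. f k z * (\<psi> j (x - z) - \<psi> j (y - z))"] by simp
    also have "\<dots> \<le> (LINT z|lborel. \<bar>f k z\<bar> * (L j * norm (x - y)))"
    proof (rule integral_mono)
      show "integrable lborel (\<lambda>z. \<bar>f k z * (\<psi> j (x - z) - \<psi> j (y - z))\<bar>)"
        using Bochner_Integration.integrable_diff[OF iG[of k j x] iG[of k j y]]
        by (intro integrable_abs) (simp add: right_diff_distrib)
      show "integrable lborel (\<lambda>z. \<bar>f k z\<bar> * (L j * norm (x - y)))" using C1c_integrable(5)[OF f(1)] by simp
      fix z
      have "\<bar>\<psi> j (x - z) - \<psi> j (y - z)\<bar> \<le> L j * norm (x - y)" using L(3)[of j "x - z" "y - z"] by simp
      then show "\<bar>f k z * (\<psi> j (x - z) - \<psi> j (y - z))\<bar> \<le> \<bar>f k z\<bar> * (L j * norm (x - y))"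
        unfolding abs_mult by (rule mult_left_mono) simp
    qed
    also have "\<dots> \<le> B * (L j * norm (x - y))"
      using L1[of k] L(1)[of j] by (simp add: mult_right_mono)
    finally show ?thesis .
  qed
  obtain D :: "'a set" where D: "countable D" "\<And>X. open X \<Longrightarrow> X \<noteq> {} \<Longrightarrow> \<exists>d\<in>D. d \<in> X"
    using countable_dense_exists by metis
  \<comment> \<open>One extraction serves all scales \<open>j\<close> and all points of the dense
    set; dividing by \<open>L j + 1\<close> provides a single bound \<open>B\<close> for all of
    them.\<close>
  have "countable ((UNIV :: nat set) \<times> D)" using D(1) by simp
  moreover have "norm (G (fst p) k (snd p) / (L (fst p) + 1)) \<le> B" for k p
  proof -
    have "\<bar>G (fst p) k (snd p)\<bar> \<le> B * (L (fst p) + 1)"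
      using Gbound[of "fst p" k "snd p"] B0 by (simp add: distrib_left)
    then show ?thesis using L(1)[of "fst p"] by (simp add: pos_divide_le_eq)
  qed
  ultimately obtain r where r: "strict_mono (r :: nat \<Rightarrow> nat)"
    and conv: "\<And>p. p \<in> UNIV \<times> D \<Longrightarrow> \<exists>l. (\<lambda>n. G (fst p) (r n) (snd p) / (L (fst p) + 1)) \<longlonglongrightarrow> l"
    using function_convergent_subsequence[of "UNIV \<times> D" "\<lambda>k p. G (fst p) k (snd p) / (L (fst p) + 1)" B] by blast
  have convD: "Cauchy (\<lambda>n. G j (r n) q)" if qD: "q \<in> D" for j q
  proof -
    obtain l where "(\<lambda>n. G j (r n) q / (L j + 1)) \<longlonglongrightarrow> l" using conv[of "(j, q)"] qD by auto
    then have "(\<lambda>n. (L j + 1) * (G j (r n) q / (L j + 1))) \<longlonglongrightarrow> (L j + 1) * l" by (rule tendsto_mult_left)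
    moreover have "L j + 1 \<noteq> 0" using L(1)[of j] by linarith
    ultimately have "(\<lambda>n. G j (r n) q) \<longlonglongrightarrow> (L j + 1) * l" by simp
    then show ?thesis by (rule LIMSEQ_imp_Cauchy)
  qed
  have convG: "convergent (\<lambda>n. G j (r n) x)" for j x
  proof -
    have "Cauchy (\<lambda>n. G j (r n) x)"
    proof (rule CauchyI)
      fix e :: real assume e: "0 < e"
      define X where "X = B * L j + 1"
      define \<delta> where "\<delta> = e / 3 / X"
      have BL: "0 < X" using B0 L(1)[of j] by (simp add: X_def add_nonneg_pos)
      have \<delta>: "0 < \<delta>" using e BL by (simp add: \<delta>_def)
      obtain q where q: "q \<in> D" "q \<in> ball x \<delta>" using D(2)[of "ball x \<delta>"] \<delta> by auto
      have near: "\<bar>G j k x - G j k q\<bar> < e / 3" for k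
      proof -
        have "\<bar>G j k x - G j k q\<bar> \<le> B * L j * norm (x - q)" using Glip[of j k x q] by (simp add: mult.assoc)
        also have "\<dots> \<le> B * L j * \<delta>"
          using q(2) B0 L(1)[of j] by (intro mult_left_mono) (auto simp: dist_norm)
        also have "\<dots> < X * \<delta>" using \<delta> by (simp add: X_def distrib_right)
        also have "\<dots> = e / 3" using BL by (simp add: \<delta>_def)
        finally show ?thesis .
      qed
      obtain N where N: "\<forall>m\<ge>N. \<forall>n\<ge>N. norm (G j (r m) q - G j (r n) q) < e / 3"
        using CauchyD[OF convD[OF q(1)], of "e / 3" j] e by (meson divide_pos_pos zero_less_numeral)
      have "norm (G j (r m) x - G j (r n) x) < e" if "m \<ge> N" "n \<ge> N" for m n
      proof -
        have "\<bar>G j (r m) q - G j (r n) q\<bar> < e / 3" using N that by simp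
        then show ?thesis using near[of "r m"] near[of "r n"] unfolding real_norm_def by linarith
      qed
      then show "\<exists>N. \<forall>m\<ge>N. \<forall>n\<ge>N. norm (G j (r m) x - G j (r n) x) < e" by blast
    qed
    then show ?thesis by (rule Cauchy_convergent)
  qed
  have cG: "continuous_on UNIV (G j k)" for j k
    unfolding G_def by (rule convolution_continuous[OF f(1) \<psi> dpos])
  have Gm[measurable]: "G j k \<in> borel_measurable borel" for j k
    by (rule borel_measurable_continuous_onI[OF cG])
  define S where "S = cball (0::'a) (R + 1)"
  have Gz: "G j k x = 0" if "x \<notin> S" for j k x
  proof -
    have "R + 1 < norm x" using that by (simp add: S_def)
    moreover have "1 / real (Suc j) \<le> 1" by simp
    ultimately have *: "R + 1 / real (Suc j) < norm x" by linarith
    show ?thesis unfolding G_def by (rule convolution_support[OF f(1) \<psi> dpos R(2) *])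
  qed
  have iS: "integrable lborel (\<lambda>x. indicator S x *\<^sub>R c)" for c :: real
    unfolding S_def by (intro borel_integrable_compact) auto
  define h where "h j x = lim (\<lambda>n. G j (r n) x)" for j x
  have hlim: "(\<lambda>n. G j (r n) x) \<longlonglongrightarrow> h j x" for j x
    using convG[of j x] by (simp add: h_def convergent_LIMSEQ_iff)
  have hm[measurable]: "h j \<in> borel_measurable borel" for j
    using borel_measurable_LIMSEQ_metric[OF Gm hlim] .
  have hb: "\<bar>h j x\<bar> \<le> B * L j" for j x
    by (rule LIMSEQ_le_const2[OF tendsto_rabs[OF hlim]]) (use Gbound in blast)
  have hz: "h j x = 0" if "x \<notin> S" for j x using Gz[OF that] by (simp add: h_def)
  have Gsq: "(G j (r n) x - h j x)\<^sup>2 \<le> indicator S x *\<^sub>R (2 * (B * L j))\<^sup>2" for j n x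
  proof (cases "x \<in> S")
    case True
    have "\<bar>G j (r n) x - h j x\<bar> \<le> 2 * (B * L j)" using Gbound[of j "r n" x] hb[of j x] by linarith
    then have "\<bar>G j (r n) x - h j x\<bar>\<^sup>2 \<le> (2 * (B * L j))\<^sup>2" by (intro power_mono) auto
    then show ?thesis using True by simp
  qed (simp add: Gz hz)
  have iGh: "integrable lborel (\<lambda>x. (G j (r n) x - h j x)\<^sup>2)" for j n
    by (rule Bochner_Integration.integrable_bound[OF iS[of "(2 * (B * L j))\<^sup>2"]])
       (use Gsq[of j n] in \<open>auto simp: indicator_def split: if_splits\<close>)
  have Glim: "(\<lambda>n. LINT x|lborel. (G j (r n) x - h j x)\<^sup>2) \<longlonglongrightarrow> 0" for j
  proof -
    have "(\<lambda>n. LINT x|lborel. (G j (r n) x - h j x)\<^sup>2) \<longlonglongrightarrow> (LINT x|lborel. (h j x - h j x)\<^sup>2 :: real)"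
    proof (rule integral_dominated_convergence[where w="\<lambda>x. indicator S x *\<^sub>R (2 * (B * L j))\<^sup>2"])
      show "AE x in lborel. (\<lambda>n. (G j (r n) x - h j x)\<^sup>2) \<longlonglongrightarrow> (h j x - h j x)\<^sup>2"
        by (intro AE_I2 tendsto_intros hlim)
      show "AE x in lborel. norm ((G j (r n) x - h j x)\<^sup>2) \<le> indicator S x *\<^sub>R (2 * (B * L j))\<^sup>2" for n
        using Gsq by (intro AE_I2) simp
      show "integrable lborel (\<lambda>x. indicator S x *\<^sub>R (2 * (B * L j))\<^sup>2)" by (rule iS)
    qed measurable
    then show ?thesis by simp
  qed
  have close: "integrable lborel (\<lambda>x. (f k x - G j k x)\<^sup>2) \<and>
      (LINT x|lborel. (f k x - G j k x)\<^sup>2) \<le> (1 / real (Suc j))\<^sup>2 * M" for j k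
  proof -
    have nn: "(\<integral>\<^sup>+x. ennreal ((f k x - G j k x)\<^sup>2) \<partial>lborel) \<le> ennreal ((1 / real (Suc j))\<^sup>2 * energy (f k))"
      unfolding G_def by (rule convolution_close_L2[OF f(1) \<psi> dpos])
    have i: "integrable lborel (\<lambda>x. (f k x - G j k x)\<^sup>2)"
    proof (rule integrableI_nonneg)
      show "(\<integral>\<^sup>+x. ennreal ((f k x - G j k x)\<^sup>2) \<partial>lborel) < \<infinity>" using nn by (simp add: le_less_trans)
    qed auto
    have "ennreal (LINT x|lborel. (f k x - G j k x)\<^sup>2) \<le> ennreal ((1 / real (Suc j))\<^sup>2 * energy (f k))"
      using nn nn_integral_eq_integral[OF i] by simp
    then have "(LINT x|lborel. (f k x - G j k x)\<^sup>2) \<le> (1 / real (Suc j))\<^sup>2 * energy (f k)"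
      using energy_nonneg[of "f k"] by (subst (asm) ennreal_le_iff) auto
    also have "\<dots> \<le> (1 / real (Suc j))\<^sup>2 * M" by (intro mult_left_mono f(2)) simp
    finally show ?thesis using i by blast
  qed
  have "\<exists>N. \<forall>m\<ge>N. \<forall>n\<ge>N. sqnorm (\<lambda>x. f (r m) x - f (r n) x) < e" if e: "0 < e" for e
  proof -
    obtain j where j: "16 * M / e < real (Suc j)" using reals_Archimedean2 by (meson less_trans lessI of_nat_less_iff)
    \<comment> \<open>Splitting into four differences costs a factor 4 on each square. Each of the
      two indices contributes two terms, so \<open>e / 16\<close> for each adds up to
      \<open>e\<close>.\<close>
    have small: "(1 / real (Suc j))\<^sup>2 * M < e / 16"
    proof -
      have "(1 / real (Suc j))\<^sup>2 * M \<le> (1 / real (Suc j)) * M"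
        using M by (intro mult_right_mono) (auto simp: power2_eq_square divide_simps)
      also have "\<dots> < e / 16" using j e by (simp add: divide_simps mult.commute)
      finally show ?thesis .
    qed
    obtain N where N: "\<forall>n\<ge>N. (LINT x|lborel. (G j (r n) x - h j x)\<^sup>2) < e / 16"
      using LIMSEQ_D[OF Glim, of "e / 16"] e by auto
    have "sqnorm (\<lambda>x. f (r m) x - f (r n) x) < e" if mn: "m \<ge> N" "n \<ge> N" for m n
    proof -
      let ?P = "\<lambda>m x. 4 * (f (r m) x - G j (r m) x)\<^sup>2 + 4 * (G j (r m) x - h j x)\<^sup>2"
      have i: "integrable lborel (?P m)" for m using close iGh by simp
      have "sqnorm (\<lambda>x. f (r m) x - f (r n) x) \<le> (LINT x|lborel. ?P m x + ?P n x)"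
        unfolding sqnorm_def
      proof (rule integral_mono)
        show "integrable lborel (\<lambda>x. (f (r m) x - f (r n) x)\<^sup>2)" by (rule C1c_integrable(3)[OF C1c_diff[OF f(1) f(1)]])
        show "integrable lborel (\<lambda>x. ?P m x + ?P n x)" by (rule Bochner_Integration.integrable_add[OF i i])
        fix x
        have *: "(a + b)\<^sup>2 \<le> 2 * a\<^sup>2 + 2 * b\<^sup>2" for a b :: real
          using norm_diff_square_le[of a "- b"] by simp
        let ?a = "f (r m) x - G j (r m) x" and ?b = "G j (r m) x - h j x" and ?c = "f (r n) x - G j (r n) x" and ?d = "G j (r n) x - h j x"
        have "(f (r m) x - f (r n) x)\<^sup>2 = ((?a + ?b) + (- (?c + ?d)))\<^sup>2" by simp
        also have "\<dots> \<le> 2 * (?a + ?b)\<^sup>2 + 2 * (?c + ?d)\<^sup>2" using *[of "?a + ?b" "- (?c + ?d)"] by (simp only: power2_minus)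
        also have "\<dots> \<le> 2 * (2 * ?a\<^sup>2 + 2 * ?b\<^sup>2) + 2 * (2 * ?c\<^sup>2 + 2 * ?d\<^sup>2)"
          by (intro add_mono mult_left_mono *) auto
        finally show "(f (r m) x - f (r n) x)\<^sup>2 \<le> ?P m x + ?P n x" by simp
      qed
      also have "\<dots> = (LINT x|lborel. ?P m x) + (LINT x|lborel. ?P n x)"
        by (rule Bochner_Integration.integral_add[OF i i])
      also have "\<dots> < e / 2 + e / 2"
      proof -
        have "(LINT x|lborel. ?P m x) < e / 2" if "m \<ge> N" for m
        proof -
          have "(LINT x|lborel. ?P m x) = 4 * (LINT x|lborel. (f (r m) x - G j (r m) x)\<^sup>2) + 4 * (LINT x|lborel. (G j (r m) x - h j x)\<^sup>2)"
            using close iGh by simp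
          moreover have "(LINT x|lborel. (f (r m) x - G j (r m) x)\<^sup>2) < e / 16"
            using close[of "r m" j] small by linarith
          moreover have "(LINT x|lborel. (G j (r m) x - h j x)\<^sup>2) < e / 16" using N that by blast
          ultimately show ?thesis by linarith
        qed
        then show ?thesis using mn by (intro add_strict_mono) auto
      qed
      finally show ?thesis by simp
    qed
    then show ?thesis by blast
  qed
  then show ?thesis using r by blast
qed

section \<open>Existence of a minimizer\<close>

text \<open>The parallelogram identity with weights; the last term is the gain from strict
  convexity. For \<open>t = 1 / 2\<close> it shows that near-minimizers form a Cauchy sequence, for
  small \<open>t\<close> it controls the difference of \<open>v m\<close> from a
  near-minimizer.\<close>

lemma energy_segment:
  assumes "f \<in> C1c U" "g \<in> C1c U"
  shows "energy (\<lambda>x. (1 - t) * f x + t * g x) = (1 - t) * energy f + t * energy g - t * (1 - t) * energy (\<lambda>x. f x - g x)"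
proof -
  have d: "f differentiable at x" "g differentiable at x" for x
    using assms by (auto elim!: C1cE intro: Ck_1_differentiable)
  have gr: "gradient (\<lambda>x. (1 - t) * f x + t * g x) x = (1 - t) *\<^sub>R gradient f x + t *\<^sub>R gradient g x" for x
  proof -
    have "gradient (\<lambda>x. (1 - t) * f x + t * g x) x = gradient (\<lambda>x. (1 - t) * f x) x + gradient (\<lambda>x. t * g x) x"
      by (rule gradient_add) (intro differentiable_mult differentiable_const d)+
    then show ?thesis by (simp add: gradient_cmult d)
  qed
  have pt: "(norm ((1 - t) *\<^sub>R a + t *\<^sub>R b))\<^sup>2 = (1 - t) * (norm a)\<^sup>2 + t * (norm b)\<^sup>2 - t * (1 - t) * (norm (a - b))\<^sup>2" for a b :: 'a
    by (simp add: power2_norm_eq_inner inner_diff_left inner_diff_right inner_add_left inner_add_right inner_commute[of b a] algebra_simps)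
  have i: "integrable lborel (\<lambda>x. (norm (gradient f x - gradient g x))\<^sup>2)"
    using C1c_integrable(4)[OF C1c_diff[OF assms]] by (simp add: gradient_diff[OF assms])
  show ?thesis
    unfolding energy_def gr pt gradient_diff[OF assms]
    using C1c_integrable(4)[OF assms(1)] C1c_integrable(4)[OF assms(2)] i by simp
qed

text \<open>The convex hull of the tail from index \<open>m\<close> on. Generating it by segments
  lets every property stable under segments pass to it by induction, without finite families of
  coefficients.\<close>

inductive_set function_hull :: "(nat \<Rightarrow> 'a \<Rightarrow> real) \<Rightarrow> nat \<Rightarrow> ('a \<Rightarrow> real) set" for v m where
  base: "m \<le> k \<Longrightarrow> v k \<in> function_hull v m"
| segment: "f \<in> function_hull v m \<Longrightarrow> g \<in> function_hull v m \<Longrightarrow> 0 \<le> t \<Longrightarrow> t \<le> 1 \<Longrightarrow>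
    (\<lambda>x. (1 - t) * f x + t * g x) \<in> function_hull v m"

lemma function_hull_antimono:
  assumes "f \<in> function_hull v n" "m \<le> n" shows "f \<in> function_hull v m"
  using assms by (induction) (auto intro: function_hull.intros)

lemma function_hull_test_functions:
  assumes "f \<in> function_hull v m" "\<And>k. v k \<in> test_functions U" shows "f \<in> test_functions U"
  using assms
proof induction
  case (segment f g t)
  then have "f \<in> test_functions U" "g \<in> test_functions U" by blast+
  then show ?case by (intro test_functions_add test_functions_cmult)
qed blast

lemma square_convex_combination:
  fixes a b t :: real
  assumes "0 \<le> t" "t \<le> 1" shows "((1 - t) * a + t * b)\<^sup>2 \<le> (1 - t) * a\<^sup>2 + t * b\<^sup>2"
proof -
  have "(1 - t) * a\<^sup>2 + t * b\<^sup>2 - ((1 - t) * a + t * b)\<^sup>2 = t * (1 - t) * (a - b)\<^sup>2"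
    by (simp add: power2_eq_square algebra_simps)
  moreover have "0 \<le> t * (1 - t) * (a - b)\<^sup>2" using assms by simp
  ultimately show ?thesis by linarith
qed

lemma integrable_diff_square:
  fixes f g :: "'a \<Rightarrow> real"
  assumes "f \<in> borel_measurable M" "g \<in> borel_measurable M"
    and "integrable M (\<lambda>x. (f x)\<^sup>2)" "integrable M (\<lambda>x. (g x)\<^sup>2)"
  shows "integrable M (\<lambda>x. (f x - g x)\<^sup>2)"
  using integrable_norm_diff_square[OF assms(1,2)] assms(3,4) by simp

lemma C1c_borel_measurable:
  assumes "f \<in> C1c U" shows "f \<in> borel_measurable borel" "gradient f \<in> borel_measurable borel"
  using assms by (auto elim!: C1cE intro: borel_measurable_continuous_onI)

text \<open>Balls around \<open>u\<close> in \<open>L^2\<close> are convex, so convex combinations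
  of a tail stay as close to \<open>u\<close> as the tail itself. This identifies \<open>u\<close>
  as the limit of the convexified sequence.\<close>

lemma function_hull_distance:
  fixes u :: "'a::euclidean_space \<Rightarrow> real"
  assumes "f \<in> function_hull v m" and v: "\<And>k. v k \<in> test_functions U"
    and u: "u \<in> borel_measurable borel" "integrable lborel (\<lambda>x. (u x)\<^sup>2)"
    and B: "\<And>k. m \<le> k \<Longrightarrow> (LINT x|lborel. (v k x - u x)\<^sup>2) \<le> B"
  shows "(LINT x|lborel. (f x - u x)\<^sup>2) \<le> B"
  using assms(1)
proof induction
  case (base k)
  then show ?case by (rule B)
next
  case (segment f g t)
  have i: "integrable lborel (\<lambda>x. (h x - u x)\<^sup>2)" if "h \<in> function_hull v m" for h
  proof -
    have h: "h \<in> C1c U" using function_hull_test_functions[OF that v] by (rule test_functions_C1c)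
    show ?thesis
      by (rule integrable_diff_square) (use h u C1c_borel_measurable[OF h] C1c_integrable(3)[OF h] in auto)
  qed
  have "(LINT x|lborel. ((1 - t) * f x + t * g x - u x)\<^sup>2) \<le> (LINT x|lborel. (1 - t) * (f x - u x)\<^sup>2 + t * (g x - u x)\<^sup>2)"
  proof (rule integral_mono)
    show "integrable lborel (\<lambda>x. ((1 - t) * f x + t * g x - u x)\<^sup>2)"
      by (rule i) (rule function_hull.segment[OF segment.hyps])
    show "integrable lborel (\<lambda>x. (1 - t) * (f x - u x)\<^sup>2 + t * (g x - u x)\<^sup>2)"
      using i segment.hyps by simp
    fix x
    have "(1 - t) * f x + t * g x - u x = (1 - t) * (f x - u x) + t * (g x - u x)" by (simp add: algebra_simps)
    then show "((1 - t) * f x + t * g x - u x)\<^sup>2 \<le> (1 - t) * (f x - u x)\<^sup>2 + t * (g x - u x)\<^sup>2"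
      using square_convex_combination[OF segment.hyps(3,4), of "f x - u x" "g x - u x"] by simp
  qed
  also have "\<dots> = (1 - t) * (LINT x|lborel. (f x - u x)\<^sup>2) + t * (LINT x|lborel. (g x - u x)\<^sup>2)"
    using i segment.hyps by simp
  also have "\<dots> \<le> (1 - t) * B + t * B"
    using segment by (intro add_mono mult_left_mono) auto
  finally show ?case by (simp add: algebra_simps)
qed

text \<open>Young's inequality with parameter \<eta>, used in both directions and followed by \<eta>
  to 0, takes the place of the reverse triangle inequality for the norm.\<close>

lemma L2_limit_norm:
  fixes s :: "nat \<Rightarrow> 'a \<Rightarrow> 'b::euclidean_space"
  assumes m: "\<And>n. s n \<in> borel_measurable M" "u \<in> borel_measurable M"
    and i: "\<And>n. integrable M (\<lambda>x. (norm (s n x))\<^sup>2)" "integrable M (\<lambda>x. (norm (u x))\<^sup>2)"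
    and d: "(\<lambda>n. LINT x|M. (norm (s n x - u x))\<^sup>2) \<longlonglongrightarrow> 0"
    and e: "(\<lambda>n. LINT x|M. (norm (s n x))\<^sup>2) \<longlonglongrightarrow> e"
  shows "(LINT x|M. (norm (u x))\<^sup>2) = e"
proof -
  define I where "I = (LINT x|M. (norm (u x))\<^sup>2)"
  have id: "integrable M (\<lambda>x. (norm (s n x - u x))\<^sup>2)" for n
    by (rule integrable_norm_diff_square[OF m i])
  have 1: "I \<le> (1 + \<eta>) * e" and 2: "e \<le> (1 + \<eta>) * I" if \<eta>: "0 < \<eta>" for \<eta>
  proof -
    have "I \<le> (1 + \<eta>) * (LINT x|M. (norm (s n x))\<^sup>2) + (1 + 1 / \<eta>) * (LINT x|M. (norm (s n x - u x))\<^sup>2)" for n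
    proof -
      have "I \<le> (LINT x|M. (1 + \<eta>) * (norm (s n x))\<^sup>2 + (1 + 1 / \<eta>) * (norm (s n x - u x))\<^sup>2)"
        unfolding I_def
      proof (rule integral_mono[OF i(2)])
        show "integrable M (\<lambda>x. (1 + \<eta>) * (norm (s n x))\<^sup>2 + (1 + 1 / \<eta>) * (norm (s n x - u x))\<^sup>2)"
          using i(1) id by simp
        show "(norm (u x))\<^sup>2 \<le> (1 + \<eta>) * (norm (s n x))\<^sup>2 + (1 + 1 / \<eta>) * (norm (s n x - u x))\<^sup>2" for x
          using norm_add_square_le[OF \<eta>, of "s n x" "u x - s n x"] by (simp add: norm_minus_commute)
      qed
      then show ?thesis using i(1) id by simp
    qed
    moreover have "(\<lambda>n. (1 + \<eta>) * (LINT x|M. (norm (s n x))\<^sup>2) + (1 + 1 / \<eta>) * (LINT x|M. (norm (s n x - u x))\<^sup>2)) \<longlonglongrightarrow> (1 + \<eta>) * e + (1 + 1 / \<eta>) * 0"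
      by (intro tendsto_add tendsto_mult_left d e)
    ultimately have "I \<le> (1 + \<eta>) * e + (1 + 1 / \<eta>) * 0" by (intro LIMSEQ_le_const) auto
    then show "I \<le> (1 + \<eta>) * e" by simp
    have "(LINT x|M. (norm (s n x))\<^sup>2) \<le> (1 + \<eta>) * I + (1 + 1 / \<eta>) * (LINT x|M. (norm (s n x - u x))\<^sup>2)" for n
    proof -
      have "(LINT x|M. (norm (s n x))\<^sup>2) \<le> (LINT x|M. (1 + \<eta>) * (norm (u x))\<^sup>2 + (1 + 1 / \<eta>) * (norm (s n x - u x))\<^sup>2)"
      proof (rule integral_mono[OF i(1)])
        show "integrable M (\<lambda>x. (1 + \<eta>) * (norm (u x))\<^sup>2 + (1 + 1 / \<eta>) * (norm (s n x - u x))\<^sup>2)"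
          using i(2) id by simp
        show "(norm (s n x))\<^sup>2 \<le> (1 + \<eta>) * (norm (u x))\<^sup>2 + (1 + 1 / \<eta>) * (norm (s n x - u x))\<^sup>2" for x
          using norm_add_square_le[OF \<eta>, of "u x" "s n x - u x"] by simp
      qed
      then show ?thesis using i(2) id by (simp add: I_def)
    qed
    moreover have "(\<lambda>n. (1 + \<eta>) * I + (1 + 1 / \<eta>) * (LINT x|M. (norm (s n x - u x))\<^sup>2)) \<longlonglongrightarrow> (1 + \<eta>) * I + (1 + 1 / \<eta>) * 0"
      by (intro tendsto_add tendsto_mult_left tendsto_const d)
    ultimately have "e \<le> (1 + \<eta>) * I + (1 + 1 / \<eta>) * 0" using e by (intro LIMSEQ_le[OF e]) auto
    then show "e \<le> (1 + \<eta>) * I" by simp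
  qed
  have lim: "((\<lambda>\<eta>. (1 + \<eta>) * c) \<longlongrightarrow> (1 + 0) * c) (at_right (0::real))" for c :: real
    by (intro tendsto_intros)
  have "I \<le> (1 + 0) * e"
    by (rule tendsto_lowerbound[OF lim]) (auto intro!: 1 eventually_at_right_less[THEN eventually_mono])
  moreover have "e \<le> (1 + 0) * I"
    by (rule tendsto_lowerbound[OF lim]) (auto intro!: 2 eventually_at_right_less[THEN eventually_mono])
  ultimately show ?thesis by (simp add: I_def)
qed

text \<open>
  Almost-minimizers \<open>x n\<close> of the energy over the convex hulls of the tails converge strongly, by
  the parallelogram identity; this replaces the extraction of a weakly convergent subsequence.
\<close>

lemma convexified_limit:
  fixes v :: "nat \<Rightarrow> 'a::euclidean_space \<Rightarrow> real" and u :: "'a \<Rightarrow> real"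
  assumes U: "bounded U" and v: "\<And>k. v k \<in> test_functions U" and Ev: "(\<lambda>k. energy (v k)) \<longlonglongrightarrow> \<mu>0"
    and u: "u \<in> borel_measurable borel" "integrable lborel (\<lambda>x. (u x)\<^sup>2)"
    and lim: "(\<lambda>k. LINT x|lborel. (v k x - u x)\<^sup>2) \<longlonglongrightarrow> 0"
  shows "\<exists>x G. (\<forall>n. x n \<in> test_functions U) \<and> G \<in> borel_measurable borel \<and> (\<forall>y. y \<notin> U \<longrightarrow> G y = 0) \<and>
    integrable lborel (\<lambda>y. (norm (G y))\<^sup>2) \<and> (\<lambda>n. LINT y|lborel. (norm (gradient (x n) y - G y))\<^sup>2) \<longlonglongrightarrow> 0 \<and>
    (\<lambda>n. LINT y|lborel. (x n y - u y)\<^sup>2) \<longlonglongrightarrow> 0 \<and> (\<lambda>n. energy (x n)) \<longlonglongrightarrow> (LINT y|lborel. (norm (G y))\<^sup>2) \<and>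
    (LINT y|lborel. (norm (G y))\<^sup>2) \<le> \<mu>0 \<and>
    (\<forall>\<eta>. 0 < \<eta> \<longrightarrow> \<eta> < 1 \<longrightarrow> (\<exists>l. \<forall>\<^sub>F m in sequentially.
       energy (\<lambda>y. v m y - x l y) \<le> (\<mu>0 - (LINT y|lborel. (norm (G y))\<^sup>2) + 3 * \<eta>) / (1 - \<eta>) \<and>
       sqnorm (\<lambda>y. v m y - x l y) \<le> \<eta>))"
proof -
  define H where "H = function_hull v"
  have HT: "f \<in> test_functions U" if "f \<in> H m" for f m
    using function_hull_test_functions[OF that[unfolded H_def] v] .
  have HC: "f \<in> C1c U" if "f \<in> H m" for f m using HT[OF that] by (rule test_functions_C1c)
  \<comment> \<open>The hulls shrink with \<open>m\<close>, so these infima increase; they stay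
    below \<mu>0 because each hull contains its tail. Their limit \<open>e0\<close> becomes the
    energy of the limit gradient.\<close>
  define e where "e m = (INF f\<in>H m. energy f)" for m
  have vH: "v k \<in> H m" if "m \<le> k" for k m using that by (simp add: H_def function_hull.base)
  have bdd: "bdd_below (energy ` H m)" for m by (rule bdd_belowI[of _ 0]) (auto simp: energy_nonneg)
  have ele: "e m \<le> energy f" if "f \<in> H m" for f m unfolding e_def by (rule cINF_lower[OF bdd that])
  have emono: "e m \<le> e n" if "m \<le> n" for m n
    unfolding e_def
  proof (rule cINF_superset_mono)
    show "H n \<noteq> {}" using vH[of n n] by blast
    show "H n \<subseteq> H m" using function_hull_antimono[OF _ that] by (auto simp: H_def)
  qed (use bdd in auto)
  have e\<mu>: "e m \<le> \<mu>0" for m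
    by (rule LIMSEQ_le_const[OF Ev]) (use ele vH in blast)
  have "incseq e" using emono by (simp add: incseq_def)
  then obtain e0 where e0: "e \<longlonglongrightarrow> e0" "\<And>m. e m \<le> e0"
    using incseq_convergent[of e \<mu>0] e\<mu> by blast
  have e0\<mu>: "e0 \<le> \<mu>0" by (rule LIMSEQ_le_const2[OF e0(1)]) (use e\<mu> in blast)
  have "\<exists>f\<in>H m. energy f < e m + 1 / real (Suc m)" for m
  proof -
    have "H m \<noteq> {}" using vH[of m m] by blast
    then have "Inf (energy ` H m) < e m + 1 / real (Suc m) \<Longrightarrow> ?thesis"
      using bdd by (simp add: cInf_less_iff)
    then show ?thesis by (simp add: e_def)
  qed
  then obtain x where x: "\<And>m. x m \<in> H m" "\<And>m. energy (x m) < e m + 1 / real (Suc m)" by metis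
  have xC: "x m \<in> C1c U" for m using HC[OF x(1)] .
  have L0: "(\<lambda>k. 1 / real (Suc k)) \<longlonglongrightarrow> 0" by (rule LIMSEQ_Suc[OF lim_1_over_n])
  have Ex: "(\<lambda>n. energy (x n)) \<longlonglongrightarrow> e0"
  proof (rule tendsto_sandwich)
    show "\<forall>\<^sub>F n in sequentially. e n \<le> energy (x n)" using ele[OF x(1)] by simp
    show "\<forall>\<^sub>F n in sequentially. energy (x n) \<le> e n + 1 / real (Suc n)" using x(2) by (simp add: less_imp_le)
    show "(\<lambda>n. e n + 1 / real (Suc n)) \<longlonglongrightarrow> e0" using tendsto_add[OF e0(1) L0] by simp
  qed (rule e0(1))
  have seg: "t * (1 - t) * energy (\<lambda>y. f y - g y) \<le> (1 - t) * energy f + t * energy g - e l"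
    if "f \<in> H l" "g \<in> H l" "0 \<le> t" "t \<le> 1" for f g l t
  proof -
    have "e l \<le> energy (\<lambda>y. (1 - t) * f y + t * g y)"
      using that by (intro ele) (simp add: H_def function_hull.segment)
    then show ?thesis using energy_segment[OF HC[OF that(1)] HC[OF that(2)], of t] by linarith
  qed
  have xH: "x n \<in> H m" if "m \<le> n" for m n
    using function_hull_antimono[OF x(1)[unfolded H_def] that] by (simp add: H_def)
  have "\<exists>N. \<forall>i\<ge>N. \<forall>j\<ge>N. (LINT y|lborel. (norm (gradient (x i) y - gradient (x j) y))\<^sup>2) < \<epsilon>" if \<epsilon>: "0 < \<epsilon>" for \<epsilon>
  proof -
    have "(\<lambda>n. 4 * (e0 - e n + 1 / real (Suc n))) \<longlonglongrightarrow> 4 * (e0 - e0 + 0)"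
      by (intro tendsto_intros e0(1) L0)
    then have "\<forall>\<^sub>F n in sequentially. 4 * (e0 - e n + 1 / real (Suc n)) < \<epsilon>"
      by (rule order_tendstoD(2)) (use \<epsilon> in simp)
    then obtain N where N: "4 * (e0 - e N + 1 / real (Suc N)) < \<epsilon>" by (auto simp: eventually_sequentially)
    have "(LINT y|lborel. (norm (gradient (x i) y - gradient (x j) y))\<^sup>2) < \<epsilon>" if ij: "i \<ge> N" "j \<ge> N" for i j
    proof -
      have b: "energy (x i) \<le> e0 + 1 / real (Suc N)" if "i \<ge> N" for i
      proof -
        have "1 / real (Suc i) \<le> 1 / real (Suc N)" using that by (intro divide_left_mono) auto
        then show ?thesis using x(2)[of i] e0(2)[of i] by linarith
      qed
      \<comment> \<open>The midpoint lies in the hull with index \<open>N\<close>, so its energy is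
        at least \<open>e N\<close>; the gain at \<open>t = 1 / 2\<close> bounds the energy of the
        difference.\<close>
      have "(1/2) * (1 - 1/2) * energy (\<lambda>y. x i y - x j y) \<le> (1 - 1/2) * energy (x i) + (1/2) * energy (x j) - e N"
        by (rule seg[OF xH[OF ij(1)] xH[OF ij(2)]]) auto
      then have "energy (\<lambda>y. x i y - x j y) \<le> 4 * (e0 - e N + 1 / real (Suc N))"
        using b[OF ij(1)] b[OF ij(2)] by simp
      then show ?thesis using N unfolding energy_def gradient_diff[OF xC xC] by linarith
    qed
    then show ?thesis by blast
  qed
  moreover have "gradient (x n) y = 0" if "y \<notin> U" for n y
    using xC[of n] that by (elim C1cE) blast
  ultimately obtain r G where G: "G \<in> borel_measurable borel" "\<forall>y. y \<notin> U \<longrightarrow> G y = 0"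
      "integrable lborel (\<lambda>y. (norm (G y))\<^sup>2)" "(\<lambda>n. LINT y|lborel. (norm (gradient (x n) y - G y))\<^sup>2) \<longlonglongrightarrow> 0"
    using L2_cauchy_limit[of U "\<lambda>n. gradient (x n)", OF U C1c_borel_measurable(2)[OF xC] C1c_integrable(4)[OF xC]] by blast
  have IG: "(LINT y|lborel. (norm (G y))\<^sup>2) = e0"
    by (rule L2_limit_norm[where s="\<lambda>n. gradient (x n)"])
       (use G C1c_borel_measurable(2)[OF xC] C1c_integrable(4)[OF xC] Ex in \<open>simp_all add: energy_def\<close>)
  have dist: "\<exists>L. \<forall>l\<ge>L. \<forall>f\<in>H l. (LINT y|lborel. (f y - u y)\<^sup>2) \<le> \<eta>" if \<eta>: "0 < \<eta>" for \<eta>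
  proof -
    obtain L where L: "\<forall>k\<ge>L. (LINT y|lborel. (v k y - u y)\<^sup>2) < \<eta>"
      using LIMSEQ_D[OF lim \<eta>] by auto
    have "(LINT y|lborel. (f y - u y)\<^sup>2) \<le> \<eta>" if "l \<ge> L" "f \<in> H l" for l f
      by (rule function_hull_distance[OF that(2)[unfolded H_def] v u])
         (use L that(1) in \<open>auto intro: less_imp_le\<close>)
    then show ?thesis by blast
  qed
  have xu: "(\<lambda>n. LINT y|lborel. (x n y - u y)\<^sup>2) \<longlonglongrightarrow> 0"
  proof (rule LIMSEQ_I)
    fix \<eta> :: real assume "0 < \<eta>"
    then obtain L where L: "\<forall>l\<ge>L. \<forall>f\<in>H l. (LINT y|lborel. (f y - u y)\<^sup>2) \<le> \<eta> / 2" using dist[of "\<eta>/2"] by auto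
    have "norm ((LINT y|lborel. (x n y - u y)\<^sup>2) - 0) < \<eta>" if "n \<ge> L" for n
    proof -
      have "(LINT y|lborel. (x n y - u y)\<^sup>2) \<le> \<eta> / 2" using L that x(1) by blast
      moreover have "0 \<le> (LINT y|lborel. (x n y - u y)\<^sup>2)" by simp
      ultimately show ?thesis using \<open>0 < \<eta>\<close> by simp
    qed
    then show "\<exists>no. \<forall>n\<ge>no. norm ((LINT y|lborel. (x n y - u y)\<^sup>2) - 0) < \<eta>" by blast
  qed
  have "\<exists>l. \<forall>\<^sub>F m in sequentially. energy (\<lambda>y. v m y - x l y) \<le> (\<mu>0 - e0 + 3 * \<eta>) / (1 - \<eta>) \<and> sqnorm (\<lambda>y. v m y - x l y) \<le> \<eta>"
    if \<eta>: "0 < \<eta>" "\<eta> < 1" for \<eta>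
  proof -
    obtain L where L: "\<forall>l\<ge>L. \<forall>f\<in>H l. (LINT y|lborel. (f y - u y)\<^sup>2) \<le> \<eta> / 4" using dist[of "\<eta>/4"] \<eta> by auto
    have "\<forall>\<^sub>F n in sequentially. 1 / real (Suc n) < \<eta> * \<eta>"
      by (rule order_tendstoD(2)[OF L0]) (use \<eta> in simp)
    moreover have "\<forall>\<^sub>F n in sequentially. e0 - \<eta> < e n"
      by (rule order_tendstoD(1)[OF e0(1)]) (use \<eta> in simp)
    moreover have "\<forall>\<^sub>F n in sequentially. L \<le> n" by (rule eventually_ge_at_top)
    ultimately have "\<forall>\<^sub>F n in sequentially. 1 / real (Suc n) < \<eta> * \<eta> \<and> e0 - \<eta> < e n \<and> L \<le> n" by eventually_elim simp
    \<comment> \<open>The defect of \<open>x l\<close> from minimality has to be of order \<eta>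
      squared, because the segment inequality below is divided by \<eta>.\<close>
    then obtain l where l: "1 / real (Suc l) < \<eta> * \<eta>" "e0 - \<eta> < e l" "L \<le> l"
      by (auto simp: eventually_sequentially)
    have "\<forall>\<^sub>F m in sequentially. energy (v m) < \<mu>0 + \<eta>"
      by (rule order_tendstoD(2)[OF Ev]) (use \<eta> in simp)
    moreover have "\<forall>\<^sub>F m in sequentially. l \<le> m" by (rule eventually_ge_at_top)
    ultimately have "\<forall>\<^sub>F m in sequentially. energy (\<lambda>y. v m y - x l y) \<le> (\<mu>0 - e0 + 3 * \<eta>) / (1 - \<eta>) \<and> sqnorm (\<lambda>y. v m y - x l y) \<le> \<eta>"
    proof eventually_elim
      case (elim m)
      have vm: "v m \<in> H l" using vH[OF elim(2)] .
      have sw: "energy (\<lambda>y. x l y - v m y) = energy (\<lambda>y. v m y - x l y)"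
        unfolding energy_def gradient_diff[OF xC test_functions_C1c[OF v]] gradient_diff[OF test_functions_C1c[OF v] xC]
        by (simp add: norm_minus_commute)
      \<comment> \<open>This is a small step of size \<eta> from \<open>x l\<close> towards
        \<open>v m\<close>. Near-minimality of \<open>x l\<close> acts as first-order optimality,
        giving asymptotically the splitting that weak convergence would give: energy of the
        difference at most the difference of the energies.\<close>
      have "\<eta> * (1 - \<eta>) * energy (\<lambda>y. x l y - v m y) \<le> (1 - \<eta>) * energy (x l) + \<eta> * energy (v m) - e l"
        by (rule seg[OF x(1) vm]) (use \<eta> in auto)
      also have "\<dots> \<le> \<eta> * (energy (v m) - energy (x l)) + 1 / real (Suc l)"
        using x(2)[of l] by (simp add: algebra_simps)
      also have "\<dots> \<le> \<eta> * (\<mu>0 + \<eta> - (e0 - \<eta>)) + \<eta> * \<eta>"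
      proof (intro add_mono mult_left_mono)
        show "energy (v m) - energy (x l) \<le> \<mu>0 + \<eta> - (e0 - \<eta>)" using elim(1) l(2) ele[OF x(1), of l] by linarith
      qed (use l \<eta> in auto)
      also have "\<dots> = \<eta> * (\<mu>0 - e0 + 3 * \<eta>)" by (simp add: algebra_simps)
      finally have "\<eta> * ((1 - \<eta>) * energy (\<lambda>y. v m y - x l y)) \<le> \<eta> * (\<mu>0 - e0 + 3 * \<eta>)"
        by (simp add: sw mult.assoc)
      then have "(1 - \<eta>) * energy (\<lambda>y. v m y - x l y) \<le> \<mu>0 - e0 + 3 * \<eta>"
        using \<eta>(1) by (simp only: mult_le_cancel_left_pos)
      then have 1: "energy (\<lambda>y. v m y - x l y) \<le> (\<mu>0 - e0 + 3 * \<eta>) / (1 - \<eta>)"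
        using \<eta> by (simp add: pos_le_divide_eq mult.commute)
      have iu: "integrable lborel (\<lambda>y. (f y - u y)\<^sup>2)" if "f \<in> H l" for f
        by (rule integrable_diff_square) (use u C1c_borel_measurable[OF HC[OF that]] C1c_integrable(3)[OF HC[OF that]] in auto)
      have "sqnorm (\<lambda>y. v m y - x l y) \<le> (LINT y|lborel. 2 * (v m y - u y)\<^sup>2 + 2 * (x l y - u y)\<^sup>2)"
        unfolding sqnorm_def
      proof (rule integral_mono)
        show "integrable lborel (\<lambda>y. (v m y - x l y)\<^sup>2)" by (rule C1c_integrable(3)[OF C1c_diff[OF HC[OF vm] xC]])
        show "integrable lborel (\<lambda>y. 2 * (v m y - u y)\<^sup>2 + 2 * (x l y - u y)\<^sup>2)" using iu[OF vm] iu[OF x(1)] by simp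
        show "(v m y - x l y)\<^sup>2 \<le> 2 * (v m y - u y)\<^sup>2 + 2 * (x l y - u y)\<^sup>2" for y
          using norm_diff_square_le[of "v m y - u y" "x l y - u y"] by simp
      qed
      also have "\<dots> = 2 * (LINT y|lborel. (v m y - u y)\<^sup>2) + 2 * (LINT y|lborel. (x l y - u y)\<^sup>2)"
        using iu[OF vm] iu[OF x(1)] by simp
      also have "\<dots> \<le> \<eta>"
      proof -
        have "(LINT y|lborel. (v m y - u y)\<^sup>2) \<le> \<eta> / 4" "(LINT y|lborel. (x l y - u y)\<^sup>2) \<le> \<eta> / 4"
          using L l(3) vm x(1) by blast+
        then show ?thesis by linarith
      qed
      finally show ?case using 1 by blast
    qed
    then show ?thesis by blast
  qed
  then show ?thesis
    using HT[OF x(1)] G xu Ex e0\<mu> unfolding IG by (intro exI[of _ x] exI[of _ G]) (auto simp: IG)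
qed

text \<open>Convexity with weights \<open>1 - l\<close> and \<open>l\<close> applied to
  \<open>\<bar>a - b\<bar>\<close> and \<open>\<bar>b\<bar>\<close>. As \<open>l\<close> tends to 0
  the first coefficient tends to 1, which is the side on which the splitting of \<Phi> has to be
  sharp.\<close>

lemma abs_powr_le_split:
  fixes a b l p :: real
  assumes "1 \<le> p" "0 < l" "l < 1"
  shows "\<bar>a\<bar> powr p \<le> ((1 - l) / (1 - l) powr p) * \<bar>a - b\<bar> powr p + (l / l powr p) * \<bar>b\<bar> powr p"
proof -
  have "\<bar>a\<bar> powr p \<le> (\<bar>a - b\<bar> + \<bar>b\<bar>) powr p" using assms by (intro powr_mono2) auto
  also have "\<bar>a - b\<bar> + \<bar>b\<bar> = (1 - l) *\<^sub>R (\<bar>a - b\<bar> / (1 - l)) + l *\<^sub>R (\<bar>b\<bar> / l)" using assms by simp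
  also have "\<dots> powr p \<le> (1 - l) * (\<bar>a - b\<bar> / (1 - l)) powr p + l * (\<bar>b\<bar> / l) powr p"
    by (rule convex_onD[OF powr_convex_nonneg[OF assms(1)]]) (use assms in auto)
  also have "\<dots> = ((1 - l) / (1 - l) powr p) * \<bar>a - b\<bar> powr p + (l / l powr p) * \<bar>b\<bar> powr p"
    using assms by (simp add: powr_divide)
  finally show ?thesis .
qed

lemma minimizer_exists:
  fixes U :: "'a::euclidean_space set" and w :: "'a \<Rightarrow> real"
  assumes U: "bounded U" and w: "continuous_on U w" "\<And>x. 0 \<le> w x" and wm[measurable]: "w \<in> borel_measurable borel"
    and q: "1 \<le> q" and \<mu>0: "0 \<le> \<mu>0"
    and low: "\<And>g. g \<in> test_functions U \<Longrightarrow> \<mu>0 * weighted_power w (2 * q) g powr (1 / q) \<le> energy g"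
    and v0: "\<And>k. v0 k \<in> test_functions U" "\<And>k. weighted_power w (2 * q) (v0 k) = 1" "(\<lambda>k. energy (v0 k)) \<longlonglongrightarrow> \<mu>0"
    and \<kappa>: "\<mu>0 < \<kappa>" and C: "0 \<le> C"
    and glob: "\<And>g. g \<in> test_functions U \<Longrightarrow> \<kappa> * weighted_power w (2 * q) g powr (1 / q) \<le> energy g + C * sqnorm g"
  shows "\<exists>u G x. u \<in> borel_measurable borel \<and> (\<forall>y. y \<notin> U \<longrightarrow> u y = 0) \<and> integrable lborel (\<lambda>y. (u y)\<^sup>2) \<and>
    G \<in> borel_measurable borel \<and> (\<forall>y. y \<notin> U \<longrightarrow> G y = 0) \<and> integrable lborel (\<lambda>y. (norm (G y))\<^sup>2) \<and>
    (\<forall>n::nat. x n \<in> test_functions U) \<and> (\<lambda>n. LINT y|lborel. (x n y - u y)\<^sup>2) \<longlonglongrightarrow> 0 \<and>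
    (\<lambda>n. LINT y|lborel. (norm (gradient (x n) y - G y))\<^sup>2) \<longlonglongrightarrow> 0 \<and>
    integrable lborel (\<lambda>y. w y * \<bar>u y\<bar> powr (2 * q)) \<and> weighted_power w (2 * q) u = 1 \<and>
    (LINT y|lborel. (norm (G y))\<^sup>2) = \<mu>0"
proof -
  define p where "p = 2 * q"
  have p: "0 < p" "1 \<le> p" using q by (auto simp: p_def)
  have TC: "g \<in> C1c U" if "g \<in> test_functions U" for g using that by (rule test_functions_C1c)
  obtain M where M: "\<And>k. energy (v0 k) \<le> M"
  proof -
    have "Bseq (\<lambda>k. energy (v0 k))" using v0(3) by (intro convergent_imp_Bseq) (auto simp: convergent_def)
    then obtain M where "\<forall>k. norm (energy (v0 k)) \<le> M" by (auto simp: Bseq_def)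
    then show ?thesis using that by (metis abs_ge_self order_trans real_norm_def)
  qed
  \<comment> \<open>A first subsequence is Cauchy in \<open>L^2\<close> by Rellich; a second one
    also converges almost everywhere, as Fatou requires.\<close>
  have "\<exists>r. strict_mono (r :: nat \<Rightarrow> nat) \<and> (\<forall>e>0. \<exists>N. \<forall>i\<ge>N. \<forall>j\<ge>N. sqnorm (\<lambda>x. v0 (r i) x - v0 (r j) x) < e)"
    by (rule rellich[OF U TC[OF v0(1)] M])
  then obtain r :: "nat \<Rightarrow> nat" where r: "strict_mono r"
    "\<forall>e>0. \<exists>N. \<forall>i\<ge>N. \<forall>j\<ge>N. sqnorm (\<lambda>x. v0 (r i) x - v0 (r j) x) < e"
    by (elim exE conjE)
  have z0: "v0 k y = 0" if "y \<notin> U" for k y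
    using TC[OF v0(1)[of k]] that by (elim C1cE) blast
  have "\<exists>r' u. strict_mono (r' :: nat \<Rightarrow> nat) \<and> u \<in> borel_measurable borel \<and> (\<forall>x. x \<notin> U \<longrightarrow> u x = 0) \<and>
    (AE x in lborel. (\<lambda>i. v0 (r (r' i)) x) \<longlonglongrightarrow> u x) \<and> integrable lborel (\<lambda>x. (norm (u x))\<^sup>2) \<and>
    (\<lambda>n. LINT x|lborel. (norm (v0 (r n) x - u x))\<^sup>2) \<longlonglongrightarrow> 0"
  proof (rule L2_cauchy_limit[OF U])
    show "v0 (r n) \<in> borel_measurable borel" for n by (rule C1c_borel_measurable(1)[OF TC[OF v0(1)]])
    show "integrable lborel (\<lambda>x. (norm (v0 (r n) x))\<^sup>2)" for n using C1c_integrable(3)[OF TC[OF v0(1)]] by simp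
    show "v0 (r n) x = 0" if "x \<notin> U" for n x by (rule z0[OF that])
    show "\<exists>N. \<forall>i\<ge>N. \<forall>j\<ge>N. (LINT x|lborel. (norm (v0 (r i) x - v0 (r j) x))\<^sup>2) < e" if "0 < e" for e
      using r(2) that by (simp add: sqnorm_def)
  qed
  then obtain r' u where r': "strict_mono (r' :: nat \<Rightarrow> nat)" and um[measurable]: "u \<in> borel_measurable borel"
    and uz: "\<forall>x. x \<notin> U \<longrightarrow> u x = 0" and ae: "AE x in lborel. (\<lambda>i. v0 (r (r' i)) x) \<longlonglongrightarrow> u x"
    and u2: "integrable lborel (\<lambda>x. (u x)\<^sup>2)" and ulim: "(\<lambda>n. LINT x|lborel. (v0 (r n) x - u x)\<^sup>2) \<longlonglongrightarrow> 0"
    by auto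
  define v where "v k = v0 (r (r' k))" for k
  have vT: "v k \<in> test_functions U" and vP: "weighted_power w p (v k) = 1" for k
    using v0 by (auto simp: v_def p_def)
  have vm[measurable]: "v k \<in> borel_measurable borel" for k by (rule C1c_borel_measurable(1)[OF TC[OF vT]])
  have Ev: "(\<lambda>k. energy (v k)) \<longlonglongrightarrow> \<mu>0"
    using LIMSEQ_subseq_LIMSEQ[OF v0(3) strict_mono_o[OF r(1) r']] by (simp add: v_def comp_def)
  have vlim: "(\<lambda>k. LINT x|lborel. (v k x - u x)\<^sup>2) \<longlonglongrightarrow> 0"
    using LIMSEQ_subseq_LIMSEQ[OF ulim r'] by (simp add: v_def comp_def)
  have vae: "AE x in lborel. (\<lambda>i. v i x) \<longlonglongrightarrow> u x" using ae by (simp add: v_def)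
  have iw: "integrable lborel (\<lambda>x. w x * \<bar>g x\<bar> powr p)" if "g \<in> test_functions U" for g
    by (rule C1c_integrable_weighted[OF TC[OF that] w(1) p(1)])
  obtain x G where x: "\<And>n. x n \<in> test_functions U" and G: "G \<in> borel_measurable borel" "\<forall>y. y \<notin> U \<longrightarrow> G y = 0"
    "integrable lborel (\<lambda>y. (norm (G y))\<^sup>2)" "(\<lambda>n. LINT y|lborel. (norm (gradient (x n) y - G y))\<^sup>2) \<longlonglongrightarrow> 0"
    and xu: "(\<lambda>n. LINT y|lborel. (x n y - u y)\<^sup>2) \<longlonglongrightarrow> 0" and Ex: "(\<lambda>n. energy (x n)) \<longlonglongrightarrow> (LINT y|lborel. (norm (G y))\<^sup>2)"
    and G\<mu>: "(LINT y|lborel. (norm (G y))\<^sup>2) \<le> \<mu>0"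
    and near: "\<And>\<eta>. 0 < \<eta> \<Longrightarrow> \<eta> < 1 \<Longrightarrow> \<exists>l. \<forall>\<^sub>F m in sequentially.
       energy (\<lambda>y. v m y - x l y) \<le> (\<mu>0 - (LINT y|lborel. (norm (G y))\<^sup>2) + 3 * \<eta>) / (1 - \<eta>) \<and>
       sqnorm (\<lambda>y. v m y - x l y) \<le> \<eta>"
    using convexified_limit[OF U vT Ev um u2 vlim] by blast
  define e0 where "e0 = (LINT y|lborel. (norm (G y))\<^sup>2)"
  have e00: "0 \<le> e0" by (simp add: e0_def)
  have xm[measurable]: "x n \<in> borel_measurable borel" for n by (rule C1c_borel_measurable(1)[OF TC[OF x]])
  define \<theta> where "\<theta> = weighted_power w p u"
  have m_wu: "(\<lambda>y. w y * \<bar>u y\<bar> powr p) \<in> borel_measurable lborel" by measurable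
  have powr_lim: "(\<lambda>n. w y * \<bar>f n\<bar> powr p) \<longlonglongrightarrow> w y * \<bar>c\<bar> powr p" if "f \<longlonglongrightarrow> c" for f c y
    by (rule tendsto_mult_left, rule tendsto_powr2) (use that p in \<open>auto intro: tendsto_rabs\<close>)
  have iu: "integrable lborel (\<lambda>y. w y * \<bar>u y\<bar> powr p)" and \<theta>1: "\<theta> \<le> 1"
  proof -
    have l: "AE y in lborel. (\<lambda>n. w y * \<bar>v n y\<bar> powr p) \<longlonglongrightarrow> w y * \<bar>u y\<bar> powr p"
      using vae by eventually_elim (rule powr_lim)
    have b: "\<forall>\<^sub>F n in sequentially. (LINT y|lborel. w y * \<bar>v n y\<bar> powr p) \<le> 1"
      using vP by (simp add: weighted_power_def)
    note F = fatou_real[where f="\<lambda>n y. w y * \<bar>v n y\<bar> powr p", OF iw[OF vT] _ m_wu l b]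
    show "integrable lborel (\<lambda>y. w y * \<bar>u y\<bar> powr p)" by (rule F) (simp add: w(2))
    show "\<theta> \<le> 1" unfolding \<theta>_def weighted_power_def by (rule F) (simp add: w(2))
  qed
  have \<theta>0: "0 \<le> \<theta>" unfolding \<theta>_def by (rule weighted_power_nonneg[OF w(2)])
  \<comment> \<open>\<open>u\<close> is only a limit, so \<open>low\<close> is applied to the
    approximants and Fatou passes to the limit. Their energies are eventually below
    \<open>e0 + \<eta>\<close>; the bound for \<theta> divides by \<mu>0, hence the separate case
    \<open>\<mu>0 = 0\<close>.\<close>
  have low_u: "\<mu>0 * \<theta> powr (1 / q) \<le> e0"
  proof (cases "\<mu>0 = 0")
    case True
    then show ?thesis using e00 by simp
  next
    case False
    then have \<mu>p: "0 < \<mu>0" using \<mu>0 by simp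
    have i: "integrable lborel (\<lambda>y. (x n y - u y)\<^sup>2)" for n
      by (rule integrable_diff_square) (use u2 C1c_integrable(3)[OF TC[OF x]] in auto)
    have "(\<lambda>n. LINT y|lborel. norm ((x n y - u y)\<^sup>2)) \<longlonglongrightarrow> 0" using xu by simp
    from tendsto_L1_AE_subseq[OF i this] obtain k where k: "strict_mono k"
      "AE y in lborel. (\<lambda>n. (x (k n) y - u y)\<^sup>2) \<longlonglongrightarrow> 0" by blast
    have l: "AE y in lborel. (\<lambda>n. w y * \<bar>x (k n) y\<bar> powr p) \<longlonglongrightarrow> w y * \<bar>u y\<bar> powr p"
      using k(2)
    proof eventually_elim
      case (elim y)
      have "(\<lambda>n. sqrt ((x (k n) y - u y)\<^sup>2)) \<longlonglongrightarrow> sqrt 0" by (rule tendsto_real_sqrt[OF elim])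
      then have "(\<lambda>n. x (k n) y - u y) \<longlonglongrightarrow> 0" by (simp add: tendsto_rabs_zero_iff)
      then show ?case by (intro powr_lim) (simp add: LIM_zero_iff)
    qed
    have bound: "\<theta> \<le> ((e0 + \<eta>) / \<mu>0) powr q" if \<eta>: "0 < \<eta>" for \<eta>
    proof -
      have "\<forall>\<^sub>F n in sequentially. energy (x (k n)) < e0 + \<eta>"
        using LIMSEQ_subseq_LIMSEQ[OF Ex k(1)] \<eta> by (intro order_tendstoD(2)) (auto simp: comp_def e0_def)
      then have b: "\<forall>\<^sub>F n in sequentially. (LINT y|lborel. w y * \<bar>x (k n) y\<bar> powr p) \<le> ((e0 + \<eta>) / \<mu>0) powr q"
      proof eventually_elim
        case (elim n)
        let ?P = "weighted_power w p (x (k n))"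
        have P0: "0 \<le> ?P" by (rule weighted_power_nonneg[OF w(2)])
        have "\<mu>0 * ?P powr (1 / q) \<le> e0 + \<eta>" using low[OF x[of "k n"]] elim by (simp add: p_def)
        then have "?P powr (1 / q) \<le> (e0 + \<eta>) / \<mu>0" using \<mu>p by (simp add: pos_le_divide_eq mult.commute)
        then have "(?P powr (1 / q)) powr q \<le> ((e0 + \<eta>) / \<mu>0) powr q" using q by (intro powr_mono2) auto
        then show ?case using P0 q by (simp add: powr_powr weighted_power_def)
      qed
      note F = fatou_real[where f="\<lambda>n y. w y * \<bar>x (k n) y\<bar> powr p", OF iw[OF x] _ m_wu l b]
      show ?thesis unfolding \<theta>_def weighted_power_def by (rule F) (simp add: w(2))
    qed
    have eps: "\<mu>0 * \<theta> powr (1 / q) \<le> e0 + \<eta>" if \<eta>: "0 < \<eta>" for \<eta>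
    proof -
      have "\<theta> powr (1 / q) \<le> (((e0 + \<eta>) / \<mu>0) powr q) powr (1 / q)"
        using bound[OF \<eta>] \<theta>0 q by (intro powr_mono2) auto
      also have "\<dots> = (e0 + \<eta>) / \<mu>0" using q e00 \<eta> \<mu>p by (simp add: powr_powr)
      finally show ?thesis using \<mu>p by (simp add: pos_le_divide_eq mult.commute)
    qed
    show ?thesis by (rule field_le_epsilon) (rule eps)
  qed
  have gap: "\<kappa> * (1 - \<theta>) powr (1 / q) \<le> \<mu>0 - e0"
  proof -
    have \<kappa>p: "0 < \<kappa>" using \<kappa> \<mu>0 by simp
    have step: "\<kappa> * (1 - \<theta>) powr (1 / q) \<le> (\<mu>0 - e0 + 3 * \<eta>) / (1 - \<eta>) + C * \<eta>" if \<eta>: "0 < \<eta>" "\<eta> < 1" for \<eta>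
    proof -
      \<comment> \<open>\<open>Q\<close> bounds the right side of \<open>glob\<close> for
        \<open>v m - x l\<close>, and \<open>P\<close> the resulting weighted integral, for fixed
        \<open>l\<close> and all large \<open>m\<close>.\<close>
      define Q where "Q = (\<mu>0 - e0 + 3 * \<eta>) / (1 - \<eta>) + C * \<eta>"
      have Q0: "0 \<le> Q" using \<eta> G\<mu> C by (auto simp: Q_def e0_def intro!: add_nonneg_nonneg divide_nonneg_pos)
      define P where "P = (Q / \<kappa>) powr q"
      obtain l where l: "\<forall>\<^sub>F m in sequentially.
         energy (\<lambda>y. v m y - x l y) \<le> (\<mu>0 - e0 + 3 * \<eta>) / (1 - \<eta>) \<and> sqnorm (\<lambda>y. v m y - x l y) \<le> \<eta>"
        using near[OF \<eta>] unfolding e0_def by blast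
      have dT: "(\<lambda>y. v m y - x l y) \<in> test_functions U" for m by (rule test_functions_diff[OF vT x])
      have evP: "\<forall>\<^sub>F m in sequentially. weighted_power w p (\<lambda>y. v m y - x l y) \<le> P"
        using l
      proof eventually_elim
        case (elim m)
        let ?P = "weighted_power w p (\<lambda>y. v m y - x l y)"
        have P0: "0 \<le> ?P" by (rule weighted_power_nonneg[OF w(2)])
        have "\<kappa> * ?P powr (1 / q) \<le> energy (\<lambda>y. v m y - x l y) + C * sqnorm (\<lambda>y. v m y - x l y)"
          using glob[OF dT] by (simp add: p_def)
        also have "\<dots> \<le> Q" unfolding Q_def using elim C by (intro add_mono mult_left_mono) auto
        finally have "?P powr (1 / q) \<le> Q / \<kappa>" using \<kappa>p by (simp add: pos_le_divide_eq mult.commute)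
        then have "(?P powr (1 / q)) powr q \<le> (Q / \<kappa>) powr q" using q by (intro powr_mono2) auto
        then show ?case using P0 q by (simp add: powr_powr P_def)
      qed
      have split: "1 - \<theta> \<le> ((1 - lam) / (1 - lam) powr p) * P" if lam: "0 < lam" "lam < 1" for lam
      proof -
        define a where "a = (1 - lam) / (1 - lam) powr p"
        define b where "b = lam / lam powr p"
        have a0: "0 \<le> a" using lam by (simp add: a_def)
        \<comment> \<open>Nonnegative by the convex splitting, so Fatou applies as \<open>m\<close>
          grows. In the limit \<open>F'\<close> the first term is dropped as nonnegative, and the
          contribution of \<open>x l\<close> occurs on both sides and cancels, which leaves
          \<open>1 - \<theta> \<le> a * P\<close>.\<close>
        define F where "F m y = a * (w y * \<bar>v m y - x l y\<bar> powr p) + b * (w y * \<bar>x l y\<bar> powr p) - w y * \<bar>v m y\<bar> powr p" for m y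
        define F' where "F' y = a * (w y * \<bar>u y - x l y\<bar> powr p) + b * (w y * \<bar>x l y\<bar> powr p) - w y * \<bar>u y\<bar> powr p" for y
        have iF: "integrable lborel (F m)" for m
          unfolding F_def using iw[OF dT] iw[OF x] iw[OF vT]
          by (intro Bochner_Integration.integrable_diff Bochner_Integration.integrable_add integrable_mult_right) auto
        have F0: "0 \<le> F m y" for m y
        proof -
          have "w y * \<bar>v m y\<bar> powr p \<le> w y * (a * \<bar>v m y - x l y\<bar> powr p + b * \<bar>x l y\<bar> powr p)"
            unfolding a_def b_def by (intro mult_left_mono abs_powr_le_split p lam w)
          then show ?thesis by (simp add: F_def algebra_simps)
        qed
        have lF: "AE y in lborel. (\<lambda>m. F m y) \<longlonglongrightarrow> F' y"
          using vae
        proof eventually_elim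
          case (elim y)
          have "(\<lambda>m. v m y - x l y) \<longlonglongrightarrow> u y - x l y" by (intro tendsto_intros elim)
          note L = powr_lim[OF this, of y] powr_lim[OF elim, of y]
          show ?case unfolding F_def F'_def
            by (rule tendsto_diff[OF tendsto_add[OF tendsto_mult_left[OF L(1)] tendsto_const] L(2)])
        qed
        have IF: "integral\<^sup>L lborel (F m) = a * weighted_power w p (\<lambda>y. v m y - x l y) + b * weighted_power w p (x l) - 1" for m
          unfolding F_def[abs_def] weighted_power_def vP[of m, unfolded weighted_power_def, symmetric]
          using iw[OF dT[of m]] iw[OF x[of l]] iw[OF vT[of m]] by simp
        have bF: "\<forall>\<^sub>F m in sequentially. integral\<^sup>L lborel (F m) \<le> a * P + b * weighted_power w p (x l) - 1"
          using evP by eventually_elim (simp add: IF mult_left_mono a0)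
        have mF: "F' \<in> borel_measurable lborel" unfolding F'_def[abs_def] by measurable
        note Fat = fatou_real[OF iF F0 mF lF bF]
        have "b * weighted_power w p (x l) - \<theta> = (LINT y|lborel. b * (w y * \<bar>x l y\<bar> powr p) - w y * \<bar>u y\<bar> powr p)"
          unfolding weighted_power_def \<theta>_def using iw[OF x[of l]] iu by simp
        also have "\<dots> \<le> integral\<^sup>L lborel F'"
        proof (rule integral_mono)
          show "integrable lborel (\<lambda>y. b * (w y * \<bar>x l y\<bar> powr p) - w y * \<bar>u y\<bar> powr p)"
            using iw[OF x[of l]] iu by simp
          show "b * (w y * \<bar>x l y\<bar> powr p) - w y * \<bar>u y\<bar> powr p \<le> F' y" for y
            using a0 w(2)[of y] by (simp add: F'_def)
        qed (rule Fat(1))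
        also have "\<dots> \<le> a * P + b * weighted_power w p (x l) - 1" by (rule Fat(2))
        finally show ?thesis by (simp add: a_def)
      qed
      \<comment> \<open>Only now does \<open>lam\<close> tend to 0: the coefficient
        \<open>lam / lam powr p\<close> may blow up, but it has already cancelled, and the remaining
        factor tends to 1.\<close>
      have lim: "((\<lambda>lam. ((1 - lam) / (1 - lam) powr p) * P) \<longlongrightarrow> ((1 - 0) / (1 - 0) powr p) * P) (at_right (0::real))"
        by (intro tendsto_intros) auto
      have "1 - \<theta> \<le> ((1 - 0) / (1 - 0) powr p) * P"
      proof (rule tendsto_lowerbound[OF lim])
        show "\<forall>\<^sub>F lam in at_right 0. 1 - \<theta> \<le> ((1 - lam) / (1 - lam) powr p) * P"
          using eventually_at_right_real[of 0 1] by (rule eventually_mono) (simp_all only: greaterThanLessThan_iff split simp_thms zero_less_one)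
      qed simp
      then have "1 - \<theta> \<le> P" by simp
      then have "(1 - \<theta>) powr (1 / q) \<le> P powr (1 / q)" using \<theta>1 q by (intro powr_mono2) auto
      also have "\<dots> = Q / \<kappa>" using q Q0 \<kappa>p by (simp add: P_def powr_powr)
      finally show ?thesis using \<kappa>p by (simp add: pos_le_divide_eq mult.commute Q_def)
    qed
    have lim: "((\<lambda>\<eta>. (\<mu>0 - e0 + 3 * \<eta>) / (1 - \<eta>) + C * \<eta>) \<longlongrightarrow> (\<mu>0 - e0 + 3 * 0) / (1 - 0) + C * 0) (at_right (0::real))"
      by (intro tendsto_intros) auto
    have "\<kappa> * (1 - \<theta>) powr (1 / q) \<le> (\<mu>0 - e0 + 3 * 0) / (1 - 0) + C * 0"
    proof (rule tendsto_lowerbound[OF lim])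
      show "\<forall>\<^sub>F \<eta> in at_right 0. \<kappa> * (1 - \<theta>) powr (1 / q) \<le> (\<mu>0 - e0 + 3 * \<eta>) / (1 - \<eta>) + C * \<eta>"
        using eventually_at_right_real[of 0 1] by (rule eventually_mono) (simp_all only: greaterThanLessThan_iff step simp_thms zero_less_one)
    qed simp
    then show ?thesis by simp
  qed
  have \<theta>_eq: "\<theta> = 1"
  proof (rule ccontr)
    assume "\<theta> \<noteq> 1"
    then have t: "0 < 1 - \<theta>" using \<theta>1 by simp
    have ge: "y \<le> y powr (1 / q)" if "0 \<le> y" "y \<le> 1" for y :: real
    proof (cases "y = 0")
      case False
      then show ?thesis using that q powr_mono'[of "1/q" 1 y] by simp
    qed simp
    have "1 \<le> \<theta> powr (1 / q) + (1 - \<theta>) powr (1 / q)"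
      using ge[of \<theta>] ge[of "1 - \<theta>"] \<theta>0 \<theta>1 by simp
    then have "\<mu>0 * 1 \<le> \<mu>0 * (\<theta> powr (1 / q) + (1 - \<theta>) powr (1 / q))"
      by (rule mult_left_mono[OF _ \<mu>0])
    moreover have "\<mu>0 * (1 - \<theta>) powr (1 / q) < \<kappa> * (1 - \<theta>) powr (1 / q)"
      using t \<kappa> by (intro mult_strict_right_mono) auto
    ultimately show False using gap low_u by (simp add: distrib_left)
  qed
  have "e0 = \<mu>0" using low_u gap G\<mu> by (simp add: \<theta>_eq e0_def)
  then show ?thesis
    using um uz u2 G x xu iu \<theta>_eq unfolding e0_def \<theta>_def p_def by blast
qed

section \<open>Sobolev functions as limits of test functions\<close>

lemma integrable_lebesgue_on:
  fixes h :: "'a::euclidean_space \<Rightarrow> 'b::euclidean_space"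
  assumes "integrable lborel h" "K \<in> sets borel" shows "integrable (lebesgue_on K) h"
proof -
  have [measurable]: "h \<in> borel_measurable borel" using borel_measurable_integrable[OF assms(1)] by simp
  have "integrable lebesgue h" using assms(1) by (subst integrable_completion) auto
  then have "integrable lebesgue (\<lambda>x. indicator K x *\<^sub>R h x)"
    using assms(2) by (intro integrable_mult_indicator) auto
  then show ?thesis using assms(2) by (subst integrable_restrict_space) auto
qed

lemma L2_bounded_support_integrable:
  fixes f :: "'a::euclidean_space \<Rightarrow> 'b::euclidean_space"
  assumes [measurable]: "f \<in> borel_measurable borel" and U: "bounded U" "\<forall>x. x \<notin> U \<longrightarrow> f x = 0"
    and f2: "integrable lborel (\<lambda>x. (norm (f x))\<^sup>2)"
  shows "integrable lborel f"
proof -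
  obtain R where R: "U \<subseteq> cball 0 R"
    using bounded_subset_ballD[OF U(1), of 0] ball_subset_cball by blast
  have i: "integrable lborel (\<lambda>x. indicator (cball (0::'a) R) x *\<^sub>R (1::real))" by (intro borel_integrable_compact) auto
  show ?thesis
  proof (rule Bochner_Integration.integrable_bound)
    show "integrable lborel (\<lambda>x. indicator (cball (0::'a) R) x *\<^sub>R 1 + (norm (f x))\<^sup>2)"
      by (rule Bochner_Integration.integrable_add[OF i f2])
    show "AE x in lborel. norm (f x) \<le> norm (indicator (cball (0::'a) R) x *\<^sub>R 1 + (norm (f x))\<^sup>2)"
    proof (rule AE_I2)
      fix x
      show "norm (f x) \<le> norm (indicator (cball (0::'a) R) x *\<^sub>R 1 + (norm (f x))\<^sup>2)"
      proof (cases "x \<in> U")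
        case True
        then have "x \<in> cball 0 R" using R by blast
        then show ?thesis using abs_le_square[of 1 "norm (f x)"] by simp
      next
        case False
        then have "f x = 0" using U(2) by blast
        then show ?thesis by simp
      qed
    qed
  qed measurable
qed

lemma abs_mult_le_squares:
  fixes a b \<epsilon> :: real assumes "0 < \<epsilon>" shows "\<bar>a * b\<bar> \<le> a\<^sup>2 / \<epsilon> + \<epsilon> * b\<^sup>2"
proof -
  have "0 \<le> (\<bar>a\<bar> - \<epsilon> * \<bar>b\<bar>)\<^sup>2" by simp
  then have "2 * \<epsilon> * (\<bar>a\<bar> * \<bar>b\<bar>) \<le> a\<^sup>2 + \<epsilon> * (\<epsilon> * b\<^sup>2)"
    by (simp add: power2_diff power_mult_distrib power2_eq_square algebra_simps)
  moreover have "0 \<le> \<epsilon> * (\<bar>a\<bar> * \<bar>b\<bar>)" using assms by simp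
  ultimately have "\<epsilon> * (\<bar>a\<bar> * \<bar>b\<bar>) \<le> a\<^sup>2 + \<epsilon> * (\<epsilon> * b\<^sup>2)" by linarith
  also have "\<dots> = \<epsilon> * (a\<^sup>2 / \<epsilon> + \<epsilon> * b\<^sup>2)" using assms by (simp add: distrib_left)
  finally have "\<epsilon> * (\<bar>a\<bar> * \<bar>b\<bar>) \<le> \<epsilon> * (a\<^sup>2 / \<epsilon> + \<epsilon> * b\<^sup>2)" .
  then show ?thesis using assms by (simp only: abs_mult mult_le_cancel_left_pos)
qed

lemma integrable_mult_L2:
  fixes f g :: "'a \<Rightarrow> real"
  assumes [measurable]: "f \<in> borel_measurable M" "g \<in> borel_measurable M"
    and "integrable M (\<lambda>x. (f x)\<^sup>2)" "integrable M (\<lambda>x. (g x)\<^sup>2)"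
  shows "integrable M (\<lambda>x. f x * g x)"
proof (rule Bochner_Integration.integrable_bound)
  show "integrable M (\<lambda>x. (f x)\<^sup>2 / 1 + 1 * (g x)\<^sup>2)" using assms by simp
  show "AE x in M. norm (f x * g x) \<le> norm ((f x)\<^sup>2 / 1 + 1 * (g x)\<^sup>2)"
    unfolding real_norm_def by (intro AE_I2 order_trans[OF abs_mult_le_squares abs_ge_self]) simp
qed measurable

text \<open>Strong convergence tested against a fixed square-integrable function; Young's inequality
  with a small \<epsilon> does the work of Cauchy-Schwarz.\<close>

lemma L2_limit_weak:
  fixes s :: "nat \<Rightarrow> 'a \<Rightarrow> real" and u \<psi> :: "'a \<Rightarrow> real"
  assumes m: "\<And>n. s n \<in> borel_measurable M" "u \<in> borel_measurable M" "\<psi> \<in> borel_measurable M"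
    and i: "\<And>n. integrable M (\<lambda>x. (s n x)\<^sup>2)" "integrable M (\<lambda>x. (u x)\<^sup>2)" "integrable M (\<lambda>x. (\<psi> x)\<^sup>2)"
    and lim: "(\<lambda>n. LINT x|M. (s n x - u x)\<^sup>2) \<longlonglongrightarrow> 0"
  shows "(\<lambda>n. LINT x|M. s n x * \<psi> x) \<longlonglongrightarrow> (LINT x|M. u x * \<psi> x)"
proof (rule LIMSEQ_I)
  fix d :: real assume d: "0 < d"
  define I where "I = (LINT x|M. (\<psi> x)\<^sup>2)"
  have I0: "0 \<le> I" by (simp add: I_def)
  \<comment> \<open>Adding 1 keeps the divisor positive when \<psi> vanishes almost everywhere, and
    makes \<open>\<epsilon> * I < d / 2\<close> strict.\<close>
  define X where "X = I + 1"
  define \<epsilon> where "\<epsilon> = d / 2 / X"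
  have X: "0 < X" using I0 by (simp add: X_def)
  have \<epsilon>: "0 < \<epsilon>" using d X by (simp add: \<epsilon>_def)
  have "\<epsilon> * I < \<epsilon> * X" using \<epsilon> by (simp add: X_def)
  also have "\<dots> = d / 2" using X by (simp add: \<epsilon>_def)
  finally have \<epsilon>I: "\<epsilon> * I < d / 2" .
  have id: "integrable M (\<lambda>x. (s n x - u x)\<^sup>2)" for n
    by (rule integrable_diff_square[OF m(1,2) i(1,2)])
  have im: "integrable M (\<lambda>x. (s n x - u x) * \<psi> x)" for n
    by (rule integrable_mult_L2[OF borel_measurable_diff[OF m(1,2)] m(3) id i(3)])
  have i1: "integrable M (\<lambda>x. s n x * \<psi> x)" "integrable M (\<lambda>x. u x * \<psi> x)" for n
    using integrable_mult_L2[OF m(1,3) i(1,3)] integrable_mult_L2[OF m(2,3) i(2,3)] by auto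
  obtain N where N: "\<forall>n\<ge>N. norm ((LINT x|M. (s n x - u x)\<^sup>2) - 0) < \<epsilon> * (d / 2)"
    using LIMSEQ_D[OF lim, of "\<epsilon> * (d / 2)"] \<epsilon> d by auto
  have "norm ((LINT x|M. s n x * \<psi> x) - (LINT x|M. u x * \<psi> x)) < d" if n: "n \<ge> N" for n
  proof -
    have "(LINT x|M. s n x * \<psi> x) - (LINT x|M. u x * \<psi> x) = (LINT x|M. (s n x - u x) * \<psi> x)"
      using i1 by (simp add: left_diff_distrib)
    also have "norm \<dots> \<le> (LINT x|M. norm ((s n x - u x) * \<psi> x))" by (rule integral_norm_bound)
    also have "\<dots> \<le> (LINT x|M. (s n x - u x)\<^sup>2 / \<epsilon> + \<epsilon> * (\<psi> x)\<^sup>2)"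
    proof (rule integral_mono)
      show "integrable M (\<lambda>x. norm ((s n x - u x) * \<psi> x))" by (rule integrable_norm[OF im])
      show "integrable M (\<lambda>x. (s n x - u x)\<^sup>2 / \<epsilon> + \<epsilon> * (\<psi> x)\<^sup>2)" using id i(3) by simp
      show "norm ((s n x - u x) * \<psi> x) \<le> (s n x - u x)\<^sup>2 / \<epsilon> + \<epsilon> * (\<psi> x)\<^sup>2" for x
        unfolding real_norm_def by (rule abs_mult_le_squares[OF \<epsilon>])
    qed
    also have "\<dots> = (LINT x|M. (s n x - u x)\<^sup>2) / \<epsilon> + \<epsilon> * I"
      using id i(3) by (simp add: I_def)
    also have "\<dots> < d / 2 + d / 2"
    proof (rule add_strict_mono[OF _ \<epsilon>I])
      have "(LINT x|M. (s n x - u x)\<^sup>2) < \<epsilon> * (d / 2)"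
        using N n abs_ge_self order_le_less_trans unfolding real_norm_def diff_zero by blast
      then show "(LINT x|M. (s n x - u x)\<^sup>2) / \<epsilon> < d / 2" using \<epsilon> by (simp add: pos_divide_less_eq mult.commute)
    qed
    finally show ?thesis by simp
  qed
  then show "\<exists>no. \<forall>n\<ge>no. norm ((LINT x|M. s n x * \<psi> x) - (LINT x|M. u x * \<psi> x)) < d" by blast
qed

text \<open>Integration by parts holds for each \<open>x n\<close>, and both of its sides pass to
  the \<open>L^2\<close> limit, which makes \<open>G\<close> a weak gradient of \<open>u\<close>.
  The same \<open>x n\<close> witness membership in the closure of the test functions.\<close>

lemma W12_0_limit:
  fixes U :: "'a::euclidean_space set" and u :: "'a \<Rightarrow> real" and x :: "nat \<Rightarrow> 'a \<Rightarrow> real"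
  assumes U: "open U" "bounded U"
    and um: "u \<in> borel_measurable borel" and uz: "\<forall>y. y \<notin> U \<longrightarrow> u y = 0" and u2: "integrable lborel (\<lambda>y. (u y)\<^sup>2)"
    and Gm: "G \<in> borel_measurable borel" and Gz: "\<forall>y. y \<notin> U \<longrightarrow> G y = 0" and G2: "integrable lborel (\<lambda>y. (norm (G y))\<^sup>2)"
    and x: "\<And>n. x n \<in> test_functions U" and xu: "(\<lambda>n. LINT y|lborel. (x n y - u y)\<^sup>2) \<longlonglongrightarrow> 0"
    and xG: "(\<lambda>n. LINT y|lborel. (norm (gradient (x n) y - G y))\<^sup>2) \<longlonglongrightarrow> 0"
  shows "u \<in> W12_0 U" and "has_weak_gradient U u G"
proof -
  note [measurable] = um Gm
  have Us: "U \<in> sets borel" using U(1) by simp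
  have xC: "x n \<in> C1c U" for n by (rule test_functions_C1c[OF x])
  note xm[measurable] = C1c_borel_measurable[OF xC]
  have xz: "x n y = 0" "gradient (x n) y = 0" if "y \<notin> U" for n y
    using xC[of n] that by (elim C1cE, blast)+
  have leb: "h \<in> borel_measurable (lebesgue_on U)" if "h \<in> borel_measurable borel" for h :: "'a \<Rightarrow> 'b::euclidean_space"
    using that by (intro measurable_restrict_space1 measurable_completion) simp
  have loc: "locally_integrable_on h U" if "integrable lborel h" for h :: "'a \<Rightarrow> 'b::euclidean_space"
    unfolding locally_integrable_on_def using integrable_lebesgue_on[OF that] borel_compact by blast
  have iu: "integrable lborel u" by (rule L2_bounded_support_integrable[OF um U(2) uz]) (use u2 in simp)
  have iG: "integrable lborel G" by (rule L2_bounded_support_integrable[OF Gm U(2) Gz G2])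
  have L2u: "L2_on U u"
    unfolding L2_on_def using leb[OF um] lebesgue_on_eq_lborel(2)[OF _ Us, of "\<lambda>y. (norm (u y))\<^sup>2"] u2 uz by simp
  have L2G: "L2_on U G"
    unfolding L2_on_def using leb[OF Gm] lebesgue_on_eq_lborel(2)[OF _ Us, of "\<lambda>y. (norm (G y))\<^sup>2"] G2 Gz by simp
  show wg: "has_weak_gradient U u G"
    unfolding has_weak_gradient_def
  proof (intro conjI ballI loc iu iG)
    fix \<phi> :: "'a \<Rightarrow> real" and i :: 'a assume \<phi>: "\<phi> \<in> test_functions U" and i: "i \<in> Basis"
    have \<phi>C: "\<phi> \<in> C1c U" by (rule test_functions_C1c[OF \<phi>])
    have \<phi>1: "Ck 1 \<phi>" using \<phi> by (simp add: test_functions_def del: Ck.simps)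
    note [measurable] = C1c_borel_measurable[OF \<phi>C]
    have nb: "(a \<bullet> i)\<^sup>2 \<le> (norm a)\<^sup>2" for a :: 'a
      using power_mono[OF Basis_le_norm[OF i, of a] abs_ge_zero, of 2] by simp
    have comp: "integrable lborel (\<lambda>y. (h y \<bullet> i)\<^sup>2)"
      if [measurable]: "h \<in> borel_measurable borel" and "integrable lborel (\<lambda>y. (norm (h y))\<^sup>2)" for h :: "'a \<Rightarrow> 'a"
      by (rule Bochner_Integration.integrable_bound[OF that(2)]) (auto simp: nb)
    have l1: "(\<lambda>n. LINT y|lborel. x n y * (gradient \<phi> y \<bullet> i)) \<longlonglongrightarrow> (LINT y|lborel. u y * (gradient \<phi> y \<bullet> i))"
      by (rule L2_limit_weak[OF _ _ _ C1c_integrable(3)[OF xC] u2 comp[OF _ C1c_integrable(4)[OF \<phi>C]] xu]) simp_all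
    have l2: "(\<lambda>n. LINT y|lborel. (gradient (x n) y \<bullet> i) * \<phi> y) \<longlonglongrightarrow> (LINT y|lborel. (G y \<bullet> i) * \<phi> y)"
    proof (rule L2_limit_weak[OF _ _ _ comp[OF _ C1c_integrable(4)[OF xC]] comp[OF Gm G2] C1c_integrable(3)[OF \<phi>C]])
      show "(\<lambda>n. LINT y|lborel. (gradient (x n) y \<bullet> i - G y \<bullet> i)\<^sup>2) \<longlonglongrightarrow> 0"
      proof (rule tendsto_sandwich[OF _ _ tendsto_const xG])
        show "\<forall>\<^sub>F n in sequentially. 0 \<le> (LINT y|lborel. (gradient (x n) y \<bullet> i - G y \<bullet> i)\<^sup>2)" by simp
        have id: "integrable lborel (\<lambda>y. (norm (gradient (x n) y - G y))\<^sup>2)" for n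
          by (rule integrable_norm_diff_square) (use G2 C1c_integrable(4)[OF xC] in simp_all)
        have "(LINT y|lborel. (gradient (x n) y \<bullet> i - G y \<bullet> i)\<^sup>2) \<le> (LINT y|lborel. (norm (gradient (x n) y - G y))\<^sup>2)" for n
        proof (rule integral_mono[OF _ id])
          show "integrable lborel (\<lambda>y. (gradient (x n) y \<bullet> i - G y \<bullet> i)\<^sup>2)"
            using comp[OF _ id[of n]] by (simp add: inner_diff_left)
          show "(gradient (x n) y \<bullet> i - G y \<bullet> i)\<^sup>2 \<le> (norm (gradient (x n) y - G y))\<^sup>2" for y
            using nb[of "gradient (x n) y - G y"] by (simp add: inner_diff_left)
        qed
        then show "\<forall>\<^sub>F n in sequentially. (LINT y|lborel. (gradient (x n) y \<bullet> i - G y \<bullet> i)\<^sup>2) \<le> (LINT y|lborel. (norm (gradient (x n) y - G y))\<^sup>2)"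
          by simp
      qed
    qed simp_all
    have "(\<lambda>n. LINT y|lborel. x n y * (gradient \<phi> y \<bullet> i)) = (\<lambda>n. - (LINT y|lborel. (gradient (x n) y \<bullet> i) * \<phi> y))"
      by (rule ext) (rule integration_by_parts[OF xC \<phi>1])
    then have "(LINT y|lborel. u y * (gradient \<phi> y \<bullet> i)) = - (LINT y|lborel. (G y \<bullet> i) * \<phi> y)"
      using LIMSEQ_unique[OF l1] tendsto_minus[OF l2] by simp
    moreover have "(LINT y|lebesgue_on U. u y * (gradient \<phi> y \<bullet> i)) = (LINT y|lborel. u y * (gradient \<phi> y \<bullet> i))"
      by (rule lebesgue_on_eq_lborel(1)[OF _ Us]) (use uz in simp_all)
    moreover have "(LINT y|lebesgue_on U. (G y \<bullet> i) * \<phi> y) = (LINT y|lborel. (G y \<bullet> i) * \<phi> y)"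
      by (rule lebesgue_on_eq_lborel(1)[OF _ Us]) (use Gz in simp_all)
    ultimately show "(LINT y|lebesgue_on U. u y * (gradient \<phi> y \<bullet> i)) = - (LINT y|lebesgue_on U. (G y \<bullet> i) * \<phi> y)"
      by simp
  qed
  have e1: "(LINT y|lebesgue_on U. (x n y - u y)\<^sup>2) = (LINT y|lborel. (x n y - u y)\<^sup>2)" for n
    by (rule lebesgue_on_eq_lborel(1)[OF _ Us]) (use uz xz in simp_all)
  have e2: "(LINT y|lebesgue_on U. (norm (gradient (x n) y - G y))\<^sup>2) = (LINT y|lborel. (norm (gradient (x n) y - G y))\<^sup>2)" for n
    by (rule lebesgue_on_eq_lborel(1)[OF _ Us]) (use Gz xz in simp_all)
  show "u \<in> W12_0 U"
    unfolding W12_0_def W12_def mem_Collect_eq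
  proof (intro conjI L2u exI[of _ G] exI[of _ x] wg L2G allI x)
    show "(\<lambda>k. LINT y|lebesgue_on U. (x k y - u y)\<^sup>2) \<longlonglongrightarrow> 0" unfolding e1 by (rule xu)
    show "(\<lambda>k. LINT y|lebesgue_on U. (norm (gradient (x k) y - G y))\<^sup>2) \<longlonglongrightarrow> 0" unfolding e2 by (rule xG)
  qed
qed

section \<open>The variational problem\<close>

text \<open>The bump around \<open>c\<close> is used here as a C^1 function. A smooth approximation
  within half of its value at \<open>c\<close> cannot vanish there.\<close>

lemma test_function_exists:
  fixes U :: "'a::euclidean_space set"
  assumes "open U" "U \<noteq> {}"
  obtains g where "g \<in> test_functions U" "g \<noteq> (\<lambda>x. 0)"
proof -
  obtain c r where cr: "0 < r" "cball c r \<subseteq> U" using assms open_contains_cball by blast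
  define f where "f y = exp_bump 0 (r\<^sup>2 - (y - c) \<bullet> (y - c))" for y
  have "f \<in> C1c U"
    unfolding C1c_def mem_Collect_eq
  proof (intro conjI exI[of _ "cball c r"] compact_cball cr(2) allI impI)
    show "Ck 1 f"
      unfolding f_def[abs_def]
    proof (rule Ck_1_exp_bump, rule Ck_1I)
      show "((\<lambda>x. r\<^sup>2 - (x - c) \<bullet> (x - c)) has_derivative (\<lambda>h. ((-2) *\<^sub>R (x - c)) \<bullet> h)) (at x)" for x
        by (auto intro!: derivative_eq_intros simp: inner_commute)
    qed (auto intro!: continuous_intros)
    fix y assume "y \<notin> cball c r"
    then have "r < norm (y - c)" by (simp add: dist_norm norm_minus_commute)
    then have "r\<^sup>2 \<le> (norm (y - c))\<^sup>2" using cr(1) by (intro power_mono) auto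
    then show "f y = 0" by (simp add: f_def exp_bump_def power2_norm_eq_inner)
  qed
  then obtain K where app: "\<And>e. 0 < e \<Longrightarrow> \<exists>g\<in>test_functions U. (\<forall>x. x \<notin> K \<longrightarrow> g x = 0) \<and>
        (\<forall>x. \<bar>g x - f x\<bar> \<le> e \<and> norm (gradient g x - gradient f x) \<le> e)"
    using smooth_approximation[OF _ assms(1)] by metis
  have fc: "0 < f c" using cr(1) by (simp add: f_def exp_bump_pos_iff)
  then obtain g where g: "g \<in> test_functions U" "\<bar>g c - f c\<bar> \<le> f c / 2" using app[of "f c / 2"] by auto
  have "g c \<noteq> 0" using g(2) fc by auto
  then have "g \<noteq> (\<lambda>x. 0)" by auto
  then show ?thesis using that g(1) by blast
qed

text \<open>Allows every nonzero test function to be rescaled to weighted integral 1.\<close>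

lemma weighted_power_pos:
  fixes u :: "'a::euclidean_space \<Rightarrow> real"
  assumes "u \<in> C1c U" "u \<noteq> (\<lambda>x. 0)" "continuous_on U w" "\<And>x. 0 \<le> w x" "\<And>x. x \<in> U \<Longrightarrow> 0 < w x" "0 < p"
  shows "0 < weighted_power w p u"
proof -
  obtain K where K: "K \<subseteq> U" "\<forall>x. x \<notin> K \<longrightarrow> u x = 0" "continuous_on UNIV u" using assms(1) by (rule C1cE)
  show ?thesis
    unfolding weighted_power_def
  proof (rule integral_pos_on_open[OF C1c_integrable_weighted[OF assms(1,3,6)]])
    show "open {x. u x \<noteq> 0}" by (rule open_Collect_neq[OF K(3) continuous_on_const])
    show "{x. u x \<noteq> 0} \<noteq> {}" using assms(2) by auto
    show "0 \<le> w x * \<bar>u x\<bar> powr p" for x using assms(4) by simp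
    fix x assume "x \<in> {x. u x \<noteq> 0}"
    then have "u x \<noteq> 0" "x \<in> U" using K by blast+
    then show "0 < w x * \<bar>u x\<bar> powr p" using assms(5) by simp
  qed
qed

lemma energy_cmult:
  assumes "u \<in> C1c U" shows "energy (\<lambda>x. c * u x) = c\<^sup>2 * energy u"
proof -
  have "gradient (\<lambda>x. c * u x) x = c *\<^sub>R gradient u x" for x
    using assms by (intro gradient_cmult) (auto elim!: C1cE intro: Ck_1_differentiable)
  then show ?thesis by (simp add: energy_def power_mult_distrib)
qed

lemma weighted_power_cmult: "weighted_power w p (\<lambda>x. c * u x) = \<bar>c\<bar> powr p * weighted_power w p u"
  by (simp add: weighted_power_def abs_mult powr_mult mult.left_commute[of _ "\<bar>c\<bar> powr p"])

theorem proposition1p4: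
  fixes \<Omega> :: "((real^'n) \<times> real) set" and \<beta> :: real
  assumes "open \<Omega>" and "connected \<Omega>" and "\<Omega> \<noteq> {}" and "bounded \<Omega>"
    and "C1_boundary \<Omega>"
    and "0 \<le> \<beta>"
    and "CARD('n) \<ge> 2 \<Longrightarrow> \<beta> \<le> 2 * (real CARD('n) + 1) / (real CARD('n) - 1)"
    and "\<mu> \<beta> \<Omega> < \<mu> \<beta> (half_space :: ((real^'n) \<times> real) set)"
  shows "\<mu>_achieved \<beta> \<Omega>"
proof -
  define N where "N = real CARD('n) + 1"
  \<comment> \<open>\<open>q\<close> is the reciprocal of the exponent s of \<Phi>. The power of
    \<open>\<bar>u\<bar>\<close> becomes \<open>2 * q\<close>, so the denominator of the quotient is
    the weighted \<open>L^q\<close> norm of \<open>u^2\<close>.\<close>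
  define q where "q = (N + \<beta>) / N"
  define \<sigma> where "\<sigma> = 2 - (real CARD('n) - 1) / N * \<beta>"
  define w where "w = boundary_weight \<sigma> \<Omega>"
  define \<mu>0 where "\<mu>0 = \<mu> \<beta> \<Omega>"
  define \<mu>H where "\<mu>H = \<mu> \<beta> (half_space :: ((real^'n) \<times> real) set)"
  have N: "0 < N" by (simp add: N_def)
  have q: "1 \<le> q" using N assms(6) by (simp add: q_def)
  have q2: "2 + 2 * \<beta> / N = 2 * q" using N by (simp add: q_def add_divide_distrib distrib_left)
  have q1: "N / (N + \<beta>) = 1 / q" by (simp add: q_def)
  \<comment> \<open>The upper bound on \<beta> is used exactly here; for \<open>CARD('n) = 1\<close>
    the factor \<open>CARD('n) - 1\<close> vanishes and \<sigma> is 2.\<close>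
  have \<sigma>: "0 \<le> \<sigma>"
  proof (cases "CARD('n) \<ge> 2")
    case True
    then have c: "0 < real CARD('n) - 1" by simp
    have "\<beta> \<le> 2 * N / (real CARD('n) - 1)" using assms(7)[OF True] by (simp add: N_def)
    then have "\<beta> * (real CARD('n) - 1) \<le> 2 * N" using c by (simp add: pos_le_divide_eq)
    then have "(real CARD('n) - 1) * \<beta> / N \<le> 2" using N by (simp add: pos_divide_le_eq mult.commute)
    then show ?thesis by (simp add: \<sigma>_def)
  next
    case False
    moreover have "0 < CARD('n)" by simp
    ultimately have "CARD('n) = 1" by linarith
    then show ?thesis by (simp add: \<sigma>_def)
  qed
  \<comment> \<open>\<open>infdist\<close> to the empty set is 0 by convention, so positivity of the
    weight rests on the frontier being nonempty.\<close>
  have fr: "frontier \<Omega> \<noteq> {}"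
    using assms(3,4) frontier_eq_empty[of \<Omega>] not_bounded_UNIV by metis
  have wc: "continuous_on \<Omega> w" unfolding w_def by (rule boundary_weight_continuous[OF assms(1) fr])
  have w0: "0 \<le> w x" for x by (simp add: w_def boundary_weight_nonneg)
  have wm[measurable]: "w \<in> borel_measurable borel" by (simp add: w_def)
  have wpos: "0 < w x" if "x \<in> \<Omega>" for x
    using infdist_frontier_pos[OF assms(1) fr that] by (simp add: w_def boundary_weight_def)
  have p: "0 < 2 * q" using q by simp
  have J: "J \<beta> \<Omega> u (gradient u) = energy u / weighted_power w (2 * q) u powr (1 / q)" if "u \<in> test_functions \<Omega>" for u
    using J_test_function[OF assms(1) that, of \<beta>] unfolding N_def[symmetric] \<sigma>_def[symmetric] q2 q1 w_def .
  let ?T = "test_functions \<Omega> - {\<lambda>x. 0}"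
  have ne: "?T \<noteq> {}" using test_function_exists[OF assms(1,3)] by blast
  have bdd: "bdd_below ((\<lambda>u. J \<beta> \<Omega> u (gradient u)) ` ?T)"
    by (rule bdd_belowI[of _ 0]) (auto simp: J energy_nonneg)
  have \<mu>00: "0 \<le> \<mu>0"
    unfolding \<mu>0_def \<mu>_def by (rule cINF_greatest[OF ne]) (auto simp: J energy_nonneg)
  \<comment> \<open>Positivity of the half-space constant comes from the strict gap, as \<mu>0 is
    nonnegative.\<close>
  have \<mu>H: "\<mu>0 < \<mu>H" "0 < \<mu>H" using assms(8) \<mu>00 by (auto simp: \<mu>0_def \<mu>H_def)
  have low: "\<mu>0 * weighted_power w (2 * q) g powr (1 / q) \<le> energy g" if "g \<in> test_functions \<Omega>" for g
    using \<mu>_le_energy[OF assms(1) that, of \<beta>]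
    unfolding N_def[symmetric] \<sigma>_def[symmetric] q2 q1 w_def[symmetric] \<mu>0_def[symmetric] .
  have "\<exists>v. v \<in> test_functions \<Omega> \<and> weighted_power w (2 * q) v = 1 \<and> energy v < \<mu>0 + 1 / real (Suc k)" for k
  proof -
    have "(INF u\<in>?T. J \<beta> \<Omega> u (gradient u)) < \<mu>0 + 1 / real (Suc k)" by (simp add: \<mu>0_def \<mu>_def)
    then obtain u where u: "u \<in> test_functions \<Omega>" "u \<noteq> (\<lambda>x. 0)" "J \<beta> \<Omega> u (gradient u) < \<mu>0 + 1 / real (Suc k)"
      using cINF_less_iff[OF ne bdd] by blast
    have uC: "u \<in> C1c \<Omega>" by (rule test_functions_C1c[OF u(1)])
    let ?P = "weighted_power w (2 * q) u"
    have P: "0 < ?P" by (rule weighted_power_pos[OF uC u(2) wc w0 wpos p])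
    \<comment> \<open>The weighted integral is homogeneous of degree \<open>2 * q\<close>, so this
      factor normalizes it to 1. The quotient is unaffected, hence the new energy equals the old
      quotient.\<close>
    define c where "c = ?P powr (- (1 / (2 * q)))"
    have c: "0 < c" using P by (simp add: c_def)
    have "c powr (2 * q) = ?P powr (-1)" using q by (simp add: c_def powr_powr)
    then have "weighted_power w (2 * q) (\<lambda>x. c * u x) = 1"
      using P c powr_minus[of ?P 1] by (simp add: weighted_power_cmult)
    moreover have "energy (\<lambda>x. c * u x) < \<mu>0 + 1 / real (Suc k)"
    proof -
      have "c\<^sup>2 = ?P powr (- (1 / q))"
        by (simp add: c_def power2_eq_square flip: powr_add)
      then have "energy (\<lambda>x. c * u x) = J \<beta> \<Omega> u (gradient u)"
        by (simp add: energy_cmult[OF uC] J[OF u(1)] powr_minus divide_inverse mult.commute)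
      then show ?thesis using u(3) by simp
    qed
    ultimately show ?thesis using test_functions_cmult[OF u(1)] by blast
  qed
  then obtain v where v: "\<And>k. v k \<in> test_functions \<Omega>" "\<And>k. weighted_power w (2 * q) (v k) = 1"
    "\<And>k. energy (v k) < \<mu>0 + 1 / real (Suc k)" by metis
  have Ev: "(\<lambda>k. energy (v k)) \<longlonglongrightarrow> \<mu>0"
  proof (rule tendsto_sandwich)
    show "\<forall>\<^sub>F k in sequentially. \<mu>0 \<le> energy (v k)" using low[OF v(1)] by (simp add: v(2))
    show "\<forall>\<^sub>F k in sequentially. energy (v k) \<le> \<mu>0 + 1 / real (Suc k)" using v(3) by (simp add: less_imp_le)
    show "(\<lambda>k. \<mu>0 + 1 / real (Suc k)) \<longlonglongrightarrow> \<mu>0"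
      using tendsto_add[OF tendsto_const[of \<mu>0] LIMSEQ_Suc[OF lim_1_over_n]] by simp
  qed simp
  \<comment> \<open>Five powers of \<open>1 + e\<close> are lost: four in the charts and one from
    the partition of unity, which is used with \<open>\<eta> = e\<close>.\<close>
  obtain e where e: "0 < e" "\<mu>0 * (1 + e) ^ 5 < \<mu>H"
  proof -
    have "((\<lambda>e. \<mu>0 * (1 + e) ^ 5) \<longlongrightarrow> \<mu>0 * (1 + 0) ^ 5) (at_right (0::real))" by (intro tendsto_intros)
    then have "\<forall>\<^sub>F e in at_right 0. \<mu>0 * (1 + e) ^ 5 < \<mu>H"
      by (rule order_tendstoD(2)) (use \<mu>H in simp)
    moreover have "\<forall>\<^sub>F e in at_right (0::real). 0 < e" by (rule eventually_at_right_less)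
    ultimately have "\<forall>\<^sub>F e in at_right 0. 0 < e \<and> \<mu>0 * (1 + e) ^ 5 < \<mu>H" by eventually_elim simp
    from eventually_happens'[OF trivial_limit_at_right_real this] show ?thesis using that by blast
  qed
  define A where "A = (1 + e) ^ 4 / \<mu>H"
  have A: "0 < A" using e \<mu>H by (simp add: A_def)
  have loc: "\<exists>r>0. \<forall>u\<in>C1c (\<Omega> \<inter> ball x0 r). weighted_power w (2 * q) u powr (1 / q) \<le> A * energy u"
    if x0: "x0 \<in> closure \<Omega>" for x0
  proof -
    have H0: "0 \<le> \<mu> \<beta> (half_space :: ((real^'n) \<times> real) set)" using \<mu>H by (simp add: \<mu>H_def)
    obtain r where r: "0 < r" "\<And>u. u \<in> C1c (\<Omega> \<inter> ball x0 r) \<Longrightarrow>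
      \<mu> \<beta> (half_space :: ((real^'n) \<times> real) set) *
      weighted_power (boundary_weight (2 - (real CARD('n) - 1) / (real CARD('n) + 1) * \<beta>) \<Omega>) (2 + 2 * \<beta> / (real CARD('n) + 1)) u powr
         ((real CARD('n) + 1) / (real CARD('n) + 1 + \<beta>)) \<le> (1 + e) ^ 4 * energy u"
      using local_inequality[OF assms(1,5) fr x0 assms(6) H0 e(1)] \<sigma> unfolding \<sigma>_def N_def by blast
    have "weighted_power w (2 * q) u powr (1 / q) \<le> A * energy u" if "u \<in> C1c (\<Omega> \<inter> ball x0 r)" for u
    proof -
      have "\<mu>H * weighted_power w (2 * q) u powr (1 / q) \<le> (1 + e) ^ 4 * energy u"
        using r(2)[OF that] unfolding N_def[symmetric] \<sigma>_def[symmetric] q2 q1 w_def[symmetric] \<mu>H_def[symmetric] .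
      then show ?thesis using \<mu>H(2) by (simp add: A_def pos_le_divide_eq mult.commute)
    qed
    then show ?thesis using r(1) by blast
  qed
  obtain C where C: "0 \<le> C" "\<And>u. u \<in> C1c \<Omega> \<Longrightarrow>
      weighted_power w (2 * q) u powr (1 / q) \<le> (1 + e) * A * energy u + C * sqnorm u"
    using global_inequality[OF assms(1,4,3) wc w0 q less_imp_le[OF A] e(1) loc] by blast
  \<comment> \<open>The reciprocal of \<open>(1 + e) * A\<close>: multiplying the global inequality
    by it leaves coefficient 1 in front of the energy, and the choice of \<open>e\<close> keeps it
    above \<mu>0.\<close>
  define \<kappa> where "\<kappa> = \<mu>H / (1 + e) ^ 5"
  have e5: "0 < (1 + e) ^ 5" using e by simp
  have \<kappa>: "\<mu>0 < \<kappa>" using e(2) e5 by (simp add: \<kappa>_def pos_less_divide_eq)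
  have \<kappa>A: "\<kappa> * ((1 + e) * A) = 1"
  proof -
    have "(1 + e) * (1 + e) ^ 4 = (1 + e) ^ 5" by (simp add: power_Suc[symmetric] del: power_Suc)
    then have "\<kappa> * ((1 + e) * A) = (\<mu>H / (1 + e) ^ 5) * ((1 + e) ^ 5 / \<mu>H)" by (simp add: \<kappa>_def A_def)
    also have "\<dots> = 1" using \<mu>H(2) e5 by simp
    finally show ?thesis .
  qed
  have \<kappa>0: "0 \<le> \<kappa>" using \<kappa> \<mu>00 by simp
  have glob: "\<kappa> * weighted_power w (2 * q) g powr (1 / q) \<le> energy g + (\<kappa> * C) * sqnorm g" if "g \<in> test_functions \<Omega>" for g
  proof -
    have "\<kappa> * weighted_power w (2 * q) g powr (1 / q) \<le> \<kappa> * ((1 + e) * A * energy g + C * sqnorm g)"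
      by (rule mult_left_mono[OF C(2)[OF test_functions_C1c[OF that]] \<kappa>0])
    also have "\<dots> = \<kappa> * ((1 + e) * A) * energy g + (\<kappa> * C) * sqnorm g" by (simp only: distrib_left mult.assoc)
    finally show ?thesis by (simp only: \<kappa>A mult_1)
  qed
  have \<kappa>C: "0 \<le> \<kappa> * C" using \<kappa>0 C(1) by simp
  obtain u G x where u: "u \<in> borel_measurable borel" "\<forall>y. y \<notin> \<Omega> \<longrightarrow> u y = 0" "integrable lborel (\<lambda>y. (u y)\<^sup>2)"
    and G: "G \<in> borel_measurable borel" "\<forall>y. y \<notin> \<Omega> \<longrightarrow> G y = 0" "integrable lborel (\<lambda>y. (norm (G y))\<^sup>2)"
    and x: "\<And>n::nat. x n \<in> test_functions \<Omega>" "(\<lambda>n. LINT y|lborel. (x n y - u y)\<^sup>2) \<longlonglongrightarrow> 0"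
      "(\<lambda>n. LINT y|lborel. (norm (gradient (x n) y - G y))\<^sup>2) \<longlonglongrightarrow> 0"
    and iu: "integrable lborel (\<lambda>y. w y * \<bar>u y\<bar> powr (2 * q))" and Pu: "weighted_power w (2 * q) u = 1"
    and EG: "(LINT y|lborel. (norm (G y))\<^sup>2) = \<mu>0"
    using minimizer_exists[OF assms(4) wc w0 wm q \<mu>00 low v(1,2) Ev \<kappa> \<kappa>C glob] by blast
  note W = W12_0_limit[OF assms(1,4) u G x]
  have Us: "\<Omega> \<in> sets borel" using assms(1) by simp
  have wd: "weighted_density \<beta> \<Omega> u = (\<lambda>y. w y * \<bar>u y\<bar> powr (2 * q))"
    unfolding weighted_density_eq[abs_def] N_def[symmetric] \<sigma>_def[symmetric] q2 w_def ..
  have m: "(\<lambda>y. w y * \<bar>u y\<bar> powr (2 * q)) \<in> borel_measurable borel" using u(1) by measurable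
  have z: "\<forall>y. y \<notin> \<Omega> \<longrightarrow> w y * \<bar>u y\<bar> powr (2 * q) = 0" using u(2) by simp
  have int: "integrable (lebesgue_on \<Omega>) (weighted_density \<beta> \<Omega> u)"
    unfolding wd lebesgue_on_eq_lborel(2)[OF m Us z] by (rule iu)
  have one: "(LINT y|lebesgue_on \<Omega>. weighted_density \<beta> \<Omega> u y) = 1"
    using lebesgue_on_eq_lborel(1)[OF m Us z] Pu by (simp add: wd weighted_power_def)
  have "(LINT y|lebesgue_on \<Omega>. (norm (G y))\<^sup>2) = \<mu>0"
    using lebesgue_on_eq_lborel(1)[OF _ Us, of "\<lambda>y. (norm (G y))\<^sup>2"] G EG by simp
  then have JG: "J \<beta> \<Omega> u G = \<mu> \<beta> \<Omega>" by (simp add: J_def Let_def one \<mu>0_def)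
  have "\<not> (AE y in lebesgue_on \<Omega>. u y = 0)"
  proof
    assume "AE y in lebesgue_on \<Omega>. u y = 0"
    then have "AE y in lebesgue_on \<Omega>. weighted_density \<beta> \<Omega> u y = 0"
      by eventually_elim (simp add: wd)
    then have "(LINT y|lebesgue_on \<Omega>. weighted_density \<beta> \<Omega> u y) = 0" by (rule integral_eq_zero_AE)
    then show False using one by simp
  qed
  then show ?thesis
    unfolding \<mu>_achieved_def using W int JG by blast
qed

end
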